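(* For each $n\ge 1$ let $\mathbf{d}^n=(d_1^n,\ldots,d_n^n)$, with $d_1^n\ge d_2^n\ge\cdots\ge d_n^n$, be the degree sequence of some simple graph on $n$ vertices, and let $G_n$ be a random graph chosen uniformly from the set of all simple graphs with degree sequence $\mathbf{d}^n$. Suppose that the sequence $\{\mathbf{d}^n\}$ converges to the scaling limit $f\in D'[0,1]$, and that $f$ belongs to the topological interior of the set $\mathcal{F}$ (as a subset of $D'[0,1]$ with the topology of the modified $L^1$ norm $\|\cdot\|_{1'}$). Then there exists a unique function $g:[0,1]\to\mathbb{R}$ in $D'[0,1]$ such that the function $$W(x,y):=\frac{e^{g(x)+g(y)}}{1+e^{g(x)+g(y)}}$$ satisfies, for all $x\in[0,1]$, $$f(x)=\int_0^1 W(x,y)\,dy.$$ In this situation, the sequence $\{G_n\}$ converges almost surely to the limit graph represented by the function $W$.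
   Context: Graphs are undirected and simple. The degree sequence of a graph on vertices $1,\ldots,n$ is the vector of degrees $(d_1,\ldots,d_n)$ of its vertices. $D'[0,1]$ denotes the set of nonincreasing real functions on $[0,1]$ which are left continuous on $(0,1)$. It is endowed with the topology induced by the modified $L^1$ norm $$\|f\|_{1'}:=|f(0)|+|f(1)|+\int_0^1|f(x)|\,dx .$$ Scaling limit: a sequence of degree sequences $\mathbf{d}^n=(d_1^n\ge\cdots\ge d_n^n)$ (one for each $n$) has scaling limit $f$, where $f$ is a nonincreasing function on $[0,1]$, if $$\lim_{n\to\infty}\left(\left|\frac{d_1^n}{n}-f(0)\right|+\left|\frac{d_n^n}{n}-f(1)\right|+\frac1n\sum_{i=1}^n\left|\frac{d_i^n}{n}-f\left(\frac in\right)\right|\right)=0 .$$ $\mathcal{F}$ is the set of functions in $D'[0,1]$ that can be obtained as scaling limits, in this sense, of degree sequences of simple graphs. Graph limits: for finite simple graphs $H,G$ let $|\hom(H,G)|$ be the number of homomorphisms (edge-preserving maps $V(H)\to V(G)$) and $t(H,G):=|\hom(H,G)|/|V(G)|^{|V(H)|}$. For a symmetric measurable $W:[0,1]^2\to[0,1]$ and a simple graph $H$ with $V(H)=\{1,\ldots,k\}$ and edge set $E(H)$ let $$t(H,W)=\int_{[0,1]^k}\prod_{(i,j)\in E(H)}W(x_i,x_j)\,dx_1\cdots dx_k .$$ A sequence of graphs $G_n$ converges to the limit graph represented by $W$ if $t(H,G_n)\to t(H,W)$ for every finite simple graph $H$. *)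

theory Defs
  imports "HOL-Probability.Probability"
begin

section \<open>Finite simple graphs and degree sequences\<close>

text \<open>A graph is a pair of a vertex set and a set of edges, an edge being a two-element set of
  vertices.\<close>

type_synonym 'a graph = "'a set \<times> 'a set set"

abbreviation verts :: "'a graph \<Rightarrow> 'a set" where "verts \<equiv> fst"
abbreviation edges :: "'a graph \<Rightarrow> 'a set set" where "edges \<equiv> snd"

definition simple_graph :: "'a graph \<Rightarrow> bool" where
  "simple_graph G \<longleftrightarrow> finite (verts G) \<and> edges G \<subseteq> {e. e \<subseteq> verts G \<and> card e = 2}"

definition vertex_degree :: "'a graph \<Rightarrow> 'a \<Rightarrow> nat" where
  "vertex_degree G v = card {e \<in> edges G. v \<in> e}"

text \<open>A vector of length \<open>n\<close> is a function on \<open>nat\<close> of which only the values on \<open>{1..n}\<close>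
  matter.\<close>

definition graphs_with_degrees :: "nat \<Rightarrow> (nat \<Rightarrow> nat) \<Rightarrow> nat graph set" where
  "graphs_with_degrees n d =
    {G. simple_graph G \<and> verts G = {1..n} \<and> (\<forall>i\<in>{1..n}. vertex_degree G i = d i)}"

definition ordered_degree_sequence :: "nat \<Rightarrow> (nat \<Rightarrow> nat) \<Rightarrow> bool" where
  "ordered_degree_sequence n d \<longleftrightarrow>
    antimono_on {1..n} d \<and> graphs_with_degrees n d \<noteq> {}"


section \<open>The space $D'[0,1]$ and scaling limits\<close>

text \<open>Functions on $[0,1]$ are extensional, so that equality in \<open>Dprime\<close> is equality on
  $[0,1]$.\<close>

definition Dprime :: "(real \<Rightarrow> real) set" where
  "Dprime = {f \<in> extensional {0..1}.
     antimono_on {0..1} f \<and> (\<forall>x\<in>{0<..<1}. continuous (at_left x) f)}"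

definition norm1' :: "(real \<Rightarrow> real) \<Rightarrow> real" where
  "norm1' f = \<bar>f 0\<bar> + \<bar>f 1\<bar> + (LBINT x:{0..1}. \<bar>f x\<bar>)"

definition dist1' :: "(real \<Rightarrow> real) \<Rightarrow> (real \<Rightarrow> real) \<Rightarrow> real" where
  "dist1' f g = norm1' (\<lambda>x. f x - g x)"

lemma Dprime_set_integrable:
  assumes "f \<in> Dprime"
  shows "set_integrable lborel {0..1} f"
proof -
  have mono: "antimono_on {0..1} f"
    using assms by (simp add: Dprime_def)
  have "mono_on {0..1} (\<lambda>x. - f x)"
    using mono by (simp add: monotone_on_def)
  then have "(\<lambda>x. - f x) \<in> borel_measurable (restrict_space borel {0..1})"
    by (rule borel_measurable_mono_on_fnc)
  then have "f \<in> borel_measurable (restrict_space borel {0..1})"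
    by (simp add: borel_measurable_uminus_eq)
  then have meas: "set_borel_measurable lborel {0..1} f"
    by (simp add: set_borel_measurable_def borel_measurable_restrict_space_iff)
  have bnd: "norm (f x) \<le> norm (\<bar>f 0\<bar> + \<bar>f 1\<bar>)" if "x \<in> {0..1}" for x
  proof -
    have "f x \<le> f 0" "f 1 \<le> f x"
      using that by (auto intro!: monotone_onD[OF mono])
    then show ?thesis by simp
  qed
  show ?thesis
    by (rule set_integrable_bound[where f="\<lambda>_. \<bar>f 0\<bar> + \<bar>f 1\<bar>"])
      (use meas bnd in \<open>auto simp: set_integrable_def\<close>)
qed

lemma dist1'_eq_0D:
  assumes "f \<in> Dprime" "g \<in> Dprime" "dist1' f g = 0"
  shows "f = g"
proof
  fix x :: real
  let ?h = "\<lambda>x. f x - g x"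
  have int: "set_integrable lborel {0..1} (\<lambda>x. \<bar>?h x\<bar>)"
    using assms by (intro set_integrable_abs set_integral_diff Dprime_set_integrable)
  have nn: "0 \<le> (LBINT x:{0..1}. \<bar>?h x\<bar>)"
    unfolding set_lebesgue_integral_def by (rule Bochner_Integration.integral_nonneg) simp
  with assms(3) have ends: "?h 0 = 0" "?h 1 = 0" and "(LBINT x:{0..1}. \<bar>?h x\<bar>) = 0"
    unfolding dist1'_def norm1'_def by linarith+
  then have ae: "AE x in lborel. indicator {0..1} x *\<^sub>R \<bar>?h x\<bar> = 0"
    using int unfolding set_lebesgue_integral_def set_integrable_def
    by (subst (asm) integral_nonneg_eq_0_iff_AE) auto
  consider "x \<notin> {0..1}" | "x = 0" | "x = 1" | "x \<in> {0<..<1}" by force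
  then show "f x = g x"
  proof cases
    case 1
    then show ?thesis using assms by (simp add: Dprime_def extensional_def)
  next
    case 4
    show ?thesis
    proof (rule ccontr)
      assume ne: "f x \<noteq> g x"
      have "continuous (at_left x) ?h"
        using assms 4 by (intro continuous_diff) (auto simp: Dprime_def)
      then have "(?h \<longlongrightarrow> ?h x) (at_left x)"
        by (simp add: continuous_within)
      then have "eventually (\<lambda>y. ?h y \<noteq> 0) (at_left x)"
        using ne by (intro tendsto_imp_eventually_ne) auto
      then obtain b where b: "b < x" "\<And>y. b < y \<Longrightarrow> y < x \<Longrightarrow> ?h y \<noteq> 0"
        unfolding eventually_at_left_field by blast
      let ?I = "{max b 0<..<x}"
      have "AE y in lborel. y \<notin> ?I"
        using ae by eventually_elim (use b 4 in \<open>auto simp: indicator_def split: if_splits\<close>)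
      then have "emeasure lborel ?I = 0"
        by (subst (asm) AE_iff_measurable[where N="?I"]) auto
      then show False using b 4 by (simp add: max_def split: if_splits)
    qed
  qed (use ends in auto)
qed

lemma Metric_space_Dprime: "Metric_space Dprime dist1'"
proof
  show "0 \<le> dist1' f g" for f g
    unfolding dist1'_def norm1'_def set_lebesgue_integral_def
    by (intro add_nonneg_nonneg Bochner_Integration.integral_nonneg) auto
  show "dist1' f g = dist1' g f" for f g
    by (simp add: dist1'_def norm1'_def abs_minus_commute)
  show "dist1' f g = 0 \<longleftrightarrow> f = g" if "f \<in> Dprime" "g \<in> Dprime" for f g
    using dist1'_eq_0D[OF that] by (auto simp: dist1'_def norm1'_def)
  show "dist1' f h \<le> dist1' f g + dist1' g h"
    if "f \<in> Dprime" "g \<in> Dprime" "h \<in> Dprime" for f g h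
  proof -
    have int: "set_integrable lborel {0..1} (\<lambda>x. \<bar>u x - v x\<bar>)"
      if "u \<in> Dprime" "v \<in> Dprime" for u v
      using that by (intro set_integrable_abs set_integral_diff Dprime_set_integrable)
    have "(LBINT x:{0..1}. \<bar>f x - h x\<bar>) \<le> (LBINT x:{0..1}. \<bar>f x - g x\<bar> + \<bar>g x - h x\<bar>)"
      using that by (intro set_integral_mono set_integral_add int) auto
    also have "\<dots> = (LBINT x:{0..1}. \<bar>f x - g x\<bar>) + (LBINT x:{0..1}. \<bar>g x - h x\<bar>)"
      using that by (intro set_integral_add int)
    finally show ?thesis
      unfolding dist1'_def norm1'_def by linarith
  qed
qed

definition Dprime_topology :: "(real \<Rightarrow> real) topology" where
  "Dprime_topology = Metric_space.mtopology Dprime dist1'"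

definition scaling_limit :: "(nat \<Rightarrow> nat \<Rightarrow> nat) \<Rightarrow> (real \<Rightarrow> real) \<Rightarrow> bool" where
  "scaling_limit d f \<longleftrightarrow>
    (\<lambda>n. \<bar>real (d n 1) / real n - f 0\<bar> + \<bar>real (d n n) / real n - f 1\<bar>
        + (1 / real n) * (\<Sum>i=1..n. \<bar>real (d n i) / real n - f (real i / real n)\<bar>))
      \<longlonglongrightarrow> 0"

definition scaling_limits :: "(real \<Rightarrow> real) set" where
  "scaling_limits = {f \<in> Dprime.
     \<exists>d. (\<forall>n\<ge>1. ordered_degree_sequence n (d n)) \<and> scaling_limit d f}"


section \<open>Graph limits\<close>

definition homs :: "'a graph \<Rightarrow> 'b graph \<Rightarrow> ('a \<Rightarrow> 'b) set" where
  "homs H G = {\<phi> \<in> verts H \<rightarrow>\<^sub>E verts G.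
     \<forall>u v. {u, v} \<in> edges H \<longrightarrow> {\<phi> u, \<phi> v} \<in> edges G}"

definition hom_density :: "'a graph \<Rightarrow> 'b graph \<Rightarrow> real" where
  "hom_density H G = real (card (homs H G)) / real (card (verts G)) ^ card (verts H)"

definition graphon :: "(real \<Rightarrow> real \<Rightarrow> real) \<Rightarrow> bool" where
  "graphon W \<longleftrightarrow>
    (\<lambda>(x, y). W x y) \<in> borel_measurable (restrict_space borel ({0..1} \<times> {0..1})) \<and>
    (\<forall>x\<in>{0..1}. \<forall>y\<in>{0..1}. W x y = W y x \<and> W x y \<in> {0..1})"

text \<open>Each undirected edge contributes exactly one factor, indexed by its increasing pair of
  end points.\<close>

definition graphon_density :: "nat graph \<Rightarrow> (real \<Rightarrow> real \<Rightarrow> real) \<Rightarrow> real" where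
  "graphon_density H W =
    (\<integral>x. (\<Prod>(i, j) \<in> {(i, j). i < j \<and> {i, j} \<in> edges H}. W (x i) (x j))
      \<partial>(\<Pi>\<^sub>M i\<in>verts H. restrict_space lborel {0..1}))"

definition converges_to_graphon ::
    "(nat \<Rightarrow> 'a graph) \<Rightarrow> (real \<Rightarrow> real \<Rightarrow> real) \<Rightarrow> bool" where
  "converges_to_graphon G W \<longleftrightarrow> graphon W \<and>
    (\<forall>H k. simple_graph H \<and> verts H = {1..k} \<longrightarrow>
      (\<lambda>n. hom_density H (G n)) \<longlonglongrightarrow> graphon_density H W)"


section \<open>Random graphs and the limit function\<close>

text \<open>Nothing is assumed about the joint law of a sequence of such random graphs.\<close>

definition uniform_random_graph ::
    "'w measure \<Rightarrow> nat \<Rightarrow> (nat \<Rightarrow> nat) \<Rightarrow> ('w \<Rightarrow> nat graph) \<Rightarrow> bool" where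
  "uniform_random_graph M n d G \<longleftrightarrow>
    G \<in> measurable M (count_space (graphs_with_degrees n d)) \<and>
    distr M (count_space (graphs_with_degrees n d)) G
      = uniform_count_measure (graphs_with_degrees n d)"

definition beta_graphon :: "(real \<Rightarrow> real) \<Rightarrow> real \<Rightarrow> real \<Rightarrow> real" where
  "beta_graphon g x y = exp (g x + g y) / (1 + exp (g x + g y))"

definition solves_limit_equation :: "(real \<Rightarrow> real) \<Rightarrow> (real \<Rightarrow> real) \<Rightarrow> bool" where
  "solves_limit_equation f g \<longleftrightarrow>
    (\<forall>x\<in>{0..1}. f x = (LBINT y:{0..1}. beta_graphon g x y))"

end

theory Submission
  imports Defs "HOL-Real_Asymp.Real_Asymp"
begin

text \<open>
  Write $\sigma(s) = e^s / (1 + e^s)$ and $K_u(s) = \int_0^1 \sigma(s + u(y))\,dy$, so that the limit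
  equation reads $f(x) = K_g(g(x))$.

  Uniqueness is monotonicity: for two solutions with difference $k$, integrating
  $(\sigma(g(x) + g(y)) - \sigma(h(x) + h(y)))\,(k(x) + k(y)) \ge 0$ gives $0$.

  Existence. Every scaling limit $h$ satisfies
  $\int h u \le \frac12 \iint (u(x) + u(y))^+$ for nonincreasing $u$. Testing this with $h = f \pm \delta$
  for a step function changing sign together with $u$ turns interiority of $f$ into the coercivity
  $\int f u + \delta \int |u| \le \frac12 \iint (u(x) + u(y))^+$. Solving $f(x) = K_b(a(x))$ for $a$,
  truncated to $[-B, B]$, is antitone in $b$, so there is a pair with $f(x) = K_b(a(x)) = K_a(b(x))$ up to
  truncation; monotonicity again makes $b - a$ a constant $c$. If $c \ne 0$ then $a + c/2$ is a solution; if
  $c = 0$ then coercivity bounds $\int |a|$ independently of $B$, and the truncation is not active.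

  Convergence. A graph with independent edges of probabilities
  $\sigma(g(i/n) + g(j/n))$ is uniform given its degrees. It is far in the cut norm from its
  expectation with probability at most $2 \cdot 4^n e^{-c n^2}$, whereas it has the prescribed degrees with
  probability at least $e^{-o(n^2)}$: a typical graph can be corrected by changing $o(n^2)$ edges. Thus
  the uniform graph is close in the cut norm up to a summable probability, and the counting lemma yields the
  convergence of all homomorphism densities.
\<close>


section \<open>The unit interval and Riemann sums\<close>

text \<open>The duality inequality comes from single graphs: pairing the degrees with a vector
  \<open>v\<close> sums \<open>v i + v j\<close> over the edges, and this is largest when the edges
  are the pairs with positive sum. Interiority enters as slack in this family of inequalities.

  The obstacle to solving the limit equation is that the natural fixed-point map is antitone. An
  order-theoretic argument then yields a 2-cycle instead of a fixed point, and it needs a complete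
  lattice, hence the truncation; both defects are repaired by analysis. The shift by
  \<open>c / 2\<close> works because \<open>logistic\<close> is applied to a sum of two potentials,
  so the two halves of the cycle can be balanced. The bound independent of \<open>B\<close> works
  because \<open>logistic s * s\<close> differs from the positive part of \<open>s\<close> by at
  most 1.

  In the convergence part everything is measured on the scale \<open>exp (- c * n^2)\<close> of cut
  deviations. The logarithm of the weight lost by correcting degrees only has to be an arbitrarily
  small multiple of \<open>n^2\<close>, so it is enough to count the graphs within a small multiple
  of \<open>n^2\<close> edits.\<close>

abbreviation unit_lebesgue :: "real measure" ("\<U>") where
  "\<U> \<equiv> restrict_space lborel {0..1}"

lemma prob_space_unit_lebesgue: "prob_space \<U>"
  by (rule prob_spaceI) (simp add: space_restrict_space emeasure_restrict_space)

interpretation U: prob_space \<U>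
  by (rule prob_space_unit_lebesgue)

interpretation UU: pair_prob_space \<U> \<U> ..

lemma space_unit_lebesgue [simp]: "space \<U> = {0..1}"
  by (simp add: space_restrict_space)

lemma LBINT_eq_unit_lebesgue: "(LBINT x:{0..1}. F x) = (\<integral>x. F x \<partial>\<U>)" for F :: "real \<Rightarrow> real"
  by (subst integral_restrict_space) (auto simp: set_lebesgue_integral_def)

lemma measurable_antimono_unit:
  fixes u :: "real \<Rightarrow> real"
  assumes "antimono_on {0..1} u"
  shows "u \<in> borel_measurable \<U>"
proof -
  have "mono_on {0..1} (\<lambda>x. - u x)"
    using assms by (simp add: monotone_on_def)
  then have "(\<lambda>x. - u x) \<in> borel_measurable (restrict_space borel {0..1})"
    by (rule borel_measurable_mono_on_fnc)
  then have "u \<in> borel_measurable (restrict_space borel {0..1})"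
    by (simp add: borel_measurable_uminus_eq)
  moreover have "sets \<U> = sets (restrict_space borel {0..1})"
    by (simp add: sets_restrict_space)
  ultimately show ?thesis
    by (simp cong: measurable_cong_sets)
qed

lemma integrable_bounded_unit:
  fixes u :: "real \<Rightarrow> real"
  assumes "u \<in> borel_measurable \<U>" "\<And>x. x \<in> {0..1} \<Longrightarrow> \<bar>u x\<bar> \<le> C"
  shows "integrable \<U> u"
  by (rule U.integrable_const_bound[where B=C]) (use assms in auto)

lemma antimono_unit_bounds:
  fixes u :: "real \<Rightarrow> real"
  assumes "antimono_on {0..1} u" "x \<in> {0..1}"
  shows "u 1 \<le> u x" "u x \<le> u 0" "\<bar>u x\<bar> \<le> \<bar>u 0\<bar> + \<bar>u 1\<bar>"
proof -
  show "u 1 \<le> u x" "u x \<le> u 0"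
    using assms by (auto intro!: monotone_onD[OF assms(1)])
  then show "\<bar>u x\<bar> \<le> \<bar>u 0\<bar> + \<bar>u 1\<bar>" by linarith
qed

lemma integrable_antimono_unit:
  fixes u :: "real \<Rightarrow> real"
  assumes "antimono_on {0..1} u"
  shows "integrable \<U> u"
  using integrable_bounded_unit measurable_antimono_unit antimono_unit_bounds(3) assms by blast

lemma integrable_mult_antimono_unit:
  fixes u v :: "real \<Rightarrow> real"
  assumes "antimono_on {0..1} u" "antimono_on {0..1} v"
  shows "integrable \<U> (\<lambda>x. u x * v x)"
proof (rule integrable_bounded_unit[where C="(\<bar>u 0\<bar> + \<bar>u 1\<bar>) * (\<bar>v 0\<bar> + \<bar>v 1\<bar>)"])
  show "(\<lambda>x. u x * v x) \<in> borel_measurable \<U>"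
    using assms by (intro borel_measurable_times measurable_antimono_unit)
  show "\<bar>u x * v x\<bar> \<le> (\<bar>u 0\<bar> + \<bar>u 1\<bar>) * (\<bar>v 0\<bar> + \<bar>v 1\<bar>)" if "x \<in> {0..1}" for x
    unfolding abs_mult using antimono_unit_bounds(3) that assms by (intro mult_mono) auto
qed

section \<open>Grid cells and the error of Riemann sums\<close>

text \<open>The cells are \<open>(i - 1) / n < x \<le> i / n\<close>, so that
  \<open>cell n x / n\<close> is the right end point, the sampling point used in
  \<open>scaling_limit\<close>. The maximum moves \<open>x = 0\<close> into the first cell.\<close>

definition cell :: "nat \<Rightarrow> real \<Rightarrow> nat" where
  "cell n x = max 1 (nat \<lceil>real n * x\<rceil>)"

lemma cell_bounds:
  assumes "n \<ge> 1" "x \<in> {0..1}"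
  shows "cell n x \<in> {1..n}" "x \<le> real (cell n x) / real n" "(real (cell n x) - 1) / real n \<le> x"
proof -
  have "real n * x \<le> real n" "0 \<le> real n * x"
    using assms by (auto simp: mult_left_le)
  moreover from this have "\<lceil>real n * x\<rceil> \<le> int n" "0 \<le> \<lceil>real n * x\<rceil>"
    by linarith+
  ultimately show "cell n x \<in> {1..n}"
    using assms by (auto simp: cell_def)
  have "real n * x \<le> real (cell n x)"
    using \<open>0 \<le> \<lceil>real n * x\<rceil>\<close> unfolding cell_def by linarith
  then show "x \<le> real (cell n x) / real n"
    using assms by (simp add: field_simps)
  have "real (cell n x) - 1 \<le> real n * x"
    using \<open>0 \<le> \<lceil>real n * x\<rceil>\<close> \<open>0 \<le> real n * x\<close> unfolding cell_def by linarith
  then show "(real (cell n x) - 1) / real n \<le> x"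
    using assms by (simp add: field_simps)
qed

lemma cell_in_unit:
  assumes "n \<ge> 1" "x \<in> {0..1}"
  shows "real (cell n x) / real n \<in> {0..1}"
  using cell_bounds(1)[OF assms] assms by (auto simp: field_simps)

lemma measurable_cell [measurable]: "cell n \<in> measurable borel (count_space UNIV)"
  unfolding cell_def by measurable

lemma measurable_cell_unit [measurable]: "cell n \<in> measurable \<U> (count_space UNIV)"
  by (intro measurable_restrict_space1) simp

lemma cell_eq_vimage:
  assumes "n \<ge> 1" "i \<in> {1..n}"
  shows "{x \<in> {0..1}. cell n x = i} = (if i = 1 then {0..1 / real n} else {(real i - 1) / real n <.. real i / real n})"
proof (intro set_eqI)
  fix x :: real
  have n: "real n > 0" using assms by simp
  show "x \<in> {x \<in> {0..1}. cell n x = i} \<longleftrightarrow>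
    x \<in> (if i = 1 then {0..1 / real n} else {(real i - 1) / real n <.. real i / real n})"
  proof (cases "x \<in> {0..1}")
    case True
    then have nx: "0 \<le> real n * x" by simp
    show ?thesis
    proof (cases "i = 1")
      case True
      have "cell n x = 1 \<longleftrightarrow> real n * x \<le> 1"
        unfolding cell_def using nx by (simp add: max_def) linarith
      then show ?thesis using True \<open>x \<in> {0..1}\<close> n by (simp add: field_simps)
    next
      case False
      then have i2: "i \<ge> 2" using assms by auto
      have "cell n x = i \<longleftrightarrow> real i - 1 < real n * x \<and> real n * x \<le> real i"
        unfolding cell_def using nx i2 by (simp add: max_def) linarith
      then show ?thesis using False \<open>x \<in> {0..1}\<close> n by (simp add: field_simps)
    qed
  next
    case False
    moreover have "y \<in> {0..1}" if "y \<in> {0..1 / real n}" for y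
    proof -
      have "1 / real n \<le> 1" using assms by simp
      with that show ?thesis by auto
    qed
    moreover have "y \<in> {0..1}" if "y \<in> {(real i - 1) / real n <.. real i / real n}" for y
    proof -
      have "0 \<le> (real i - 1) / real n" "real i / real n \<le> 1"
        using assms by (auto simp: field_simps)
      with that show ?thesis by auto
    qed
    ultimately show ?thesis by auto
  qed
qed

lemma measure_cell:
  assumes "n \<ge> 1" "i \<in> {1..n}"
  shows "(\<integral>x. (if cell n x = i then 1 else 0) \<partial>\<U>) = 1 / real n"
proof -
  have "(\<integral>x. (if cell n x = i then 1 else 0::real) \<partial>\<U>) = (\<integral>x. indicator {x \<in> {0..1}. cell n x = i} x \<partial>\<U>)"
    by (intro Bochner_Integration.integral_cong) (auto simp: indicator_def)
  also have "\<dots> = measure \<U> {x \<in> {0..1}. cell n x = i}"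
    by (simp, intro arg_cong[where f="measure \<U>"]) auto
  also have "\<dots> = measure lborel {x \<in> {0..1}. cell n x = i}"
    by (subst measure_restrict_space) auto
  also have "\<dots> = 1 / real n"
    using assms unfolding cell_eq_vimage[OF assms] by (auto simp: field_simps)
  finally show ?thesis .
qed

lemma integral_cell:
  fixes F :: "nat \<Rightarrow> real"
  assumes n: "n \<ge> 1"
  shows "(\<integral>x. F (cell n x) \<partial>\<U>) = (1 / real n) * (\<Sum>i=1..n. F i)"
    and "integrable \<U> (\<lambda>x. F (cell n x))"
proof -
  have int: "integrable \<U> (\<lambda>x. F i * (if cell n x = i then 1 else 0))" for i
    by (intro integrable_mult_right integrable_bounded_unit[where C=1]) auto
  have eq: "F (cell n x) = (\<Sum>i=1..n. F i * (if cell n x = i then 1 else 0))" if "x \<in> space \<U>" for x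
  proof -
    have "(\<Sum>i=1..n. F i * (if cell n x = i then 1 else 0)) = (\<Sum>i=1..n. if cell n x = i then F i else 0)"
      by (intro sum.cong) auto
    also have "\<dots> = F (cell n x)"
      using cell_bounds(1)[OF n, of x] that by (subst sum.delta') auto
    finally show ?thesis by simp
  qed
  have "(\<integral>x. F (cell n x) \<partial>\<U>) = (\<integral>x. (\<Sum>i=1..n. F i * (if cell n x = i then 1 else 0)) \<partial>\<U>)"
    by (rule Bochner_Integration.integral_cong[OF refl eq])
  also have "\<dots> = (\<Sum>i=1..n. F i * (\<integral>x. (if cell n x = i then 1 else 0) \<partial>\<U>))"
    by (subst Bochner_Integration.integral_sum[OF int]) simp
  also have "\<dots> = (\<Sum>i=1..n. F i * (1 / real n))"
    using measure_cell[OF n] by (intro sum.cong) auto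
  finally show "(\<integral>x. F (cell n x) \<partial>\<U>) = (1 / real n) * (\<Sum>i=1..n. F i)"
    by (simp add: sum_distrib_right sum_distrib_left)
  show "integrable \<U> (\<lambda>x. F (cell n x))"
    by (subst Bochner_Integration.integrable_cong[OF refl eq]) (use int in auto)
qed

interpretation UP: product_prob_space "\<lambda>_::nat. \<U>" I for I ..

lemma integral_PiM_prod:
  fixes h :: "nat \<Rightarrow> real \<Rightarrow> real"
  assumes "finite I" "\<And>i. i \<in> I \<Longrightarrow> integrable \<U> (h i)"
  shows "(\<integral>x. (\<Prod>i\<in>I. h i (x i)) \<partial>(\<Pi>\<^sub>M i\<in>I. \<U>)) = (\<Prod>i\<in>I. \<integral>x. h i x \<partial>\<U>)"
    and "integrable (\<Pi>\<^sub>M i\<in>I. \<U>) (\<lambda>x. \<Prod>i\<in>I. h i (x i))"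
  using UP.product_integral_prod[OF assms] UP.product_integrable_prod[OF assms] by auto

lemma integral_PiM_component:
  fixes h :: "real \<Rightarrow> real" and a :: nat
  assumes "finite I" "a \<in> I" "integrable \<U> h"
  shows "(\<integral>x. h (x a) \<partial>(\<Pi>\<^sub>M i\<in>I. \<U>)) = (\<integral>x. h x \<partial>\<U>)"
    and "integrable (\<Pi>\<^sub>M i\<in>I. \<U>) (\<lambda>x. h (x a))"
proof -
  let ?h = "\<lambda>i::nat. if i = a then h else (\<lambda>_. 1)"
  have int: "integrable \<U> (?h i)" if "i \<in> I" for i using assms by auto
  have "(\<Prod>i\<in>I. ?h i (x i)) = (\<Prod>i\<in>I. if i = a then h (x a) else 1)" for x
    by (intro prod.cong) auto
  then have 1: "(\<Prod>i\<in>I. ?h i (x i)) = h (x a)" for x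
    using assms(1,2) by simp
  have "(\<Prod>i\<in>I. \<integral>x. ?h i x \<partial>\<U>) = (\<Prod>i\<in>I. if i = a then \<integral>x. h x \<partial>\<U> else 1)"
    using U.prob_space by (intro prod.cong) auto
  then have 2: "(\<Prod>i\<in>I. \<integral>x. ?h i x \<partial>\<U>) = (\<integral>x. h x \<partial>\<U>)"
    using assms(1,2) by simp
  show "(\<integral>x. h (x a) \<partial>(\<Pi>\<^sub>M i\<in>I. \<U>)) = (\<integral>x. h x \<partial>\<U>)"
    "integrable (\<Pi>\<^sub>M i\<in>I. \<U>) (\<lambda>x. h (x a))"
    using integral_PiM_prod[where h="?h", OF assms(1) int] unfolding 1 2 by auto
qed

text \<open>Averages over maps into \<open>{1..n}\<close> become integrals of functions constant on
  the cells of a cube. Homomorphism sums on the grid and graphon densities can then be compared as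
  integrals over one space.\<close>

lemma integral_PiM_cell:
  fixes F :: "(nat \<Rightarrow> nat) \<Rightarrow> real"
  assumes n: "n \<ge> 1" and I: "finite I"
  shows "(\<integral>x. F (\<lambda>i\<in>I. cell n (x i)) \<partial>(\<Pi>\<^sub>M i\<in>I. \<U>)) =
      (\<Sum>\<phi>\<in>I \<rightarrow>\<^sub>E {1..n}. F \<phi>) / real n ^ card I"
    and "integrable (\<Pi>\<^sub>M i\<in>I. \<U>) (\<lambda>x. F (\<lambda>i\<in>I. cell n (x i)))"
proof -
  let ?M = "\<Pi>\<^sub>M i\<in>I. \<U>"
  let ?ind = "\<lambda>\<phi> x. \<Prod>i\<in>I. (if cell n (x i) = \<phi> i then 1 else 0::real)"
  have ic: "integrable \<U> (\<lambda>x. if cell n x = j then 1 else 0::real)" for j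
    by (intro integrable_bounded_unit[where C=1]) auto
  have fin: "finite (I \<rightarrow>\<^sub>E {1..n})" using I by (simp add: finite_PiE)
  have ind: "?ind \<phi> x = (if \<phi> = (\<lambda>i\<in>I. cell n (x i)) then 1 else 0)" if "\<phi> \<in> I \<rightarrow>\<^sub>E {1..n}" for \<phi> x
  proof (cases "\<phi> = (\<lambda>i\<in>I. cell n (x i))")
    case False
    moreover have "\<phi> = (\<lambda>i\<in>I. cell n (x i))" if "\<forall>i\<in>I. \<phi> i = cell n (x i)"
      using that \<open>\<phi> \<in> I \<rightarrow>\<^sub>E {1..n}\<close> by (intro extensionalityI[of _ I]) (auto simp: PiE_iff)
    ultimately obtain i where "i \<in> I" "\<phi> i \<noteq> cell n (x i)"
      by blast
    then show ?thesis using I False by (auto intro!: prod_zero)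
  qed auto
  have eq: "F (\<lambda>i\<in>I. cell n (x i)) = (\<Sum>\<phi>\<in>I \<rightarrow>\<^sub>E {1..n}. F \<phi> * ?ind \<phi> x)" if "x \<in> space ?M" for x
  proof -
    have "(\<lambda>i\<in>I. cell n (x i)) \<in> I \<rightarrow>\<^sub>E {1..n}"
      using that cell_bounds(1)[OF n] by (auto simp: space_PiM PiE_def Pi_def)
    moreover have "(\<Sum>\<phi>\<in>I \<rightarrow>\<^sub>E {1..n}. F \<phi> * ?ind \<phi> x) =
        (\<Sum>\<phi>\<in>I \<rightarrow>\<^sub>E {1..n}. if \<phi> = (\<lambda>i\<in>I. cell n (x i)) then F \<phi> else 0)"
      using ind by (intro sum.cong) auto
    ultimately show ?thesis using fin by simp
  qed
  have int: "integrable ?M (\<lambda>x. F \<phi> * ?ind \<phi> x)" for \<phi>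
    using integral_PiM_prod(2)[OF I, where h="\<lambda>i x. if cell n x = \<phi> i then 1 else 0"] ic
    by (intro integrable_mult_right) auto
  have val: "(\<integral>x. ?ind \<phi> x \<partial>?M) = 1 / real n ^ card I" if "\<phi> \<in> I \<rightarrow>\<^sub>E {1..n}" for \<phi>
  proof -
    have "(\<integral>x. ?ind \<phi> x \<partial>?M) = (\<Prod>i\<in>I. \<integral>x. (if cell n x = \<phi> i then 1 else 0) \<partial>\<U>)"
      by (rule integral_PiM_prod(1)[OF I, where h="\<lambda>i x. if cell n x = \<phi> i then 1 else 0"]) (rule ic)
    also have "\<dots> = (\<Prod>i\<in>I. 1 / real n)"
      using that by (intro prod.cong refl measure_cell[OF n]) (auto simp: PiE_iff)
    finally show ?thesis by (simp add: power_one_over)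
  qed
  have "(\<integral>x. F (\<lambda>i\<in>I. cell n (x i)) \<partial>?M) = (\<integral>x. (\<Sum>\<phi>\<in>I \<rightarrow>\<^sub>E {1..n}. F \<phi> * ?ind \<phi> x) \<partial>?M)"
    by (rule Bochner_Integration.integral_cong[OF refl eq])
  also have "\<dots> = (\<Sum>\<phi>\<in>I \<rightarrow>\<^sub>E {1..n}. F \<phi> * (\<integral>x. ?ind \<phi> x \<partial>?M))"
    by (subst Bochner_Integration.integral_sum[OF int]) simp
  also have "\<dots> = (\<Sum>\<phi>\<in>I \<rightarrow>\<^sub>E {1..n}. F \<phi> * (1 / real n ^ card I))"
    by (intro sum.cong refl arg_cong2[where f="(*)"] val)
  finally show "(\<integral>x. F (\<lambda>i\<in>I. cell n (x i)) \<partial>?M) =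
      (\<Sum>\<phi>\<in>I \<rightarrow>\<^sub>E {1..n}. F \<phi>) / real n ^ card I"
    by (simp add: sum_divide_distrib)
  show "integrable ?M (\<lambda>x. F (\<lambda>i\<in>I. cell n (x i)))"
    by (subst Bochner_Integration.integrable_cong[OF refl eq]) (use int in auto)
qed

text \<open>On a cell a monotone function varies by at most the difference of its values at the two
  end points, and these differences telescope. This gives the rate \<open>1 / n\<close> although
  \<open>u\<close> may jump.\<close>

lemma antimono_cell_error:
  fixes u :: "real \<Rightarrow> real"
  assumes u: "antimono_on {0..1} u" and n: "n \<ge> 1"
  shows "(\<integral>x. \<bar>u (real (cell n x) / real n) - u x\<bar> \<partial>\<U>) \<le> (u 0 - u 1) / real n"
    and "integrable \<U> (\<lambda>x. \<bar>u (real (cell n x) / real n) - u x\<bar>)"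
proof -
  let ?D = "\<lambda>i. u ((real i - 1) / real n) - u (real i / real n)"
  have le: "\<bar>u (real (cell n x) / real n) - u x\<bar> \<le> ?D (cell n x)" if x: "x \<in> {0..1}" for x
  proof -
    have "u (real (cell n x) / real n) \<le> u x"
      using cell_bounds[OF n x] x cell_in_unit[OF n x] by (intro monotone_onD[OF u]) auto
    moreover have "u x \<le> u ((real (cell n x) - 1) / real n)"
      using cell_bounds[OF n x] x cell_in_unit[OF n x] n
      by (intro monotone_onD[OF u]) (auto simp: field_simps)
    ultimately show ?thesis by linarith
  qed
  show int: "integrable \<U> (\<lambda>x. \<bar>u (real (cell n x) / real n) - u x\<bar>)"
    using integral_cell(2)[OF n, of "\<lambda>i. u (real i / real n)"] integrable_antimono_unit[OF u]
    by (intro integrable_abs Bochner_Integration.integrable_diff) auto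
  have "(\<integral>x. \<bar>u (real (cell n x) / real n) - u x\<bar> \<partial>\<U>) \<le> (\<integral>x. ?D (cell n x) \<partial>\<U>)"
    using le integral_cell(2)[OF n, of ?D] int by (intro integral_mono) auto
  also have "\<dots> = (1 / real n) * (\<Sum>i=1..n. ?D i)"
    by (rule integral_cell(1)[OF n])
  also have "(\<Sum>i=1..n. ?D i) = u 0 - u 1"
  proof -
    have "(\<Sum>i=1..k. ?D i) = u 0 - u (real k / real n)" for k
      by (induction k) (auto simp: add_divide_distrib)
    then show ?thesis using n by simp
  qed
  finally show "(\<integral>x. \<bar>u (real (cell n x) / real n) - u x\<bar> \<partial>\<U>) \<le> (u 0 - u 1) / real n"
    by simp
qed

section \<open>The logistic function\<close>

definition logistic :: "real \<Rightarrow> real" where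
  "logistic s = exp s / (1 + exp s)"

lemma beta_graphon_logistic: "beta_graphon g x y = logistic (g x + g y)"
  by (simp add: beta_graphon_def logistic_def)

lemma logistic_gt_0 [simp]: "logistic s > 0" and logistic_lt_1 [simp]: "logistic s < 1"
  by (auto simp: logistic_def field_simps add_pos_pos)

lemma logistic_ge_0 [simp]: "logistic s \<ge> 0" and logistic_le_1 [simp]: "logistic s \<le> 1"
  by (simp_all add: less_imp_le)

lemma one_minus_logistic: "1 - logistic s = 1 / (1 + exp s)"
  by (simp add: logistic_def field_simps add_pos_pos less_imp_neq[THEN not_sym])

lemma logistic_minus: "logistic (- s) = 1 - logistic s"
  unfolding one_minus_logistic
  by (simp add: logistic_def exp_minus field_simps add_pos_pos less_imp_neq[THEN not_sym])

lemma logistic_strict_mono: "s < t \<Longrightarrow> logistic s < logistic t"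
proof -
  assume "s < t"
  then have "1 / (1 + exp t) < 1 / (1 + exp s)"
    by (intro divide_strict_left_mono) (auto simp: add_pos_pos)
  then show ?thesis
    using one_minus_logistic[of s] one_minus_logistic[of t] by linarith
qed

lemma logistic_mono: "s \<le> t \<Longrightarrow> logistic s \<le> logistic t"
  using logistic_strict_mono[of s t] by (cases "s = t") auto

lemma logistic_less_iff [simp]: "logistic s < logistic t \<longleftrightarrow> s < t"
  using logistic_strict_mono logistic_mono by (meson linorder_not_less)

lemma logistic_eq_iff [simp]: "logistic s = logistic t \<longleftrightarrow> s = t"
  using logistic_strict_mono by (metis less_irrefl linorder_less_linear)

lemma logistic_lipschitz: "\<bar>logistic s - logistic t\<bar> \<le> \<bar>s - t\<bar>"
proof -
  have *: "logistic t - logistic s \<le> t - s" if "s \<le> t" for s t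
  proof -
    \<comment> \<open>Multiplied by \<open>exp t\<close>, this bounds the numerator of the
      difference of the two fractions; the product of their denominators is at least
      \<open>exp t\<close>.\<close>
    have "1 + (s - t) \<le> exp (s - t)" by (rule exp_ge_add_one_self)
    then have "exp t - exp s \<le> exp t * (t - s)"
      by (simp add: exp_diff field_simps)
    also have "\<dots> \<le> ((1 + exp t) * (1 + exp s)) * (t - s)"
      using that by (intro mult_right_mono) (auto simp: algebra_simps add_nonneg_nonneg)
    finally have "(exp t - exp s) / ((1 + exp t) * (1 + exp s)) \<le> t - s"
      by (subst pos_divide_le_eq) (auto simp: add_pos_pos mult.commute)
    moreover have "logistic t - logistic s = (exp t - exp s) / ((1 + exp t) * (1 + exp s))"
      unfolding logistic_def
      by (subst diff_frac_eq) (auto simp: add_pos_pos less_imp_neq[THEN not_sym] algebra_simps)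
    ultimately show ?thesis by simp
  qed
  show ?thesis
    using *[of s t] *[of t s] logistic_mono[of s t] logistic_mono[of t s] by (cases "s \<le> t") auto
qed

lemma continuous_on_logistic [continuous_intros]:
  "continuous_on A h \<Longrightarrow> continuous_on A (\<lambda>x. logistic (h x))"
  unfolding logistic_def
  by (intro continuous_intros) (auto simp: add_pos_pos less_imp_neq[THEN not_sym])

lemma measurable_logistic [measurable]: "logistic \<in> borel_measurable borel"
  by (rule borel_measurable_continuous_onI) (intro continuous_intros)

lemma logistic_at_top: "(logistic \<longlongrightarrow> 1) at_top"
proof -
  have "filterlim (\<lambda>s::real. 1 + exp s) at_top at_top"
    by (rule filterlim_tendsto_add_at_top[OF tendsto_const exp_at_top])
  then have "((\<lambda>s::real. 1 / (1 + exp s)) \<longlongrightarrow> 0) at_top"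
    by (intro tendsto_divide_0[OF tendsto_const] filterlim_at_top_imp_at_infinity)
  then have "((\<lambda>s::real. 1 - 1 / (1 + exp s)) \<longlongrightarrow> 1 - 0) at_top"
    by (intro tendsto_diff tendsto_const)
  moreover have "1 - 1 / (1 + exp s) = logistic s" for s
    using one_minus_logistic[of s] by simp
  ultimately show ?thesis by simp
qed

lemma logistic_at_bot: "(logistic \<longlongrightarrow> 0) at_bot"
proof -
  have "((\<lambda>s. 1 - logistic s) \<longlongrightarrow> 1 - 1) at_top"
    by (intro tendsto_diff tendsto_const logistic_at_top)
  then show ?thesis
    by (simp add: filterlim_at_bot_mirror logistic_minus)
qed

section \<open>Degrees and edges\<close>

lemma vertex_degree_eq_sum:
  assumes "simple_graph G" "i \<in> verts G"
  shows "vertex_degree G i = (\<Sum>j\<in>verts G. if {i, j} \<in> edges G then 1 else 0)"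
proof -
  have fin: "finite (verts G)" using assms by (simp add: simple_graph_def)
  have "bij_betw (\<lambda>j. {i, j}) {j \<in> verts G. {i, j} \<in> edges G} {e \<in> edges G. i \<in> e}"
    unfolding bij_betw_def
  proof
    show "inj_on (\<lambda>j. {i, j}) {j \<in> verts G. {i, j} \<in> edges G}"
      by (auto simp: inj_on_def doubleton_eq_iff)
    show "(\<lambda>j. {i, j}) ` {j \<in> verts G. {i, j} \<in> edges G} = {e \<in> edges G. i \<in> e}"
    proof (intro equalityI subsetI)
      fix e assume e: "e \<in> {e \<in> edges G. i \<in> e}"
      then have "card e = 2" "e \<subseteq> verts G"
        using assms by (auto simp: simple_graph_def)
      with e obtain j where "e = {i, j}" "j \<in> verts G"
        by (auto simp: card_2_iff)
      with e show "e \<in> (\<lambda>j. {i, j}) ` {j \<in> verts G. {i, j} \<in> edges G}" by auto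
    qed auto
  qed
  then have "vertex_degree G i = card {j \<in> verts G. {i, j} \<in> edges G}"
    unfolding vertex_degree_def by (simp add: bij_betw_same_card)
  also have "\<dots> = (\<Sum>j\<in>verts G. if {i, j} \<in> edges G then 1 else 0)"
    using fin by (simp add: sum.If_cases Int_def)
  finally show ?thesis .
qed

text \<open>Twice the left side is the sum of \<open>v i + v j\<close> over ordered adjacent pairs.
  Discarding negative terms and admitting all pairs, the diagonal included, can only increase
  it.\<close>

lemma degree_pairing_bound:
  fixes v :: "'a \<Rightarrow> real"
  assumes G: "simple_graph G"
  shows "(\<Sum>i\<in>verts G. real (vertex_degree G i) * v i) \<le>
    (\<Sum>i\<in>verts G. \<Sum>j\<in>verts G. max 0 (v i + v j)) / 2"
proof -
  let ?A = "\<lambda>i j. if {i, j} \<in> edges G then 1 else 0 :: real"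
  have "(\<Sum>i\<in>verts G. real (vertex_degree G i) * v i) = (\<Sum>i\<in>verts G. \<Sum>j\<in>verts G. ?A i j * v i)"
    by (intro sum.cong) (auto simp: vertex_degree_eq_sum[OF G] sum_distrib_right intro!: sum.cong)
  moreover have "(\<Sum>i\<in>verts G. \<Sum>j\<in>verts G. ?A i j * v i) = (\<Sum>i\<in>verts G. \<Sum>j\<in>verts G. ?A i j * v j)"
    by (subst sum.swap) (simp add: insert_commute)
  ultimately have "2 * (\<Sum>i\<in>verts G. real (vertex_degree G i) * v i) =
      (\<Sum>i\<in>verts G. \<Sum>j\<in>verts G. ?A i j * (v i + v j))"
    by (simp add: distrib_left sum.distrib)
  also have "\<dots> \<le> (\<Sum>i\<in>verts G. \<Sum>j\<in>verts G. max 0 (v i + v j))"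
    by (intro sum_mono) auto
  finally show ?thesis by simp
qed

section \<open>Duality for scaling limits\<close>

lemma integrable_bounded_pair:
  fixes F :: "real \<Rightarrow> real \<Rightarrow> real"
  assumes "(\<lambda>(x, y). F x y) \<in> borel_measurable (\<U> \<Otimes>\<^sub>M \<U>)"
    and "\<And>x y. x \<in> {0..1} \<Longrightarrow> y \<in> {0..1} \<Longrightarrow> \<bar>F x y\<bar> \<le> C"
  shows "integrable (\<U> \<Otimes>\<^sub>M \<U>) (\<lambda>(x, y). F x y)"
  by (rule UU.integrable_const_bound[where B=C])
    (use assms in \<open>auto simp: space_pair_measure\<close>)

lemma integrable_inner_unit:
  fixes F :: "real \<Rightarrow> real \<Rightarrow> real"
  assumes "(\<lambda>(x, y). F x y) \<in> borel_measurable (\<U> \<Otimes>\<^sub>M \<U>)"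
    and "\<And>x y. x \<in> {0..1} \<Longrightarrow> y \<in> {0..1} \<Longrightarrow> \<bar>F x y\<bar> \<le> C"
  shows "integrable \<U> (\<lambda>x. \<integral>y. F x y \<partial>\<U>)"
    and "x \<in> {0..1} \<Longrightarrow> integrable \<U> (\<lambda>y. F x y)"
    and "(\<integral>x. \<integral>y. F x y \<partial>\<U> \<partial>\<U>) = (\<integral>(x, y). F x y \<partial>(\<U> \<Otimes>\<^sub>M \<U>))"
    and "(\<integral>x. \<integral>y. F x y \<partial>\<U> \<partial>\<U>) = (\<integral>y. \<integral>x. F x y \<partial>\<U> \<partial>\<U>)"
proof -
  note int = integrable_bounded_pair[OF assms]
  show "integrable \<U> (\<lambda>x. \<integral>y. F x y \<partial>\<U>)"
    using UU.integrable_fst'[OF int] by simp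
  show "(\<integral>x. \<integral>y. F x y \<partial>\<U> \<partial>\<U>) = (\<integral>(x, y). F x y \<partial>(\<U> \<Otimes>\<^sub>M \<U>))"
    using UU.integral_fst'[OF int] by simp
  show "(\<integral>x. \<integral>y. F x y \<partial>\<U> \<partial>\<U>) = (\<integral>y. \<integral>x. F x y \<partial>\<U> \<partial>\<U>)"
    using UU.Fubini_integral[OF int] by simp
  show "integrable \<U> (\<lambda>y. F x y)" if "x \<in> {0..1}"
  proof (rule integrable_bounded_unit[where C=C])
    show "(\<lambda>y. F x y) \<in> borel_measurable \<U>"
      using measurable_Pair2[OF assms(1), of x] that by simp
  qed (use assms that in auto)
qed

text \<open>For bounded measurable \<open>u\<close> this is the supremum of the integral of
  \<open>W x y * (u x + u y)\<close> over measurable \<open>W\<close> with values in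
  \<open>[0,1]\<close>, attained at the indicator of \<open>u x + u y > 0\<close>.\<close>

abbreviation positive_energy :: "(real \<Rightarrow> real) \<Rightarrow> real" where
  "positive_energy u \<equiv> (\<integral>x. \<integral>y. max 0 (u x + u y) \<partial>\<U> \<partial>\<U>)"

lemma abs_positive_part_bound:
  fixes u :: "real \<Rightarrow> real"
  assumes "antimono_on {0..1} u" "x \<in> {0..1}" "y \<in> {0..1}"
  shows "\<bar>max 0 (u x + u y)\<bar> \<le> 2 * (\<bar>u 0\<bar> + \<bar>u 1\<bar>)"
proof -
  have "\<bar>max 0 (u x + u y)\<bar> \<le> \<bar>u x\<bar> + \<bar>u y\<bar>" by (auto simp: max_def)
  also have "\<dots> \<le> (\<bar>u 0\<bar> + \<bar>u 1\<bar>) + (\<bar>u 0\<bar> + \<bar>u 1\<bar>)"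
    using assms by (intro add_mono antimono_unit_bounds(3))
  finally show ?thesis by simp
qed

text \<open>The double sum is the integral of a function constant on grid squares, and the positive
  part is 1-Lipschitz, so passing from grid values to \<open>u\<close> costs the cell errors of both
  variables.\<close>

lemma integral_sum_pair_cell:
  fixes u :: "real \<Rightarrow> real"
  assumes u: "antimono_on {0..1} u" and n: "n \<ge> 1"
  shows "(\<Sum>i=1..n. \<Sum>j=1..n. max 0 (u (real i / real n) + u (real j / real n))) / (real n)\<^sup>2
    \<le> positive_energy u + 2 * (u 0 - u 1) / real n"
proof -
  note [measurable] = measurable_antimono_unit[OF u]
  let ?c = "\<lambda>x. real (cell n x) / real n"
  let ?e = "\<lambda>x. \<bar>u (?c x) - u x\<bar>"
  let ?C = "\<bar>u 0\<bar> + \<bar>u 1\<bar>"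
  let ?r = "(\<integral>x. ?e x \<partial>\<U>)"
  note e = antimono_cell_error[OF u n]
  note bnd = abs_positive_part_bound[OF u]
  have meas: "(\<lambda>(x, y). max 0 (u x + u y)) \<in> borel_measurable (\<U> \<Otimes>\<^sub>M \<U>)"
    by measurable
  note F = integrable_inner_unit[OF meas bnd]
  have inner: "(\<integral>y. max 0 (u s + u (?c y)) \<partial>\<U>) = (1 / real n) * (\<Sum>j=1..n. max 0 (u s + u (real j / real n)))"
      "integrable \<U> (\<lambda>y. max 0 (u s + u (?c y)))" for s
    using integral_cell[OF n, of "\<lambda>j. max 0 (u s + u (real j / real n))"] by auto
  have "(\<Sum>i=1..n. \<Sum>j=1..n. max 0 (u (real i / real n) + u (real j / real n))) / (real n)\<^sup>2
      = (1 / real n) * (\<Sum>i=1..n. (1 / real n) * (\<Sum>j=1..n. max 0 (u (real i / real n) + u (real j / real n))))"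
    by (simp add: sum_divide_distrib power2_eq_square sum_distrib_left)
  also have "\<dots> = (1 / real n) * (\<Sum>i=1..n. \<integral>y. max 0 (u (real i / real n) + u (?c y)) \<partial>\<U>)"
    by (simp only: inner)
  also have "\<dots> = (\<integral>x. \<integral>y. max 0 (u (?c x) + u (?c y)) \<partial>\<U> \<partial>\<U>)"
    using integral_cell[OF n, of "\<lambda>i. \<integral>y. max 0 (u (real i / real n) + u (?c y)) \<partial>\<U>"] by simp
  also have "\<dots> \<le> (\<integral>x. (\<integral>y. max 0 (u x + u y) \<partial>\<U>) + (?e x + ?r) \<partial>\<U>)"
  proof (rule integral_mono)
    show "integrable \<U> (\<lambda>x. \<integral>y. max 0 (u (?c x) + u (?c y)) \<partial>\<U>)"
      using integral_cell[OF n, of "\<lambda>i. \<integral>y. max 0 (u (real i / real n) + u (?c y)) \<partial>\<U>"] by simp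
    show "integrable \<U> (\<lambda>x. (\<integral>y. max 0 (u x + u y) \<partial>\<U>) + (?e x + ?r))"
      using F(1) e(2) by auto
    fix x assume "x \<in> space \<U>"
    then have x: "x \<in> {0..1}" by simp
    have "(\<integral>y. max 0 (u (?c x) + u (?c y)) \<partial>\<U>) \<le> (\<integral>y. max 0 (u x + u y) + (?e x + ?e y) \<partial>\<U>)"
      using F(2)[OF _ _ x] e(2) inner(2)
      by (intro integral_mono Bochner_Integration.integrable_add) auto
    also have "\<dots> = (\<integral>y. max 0 (u x + u y) \<partial>\<U>) + (?e x + ?r)"
      using F(2)[OF _ _ x] e(2) U.prob_space
      by (subst Bochner_Integration.integral_add) auto
    finally show "(\<integral>y. max 0 (u (?c x) + u (?c y)) \<partial>\<U>) \<le> (\<integral>y. max 0 (u x + u y) \<partial>\<U>) + (?e x + ?r)" .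
  qed
  also have "\<dots> = positive_energy u + (?r + ?r)"
    using F(1) e(2) U.prob_space by (subst Bochner_Integration.integral_add) auto
  also have "\<dots> \<le> positive_energy u + 2 * (u 0 - u 1) / real n"
    using mult_left_mono[OF e(1), of 2] by simp
  finally show ?thesis .
qed

lemma integral_mult_cell:
  fixes h u :: "real \<Rightarrow> real"
  assumes h: "antimono_on {0..1} h" and u: "antimono_on {0..1} u" and n: "n \<ge> 1"
  shows "(\<integral>x. h x * u x \<partial>\<U>) \<le>
    (1 / real n) * (\<Sum>i=1..n. h (real i / real n) * u (real i / real n)) +
    ((\<bar>u 0\<bar> + \<bar>u 1\<bar>) * (h 0 - h 1) + (\<bar>h 0\<bar> + \<bar>h 1\<bar>) * (u 0 - u 1)) / real n"
proof -
  note [measurable] = measurable_antimono_unit[OF u] measurable_antimono_unit[OF h]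
  let ?c = "\<lambda>x. real (cell n x) / real n"
  let ?e = "\<lambda>u x. \<bar>u (?c x) - u x\<bar>"
  let ?C = "\<lambda>u::real\<Rightarrow>real. \<bar>u 0\<bar> + \<bar>u 1\<bar>"
  note eu = antimono_cell_error[OF u n] and eh = antimono_cell_error[OF h n]
  note c = integral_cell[OF n, of "\<lambda>i. h (real i / real n) * u (real i / real n)"]
  have "(\<integral>x. h x * u x \<partial>\<U>) \<le> (\<integral>x. h (?c x) * u (?c x) + (?C u * ?e h x + ?C h * ?e u x) \<partial>\<U>)"
  proof (rule integral_mono)
    show "integrable \<U> (\<lambda>x. h x * u x)" by (rule integrable_mult_antimono_unit[OF h u])
    show "integrable \<U> (\<lambda>x. h (?c x) * u (?c x) + (?C u * ?e h x + ?C h * ?e u x))"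
      using c(2) eu(2) eh(2) by auto
    fix x assume "x \<in> space \<U>"
    then have x: "x \<in> {0..1}" "?c x \<in> {0..1}" using cell_in_unit[OF n] by auto
    have "h x * u x - h (?c x) * u (?c x) = (h x - h (?c x)) * u (?c x) + h x * (u x - u (?c x))"
      by (simp add: algebra_simps)
    also have "\<dots> \<le> \<bar>h x - h (?c x)\<bar> * \<bar>u (?c x)\<bar> + \<bar>h x\<bar> * \<bar>u x - u (?c x)\<bar>"
      unfolding abs_mult[symmetric] by (intro add_mono abs_ge_self)
    also have "\<dots> \<le> ?e h x * ?C u + ?C h * ?e u x"
      using antimono_unit_bounds(3)[OF u x(2)] antimono_unit_bounds(3)[OF h x(1)]
      by (intro add_mono mult_mono) auto
    finally show "h x * u x \<le> h (?c x) * u (?c x) + (?C u * ?e h x + ?C h * ?e u x)"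
      by (simp add: mult.commute)
  qed
  also have "\<dots> = (\<integral>x. h (?c x) * u (?c x) \<partial>\<U>) + (?C u * (\<integral>x. ?e h x \<partial>\<U>) + ?C h * (\<integral>x. ?e u x \<partial>\<U>))"
    using c(2) eu(2) eh(2) by (subst Bochner_Integration.integral_add) (auto simp del: abs_of_nonneg)
  also have "\<dots> \<le> (\<integral>x. h (?c x) * u (?c x) \<partial>\<U>) + (?C u * ((h 0 - h 1) / real n) + ?C h * ((u 0 - u 1) / real n))"
    using eu(1) eh(1) by (intro add_mono mult_left_mono) auto
  finally show ?thesis
    using c(1) by (simp add: add_divide_distrib)
qed

text \<open>Dividing \<open>degree_pairing_bound\<close> by the square of \<open>n\<close> gives the
  inequality for each member of the sequence, up to errors that vanish in the limit.\<close>

lemma scaling_limits_dual: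
  fixes h u :: "real \<Rightarrow> real"
  assumes "h \<in> scaling_limits" and u: "antimono_on {0..1} u"
  shows "(\<integral>x. h x * u x \<partial>\<U>) \<le> positive_energy u / 2"
proof -
  obtain d where d: "\<And>n. n \<ge> 1 \<Longrightarrow> ordered_degree_sequence n (d n)" and lim: "scaling_limit d h"
    and hD: "h \<in> Dprime"
    using assms(1) by (auto simp: scaling_limits_def)
  have h: "antimono_on {0..1} h" using hD by (simp add: Dprime_def)
  let ?C = "\<bar>u 0\<bar> + \<bar>u 1\<bar>"
  let ?J = "positive_energy u"
  \<comment> \<open>The total error: replacing \<open>d n i / n\<close> by \<open>h (i / n)\<close>,
    then the Riemann sum for \<open>h * u\<close>, then half the one for the positive
    energy.\<close>
  define q where "q n = ?C * (\<bar>real (d n 1) / real n - h 0\<bar> + \<bar>real (d n n) / real n - h 1\<bar>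
        + (1 / real n) * (\<Sum>i=1..n. \<bar>real (d n i) / real n - h (real i / real n)\<bar>)) +
     (?C * (h 0 - h 1) + (\<bar>h 0\<bar> + \<bar>h 1\<bar>) * (u 0 - u 1)) / real n + (u 0 - u 1) / real n" for n
  have q: "q \<longlonglongrightarrow> ?C * 0 + 0 + 0"
    unfolding q_def
    by (intro tendsto_add tendsto_mult tendsto_const lim[unfolded scaling_limit_def] lim_const_over_n)
  have le: "(\<integral>x. h x * u x \<partial>\<U>) \<le> ?J / 2 + q n" if n: "n \<ge> 1" for n
  proof -
    obtain G where G: "simple_graph G" "verts G = {1..n}" "\<And>i. i \<in> {1..n} \<Longrightarrow> vertex_degree G i = d n i"
      using d[OF n] by (auto simp: ordered_degree_sequence_def graphs_with_degrees_def)
    let ?u = "\<lambda>i. u (real i / real n)" and ?h = "\<lambda>i. h (real i / real n)"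
    have "(\<Sum>i=1..n. real (d n i) * ?u i) \<le> (\<Sum>i=1..n. \<Sum>j=1..n. max 0 (?u i + ?u j)) / 2"
      using degree_pairing_bound[OF G(1), of ?u] G by simp
    then have "(\<Sum>i=1..n. real (d n i) * ?u i) / (real n)\<^sup>2 \<le>
       ((\<Sum>i=1..n. \<Sum>j=1..n. max 0 (?u i + ?u j)) / 2) / (real n)\<^sup>2"
      by (intro divide_right_mono) auto
    also have "\<dots> \<le> (?J + 2 * (u 0 - u 1) / real n) / 2"
      using integral_sum_pair_cell[OF u n] by (simp add: field_simps)
    also have "\<dots> = ?J / 2 + (u 0 - u 1) / real n"
      by (simp add: add_divide_distrib diff_divide_distrib)
    finally have 1: "(1 / real n) * (\<Sum>i=1..n. (real (d n i) / real n) * ?u i) \<le> ?J / 2 + (u 0 - u 1) / real n"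
      by (simp add: sum_divide_distrib power2_eq_square sum_distrib_left)
    have "(\<Sum>i=1..n. ?h i * ?u i) - (\<Sum>i=1..n. (real (d n i) / real n) * ?u i)
        = (\<Sum>i=1..n. (?h i - real (d n i) / real n) * ?u i)"
      by (simp add: sum_subtractf left_diff_distrib)
    also have "\<dots> \<le> (\<Sum>i=1..n. \<bar>?h i - real (d n i) / real n\<bar> * ?C)"
    proof (intro sum_mono)
      fix i assume "i \<in> {1..n}"
      then have "real i / real n \<in> {0..1}" using n by (auto simp: field_simps)
      then have "\<bar>?u i\<bar> \<le> ?C" by (rule antimono_unit_bounds(3)[OF u])
      then have "\<bar>?h i - real (d n i) / real n\<bar> * \<bar>?u i\<bar> \<le> \<bar>?h i - real (d n i) / real n\<bar> * ?C"
        by (intro mult_left_mono) auto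
      moreover have "(?h i - real (d n i) / real n) * ?u i \<le> \<bar>?h i - real (d n i) / real n\<bar> * \<bar>?u i\<bar>"
        unfolding abs_mult[symmetric] by (rule abs_ge_self)
      ultimately show "(?h i - real (d n i) / real n) * ?u i \<le> \<bar>?h i - real (d n i) / real n\<bar> * ?C"
        by linarith
    qed
    also have "\<dots> = ?C * (\<Sum>i=1..n. \<bar>real (d n i) / real n - ?h i\<bar>)"
      by (simp add: sum_distrib_left abs_minus_commute mult.commute)
    finally have "(1 / real n) * ((\<Sum>i=1..n. ?h i * ?u i) - (\<Sum>i=1..n. (real (d n i) / real n) * ?u i)) \<le>
        (1 / real n) * (?C * (\<Sum>i=1..n. \<bar>real (d n i) / real n - ?h i\<bar>))"
      by (intro mult_left_mono) auto
    also have "\<dots> \<le> ?C * (\<bar>real (d n 1) / real n - h 0\<bar> + \<bar>real (d n n) / real n - h 1\<bar>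
        + (1 / real n) * (\<Sum>i=1..n. \<bar>real (d n i) / real n - h (real i / real n)\<bar>))"
    proof -
      have "?C * ((1 / real n) * (\<Sum>i=1..n. \<bar>real (d n i) / real n - ?h i\<bar>)) \<le> ?C * (\<bar>real (d n 1) / real n - h 0\<bar> + \<bar>real (d n n) / real n - h 1\<bar>
        + (1 / real n) * (\<Sum>i=1..n. \<bar>real (d n i) / real n - h (real i / real n)\<bar>))"
        by (intro mult_left_mono) auto
      then show ?thesis by (simp only: mult.left_commute)
    qed
    finally show ?thesis
      using 1 integral_mult_cell[OF h u n] unfolding q_def by (simp only: right_diff_distrib)
  qed
  have "(\<lambda>n. ?J / 2 + q n) \<longlonglongrightarrow> ?J / 2 + 0"
    using q by (intro tendsto_add tendsto_const) simp
  then have "(\<integral>x. h x * u x \<partial>\<U>) \<le> ?J / 2 + 0"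
    by (rule LIMSEQ_le_const) (use le in blast)
  then show ?thesis by simp
qed

lemma scaling_limits_bounds:
  assumes "h \<in> scaling_limits"
  shows "h 0 \<le> 1" "0 \<le> h 1"
proof -
  obtain d where d: "\<And>n. n \<ge> 1 \<Longrightarrow> ordered_degree_sequence n (d n)" and lim: "scaling_limit d h"
    using assms(1) by (auto simp: scaling_limits_def)
  let ?s = "\<lambda>n. \<bar>real (d n 1) / real n - h 0\<bar> + \<bar>real (d n n) / real n - h 1\<bar>
        + (1 / real n) * (\<Sum>i=1..n. \<bar>real (d n i) / real n - h (real i / real n)\<bar>)"
  have s: "?s \<longlonglongrightarrow> 0" using lim by (simp add: scaling_limit_def)
  have nn: "0 \<le> (1 / real n) * (\<Sum>i=1..n. \<bar>real (d n i) / real n - h (real i / real n)\<bar>)" for n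
    by (intro mult_nonneg_nonneg sum_nonneg) auto
  have "h 0 \<le> 1 + ?s n" if n: "n \<ge> 1" for n
  proof -
    obtain G where G: "simple_graph G" "verts G = {1..n}" "\<And>i. i \<in> {1..n} \<Longrightarrow> vertex_degree G i = d n i"
      using d[OF n] by (auto simp: ordered_degree_sequence_def graphs_with_degrees_def)
    have "d n 1 = (\<Sum>j=1..n. if {1, j} \<in> edges G then 1 else 0)"
      using vertex_degree_eq_sum[OF G(1), of 1] G n by auto
    also have "\<dots> \<le> (\<Sum>j=1..n. 1)" by (intro sum_mono) auto
    finally have "real (d n 1) / real n \<le> 1" using n by simp
    then show ?thesis using nn[of n] by linarith
  qed
  moreover have "(\<lambda>n. 1 + ?s n) \<longlonglongrightarrow> 1 + 0" by (intro tendsto_add tendsto_const s)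
  ultimately have "h 0 \<le> 1 + 0" by (intro LIMSEQ_le_const) auto
  then show "h 0 \<le> 1" by simp
  have "- h 1 \<le> ?s n" for n
    proof -
    have "0 \<le> real (d n n) / real n" by simp
    then show ?thesis using nn[of n] by linarith
  qed
  then have "- h 1 \<le> 0" by (intro LIMSEQ_le_const[OF s]) auto
  then show "0 \<le> h 1" by simp
qed

lemma interior_scaling_limits_perturb:
  assumes "f \<in> Dprime_topology interior_of scaling_limits" "f \<in> Dprime"
  obtains \<delta> where "\<delta> > 0"
    "\<And>h. h \<in> Dprime \<Longrightarrow> (\<And>x. x \<in> {0..1} \<Longrightarrow> \<bar>f x - h x\<bar> \<le> \<delta>) \<Longrightarrow> h \<in> scaling_limits"
proof -
  interpret Metric_space Dprime dist1' by (rule Metric_space_Dprime)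
  obtain S where S: "openin mtopology S" "f \<in> S" "S \<subseteq> scaling_limits"
    using assms(1) unfolding Dprime_topology_def interior_of_def by auto
  obtain r where r: "r > 0" "mball f r \<subseteq> S"
    using S(1,2) unfolding openin_mtopology by auto
  show ?thesis
  \<comment> \<open>The norm has three summands; a uniform perturbation by \<open>r / 4\<close>
    makes each at most \<open>r / 4\<close>, so their total stays below \<open>r\<close>.\<close>
  proof (rule that[of "r / 4"])
    fix h assume h: "h \<in> Dprime" and le: "\<And>x. x \<in> {0..1} \<Longrightarrow> \<bar>f x - h x\<bar> \<le> r / 4"
    have "integrable \<U> (\<lambda>x. \<bar>f x - h x\<bar>)"
      using h assms(2) by (intro integrable_abs Bochner_Integration.integrable_diff integrable_antimono_unit)
        (auto simp: Dprime_def)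
    then have "(\<integral>x. \<bar>f x - h x\<bar> \<partial>\<U>) \<le> (\<integral>x. r / 4 \<partial>\<U>)"
      using le by (intro integral_mono) auto
    then have "(LBINT x:{0..1}. \<bar>f x - h x\<bar>) \<le> r / 4"
      unfolding LBINT_eq_unit_lebesgue using U.prob_space by simp
    then have "dist1' f h \<le> 3 * (r / 4)"
      using le[of 0] le[of 1] unfolding dist1'_def norm1'_def by simp
    then have "dist1' f h < r" using r by simp
    then have "h \<in> mball f r"
      using h assms(2) by simp
    then show "h \<in> scaling_limits" using r S by auto
  qed (use r in simp)
qed

text \<open>For nonincreasing \<open>u\<close> the sign of \<open>u\<close> is a nonincreasing step
  function, so \<delta> times such a step can be added to \<open>f\<close> without leaving
  \<open>Dprime\<close>. The perturbed function is still a scaling limit, and its pairing with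
  \<open>u\<close> gains \<delta> times the integral of the absolute value.\<close>

lemma interior_coercive:
  assumes "f \<in> Dprime_topology interior_of scaling_limits" "f \<in> Dprime"
  obtains \<delta> where "\<delta> > 0" "f 0 < 1" "0 < f 1"
    "\<And>u. antimono_on {0..1} u \<Longrightarrow> (\<integral>x. f x * u x \<partial>\<U>) + \<delta> * (\<integral>x. \<bar>u x\<bar> \<partial>\<U>) \<le>
       positive_energy u / 2"
proof -
  obtain \<delta> where \<delta>: "\<delta> > 0"
    "\<And>h. h \<in> Dprime \<Longrightarrow> (\<And>x. x \<in> {0..1} \<Longrightarrow> \<bar>f x - h x\<bar> \<le> \<delta>) \<Longrightarrow> h \<in> scaling_limits"
    using interior_scaling_limits_perturb[OF assms] by blast
  have f: "antimono_on {0..1} f" "\<And>x. x \<in> {0<..<1} \<Longrightarrow> continuous (at_left x) f"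
    using assms(2) by (auto simp: Dprime_def)
  \<comment> \<open>The jump is taken at \<open>x \<le> t\<close>, which makes the step left
    continuous.\<close>
  define h where "h t = (\<lambda>x. if x \<in> {0..1} then f x + (if x \<le> t then \<delta> else - \<delta>) else undefined)" for t
  have hD: "h t \<in> Dprime" for t
  proof -
    have "antimono_on {0..1} (h t)"
      unfolding h_def using \<delta>(1) monotone_onD[OF f(1)] by (fastforce intro!: monotone_onI add_mono)
    moreover have "continuous (at_left x) (h t)" if x: "x \<in> {0<..<1}" for x
    proof -
      define s where "s = (if x \<le> t then \<delta> else - \<delta>)"
      have "eventually (\<lambda>y. (if y \<le> t then \<delta> else - \<delta>) = s \<and> y \<in> {0..1}) (at_left x)"
      proof (cases "x \<le> t")
        case True
        then show ?thesis using x
          by (auto simp: s_def eventually_at_left_field intro!: exI[of _ 0])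
      next
        case False
        then show ?thesis using x
          by (auto simp: s_def eventually_at_left_field intro!: exI[of _ "max 0 t"])
      qed
      then have "eventually (\<lambda>y. f y + s = h t y) (at_left x)"
        by eventually_elim (auto simp: h_def)
      moreover have "((\<lambda>y. f y + s) \<longlongrightarrow> f x + s) (at_left x)"
        using f(2)[OF x] by (intro tendsto_add tendsto_const) (simp add: continuous_within)
      ultimately have "(h t \<longlongrightarrow> f x + s) (at_left x)"
        by (rule Lim_transform_eventually[rotated])
      then show ?thesis using x by (simp add: continuous_within h_def s_def)
    qed
    ultimately show ?thesis by (auto simp: Dprime_def h_def extensional_def)
  qed
  have hS: "h t \<in> scaling_limits" for t
    by (rule \<delta>(2)[OF hD]) (use \<delta>(1) in \<open>auto simp: h_def\<close>)
  show ?thesis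
  proof (rule that[OF \<delta>(1)])
    \<comment> \<open>The step at \<open>t = 0\<close> raises the value at 0 and lowers the value at
      1, so one perturbation yields both strict bounds.\<close>
    show "f 0 < 1" using scaling_limits_bounds(1)[OF hS, of 0] \<delta>(1) by (simp add: h_def)
    show "0 < f 1" using scaling_limits_bounds(2)[OF hS, of 0] \<delta>(1) by (simp add: h_def)
    fix u :: "real \<Rightarrow> real" assume u: "antimono_on {0..1} u"
    note [measurable] = measurable_antimono_unit[OF u] measurable_antimono_unit[OF f(1)]
    \<comment> \<open>The supremum of this set is the sign change of \<open>u\<close>. Inserting 0
      keeps the set nonempty when \<open>u\<close> is negative throughout. At the sign change itself
      the step may have the wrong sign, which is why that point is removed below.\<close>
    define Z where "Z = insert 0 {x \<in> {0..1}. u x \<ge> 0}"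
    define t where "t = Sup Z"
    have Z: "bdd_above Z" "Z \<noteq> {}" unfolding Z_def by (auto intro!: bdd_aboveI[of _ 1])
    have sgn1: "u x \<le> 0" if "x \<in> {0..1}" "t < x" for x
    proof (rule ccontr)
      assume "\<not> u x \<le> 0"
      then have "x \<in> Z" using that by (auto simp: Z_def)
      then have "x \<le> t" unfolding t_def by (intro cSup_upper Z)
      then show False using that by simp
    qed
    have sgn2: "u x \<ge> 0" if x: "x \<in> {0..1}" "x < t" for x
    proof -
      obtain z where z: "z \<in> Z" "x < z" using less_cSupD[OF Z(2)] x(2) unfolding t_def by blast
      then have "u z \<ge> 0" "z \<in> {0..1}" using x by (auto simp: Z_def)
      moreover have "u z \<le> u x" using z x \<open>z \<in> {0..1}\<close> by (intro monotone_onD[OF u]) auto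
      ultimately show ?thesis by simp
    qed
    have "AE x in \<U>. x \<noteq> t"
      using AE_lborel_singleton[of t] by (subst AE_restrict_space_iff) (auto elim: eventually_mono)
    then have ae: "AE x in \<U>. h t x * u x = f x * u x + \<delta> * \<bar>u x\<bar>"
    proof (rule AE_mp, intro AE_I2 impI)
      fix x assume "x \<in> space \<U>" "x \<noteq> t"
      then show "h t x * u x = f x * u x + \<delta> * \<bar>u x\<bar>"
        using sgn1[of x] sgn2[of x] by (cases "x < t") (auto simp: h_def algebra_simps)
    qed
    have "antimono_on {0..1} (h t)" using hD by (simp add: Dprime_def)
    note [measurable] = measurable_antimono_unit[OF this]
    have iu: "integrable \<U> u" using integrable_antimono_unit[OF u] .
    have ifu: "integrable \<U> (\<lambda>x. f x * u x)" by (rule integrable_mult_antimono_unit[OF f(1) u])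
    have "(\<integral>x. f x * u x \<partial>\<U>) + \<delta> * (\<integral>x. \<bar>u x\<bar> \<partial>\<U>) = (\<integral>x. f x * u x + \<delta> * \<bar>u x\<bar> \<partial>\<U>)"
      using iu ifu by (subst Bochner_Integration.integral_add) auto
    also have "\<dots> = (\<integral>x. h t x * u x \<partial>\<U>)"
      using ae by (intro integral_cong_AE) (auto elim: AE_mp)
    also have "\<dots> \<le> positive_energy u / 2"
      by (rule scaling_limits_dual[OF hS u])
    finally show "(\<integral>x. f x * u x \<partial>\<U>) + \<delta> * (\<integral>x. \<bar>u x\<bar> \<partial>\<U>) \<le>
       positive_energy u / 2" .
  qed
qed

section \<open>The limit equation\<close>

text \<open>The function \<open>K_u\<close> of the overview. The two occurrences of the unknown in
  the limit equation are separated, so that the equation can be solved for one of them with the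
  other held fixed.\<close>

definition logistic_mean :: "(real \<Rightarrow> real) \<Rightarrow> real \<Rightarrow> real" where
  "logistic_mean u s = (\<integral>y. logistic (s + u y) \<partial>\<U>)"

lemma solves_limit_equation_iff:
  "solves_limit_equation f g \<longleftrightarrow> (\<forall>x\<in>{0..1}. f x = logistic_mean g (g x))"
  unfolding solves_limit_equation_def beta_graphon_logistic logistic_mean_def LBINT_eq_unit_lebesgue ..

lemma logistic_mean_integrable:
  assumes [measurable]: "u \<in> borel_measurable \<U>"
  shows "integrable \<U> (\<lambda>y. logistic (s + u y))"
  by (rule integrable_bounded_unit[where C=1]) auto

lemma logistic_mean_mono:
  assumes "u \<in> borel_measurable \<U>" "v \<in> borel_measurable \<U>"
    "\<And>y. y \<in> {0..1} \<Longrightarrow> u y \<le> v y" "s \<le> t"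
  shows "logistic_mean u s \<le> logistic_mean v t"
  unfolding logistic_mean_def
  using assms by (intro integral_mono logistic_mean_integrable logistic_mono add_mono) auto

lemma logistic_mean_strict_mono:
  assumes "u \<in> borel_measurable \<U>" "s < t"
  shows "logistic_mean u s < logistic_mean u t"
  unfolding logistic_mean_def
  using assms U.emeasure_space_1
  by (intro U.integral_less_AE_space logistic_mean_integrable AE_I2) auto

lemma logistic_mean_less_iff:
  assumes "u \<in> borel_measurable \<U>"
  shows "logistic_mean u s < logistic_mean u t \<longleftrightarrow> s < t"
  using logistic_mean_strict_mono[OF assms, of s t] logistic_mean_strict_mono[OF assms, of t s]
  by (cases s t rule: linorder_cases) auto

lemma logistic_mean_eq_iff:
  assumes "u \<in> borel_measurable \<U>"
  shows "logistic_mean u s = logistic_mean u t \<longleftrightarrow> s = t"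
  using logistic_mean_strict_mono[OF assms, of s t] logistic_mean_strict_mono[OF assms, of t s]
  by (cases s t rule: linorder_cases) auto

lemma logistic_mean_cong_AE:
  assumes "u \<in> borel_measurable \<U>" "v \<in> borel_measurable \<U>" "AE y in \<U>. u y = v y"
  shows "logistic_mean u s = logistic_mean v s"
  unfolding logistic_mean_def
proof (rule integral_cong_AE)
  show "AE y in \<U>. logistic (s + u y) = logistic (s + v y)"
    using assms(3) by eventually_elim simp
qed (use assms in measurable)

lemma continuous_on_logistic_mean:
  assumes u: "u \<in> borel_measurable \<U>"
  shows "continuous_on A (logistic_mean u)"
proof -
  have "\<bar>logistic_mean u s - logistic_mean u t\<bar> \<le> \<bar>s - t\<bar>" for s t
  proof -
    have "\<bar>logistic_mean u s - logistic_mean u t\<bar> = \<bar>\<integral>y. logistic (s + u y) - logistic (t + u y) \<partial>\<U>\<bar>"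
      unfolding logistic_mean_def
      by (simp add: Bochner_Integration.integral_diff logistic_mean_integrable[OF u])
    also have "\<dots> \<le> (\<integral>y. \<bar>logistic (s + u y) - logistic (t + u y)\<bar> \<partial>\<U>)"
      by (rule integral_abs_bound)
    also have "\<dots> \<le> (\<integral>y. \<bar>s - t\<bar> \<partial>\<U>)"
    proof (rule integral_mono)
      show "integrable \<U> (\<lambda>y. \<bar>logistic (s + u y) - logistic (t + u y)\<bar>)"
        by (intro integrable_abs Bochner_Integration.integrable_diff logistic_mean_integrable u)
      show "\<bar>logistic (s + u y) - logistic (t + u y)\<bar> \<le> \<bar>s - t\<bar>" for y
        using logistic_lipschitz[of "s + u y" "t + u y"] by simp
    qed simp
    finally show ?thesis using U.prob_space by simp
  qed
  then have "1-lipschitz_on A (logistic_mean u)"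
    by (intro lipschitz_onI) (auto simp: dist_real_def)
  then show ?thesis by (rule lipschitz_on_continuous_on)
qed

text \<open>Where the absolute value of \<open>u\<close> is at most \<open>s / 2\<close>, the
  integrand is at least \<open>logistic (s / 2)\<close>; elsewhere the subtracted term is at least
  1, as in Markov's inequality. An integral bound on \<open>u\<close> thus forces the mean close to
  1 at large arguments.\<close>

lemma logistic_mean_lower:
  assumes u: "integrable \<U> u" and s: "s > 0"
  shows "logistic (s / 2) - 2 / s * (\<integral>y. \<bar>u y\<bar> \<partial>\<U>) \<le> logistic_mean u s"
proof -
  have "(\<integral>y. logistic (s / 2) - 2 / s * \<bar>u y\<bar> \<partial>\<U>) \<le> logistic_mean u s"
    unfolding logistic_mean_def
  proof (rule integral_mono)
    show "integrable \<U> (\<lambda>y. logistic (s / 2) - 2 / s * \<bar>u y\<bar>)" using u by auto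
    show "integrable \<U> (\<lambda>y. logistic (s + u y))"
      using u by (intro logistic_mean_integrable) auto
    fix y
    show "logistic (s / 2) - 2 / s * \<bar>u y\<bar> \<le> logistic (s + u y)"
    proof (cases "\<bar>u y\<bar> \<le> s / 2")
      case True
      then have "logistic (s / 2) \<le> logistic (s + u y)" by (intro logistic_mono) linarith
      moreover have "0 \<le> 2 / s * \<bar>u y\<bar>" using s by simp
      ultimately show ?thesis by linarith
    next
      case False
      then have "1 \<le> 2 / s * \<bar>u y\<bar>" using s by (simp add: field_simps)
      then show ?thesis using logistic_le_1[of "s / 2"] logistic_ge_0[of "s + u y"] by linarith
    qed
  qed
  also have "(\<integral>y. logistic (s / 2) - 2 / s * \<bar>u y\<bar> \<partial>\<U>) = logistic (s / 2) - 2 / s * (\<integral>y. \<bar>u y\<bar> \<partial>\<U>)"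
    using u U.prob_space by (subst Bochner_Integration.integral_diff) auto
  finally show ?thesis .
qed

lemma logistic_mean_uminus:
  assumes u: "u \<in> borel_measurable \<U>"
  shows "logistic_mean (\<lambda>y. - u y) (- s) = 1 - logistic_mean u s"
proof -
  have "logistic_mean (\<lambda>y. - u y) (- s) = (\<integral>y. 1 - logistic (s + u y) \<partial>\<U>)"
    unfolding logistic_mean_def
  proof (intro Bochner_Integration.integral_cong refl)
    show "logistic (- s + - u y) = 1 - logistic (s + u y)" for y
      using logistic_minus[of "s + u y"] by (simp add: algebra_simps)
  qed
  then show ?thesis
    using logistic_mean_integrable[OF u] U.prob_space unfolding logistic_mean_def
    by (simp add: Bochner_Integration.integral_diff)
qed

lemma logistic_mean_upper:
  assumes u: "integrable \<U> u" and s: "s > 0"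
  shows "logistic_mean u (- s) \<le> logistic (- s / 2) + 2 / s * (\<integral>y. \<bar>u y\<bar> \<partial>\<U>)"
proof -
  have "logistic_mean u (- s) = 1 - logistic_mean (\<lambda>y. - u y) s"
    using logistic_mean_uminus[of "\<lambda>y. - u y" s] u by simp
  moreover have "logistic (s / 2) - 2 / s * (\<integral>y. \<bar>u y\<bar> \<partial>\<U>) \<le> logistic_mean (\<lambda>y. - u y) s"
    using logistic_mean_lower[of "\<lambda>y. - u y" s] u s by simp
  ultimately show ?thesis
    using logistic_minus[of "s / 2"] by simp
qed

text \<open>The lemma covers two situations: \<open>e = 1\<close> with
  \<open>D x y = logistic (g x + g y) - logistic (h x + h y)\<close> and \<open>k = g - h\<close>, and \<open>e = -1\<close> with
  \<open>D x y = logistic (a x + b y) - logistic (b x + a y)\<close> and \<open>k = a - b\<close>.\<close>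

lemma monotone_coupling:
  fixes D :: "real \<Rightarrow> real \<Rightarrow> real" and k :: "real \<Rightarrow> real"
  assumes D[measurable]: "(\<lambda>(x, y). D x y) \<in> borel_measurable (\<U> \<Otimes>\<^sub>M \<U>)"
    and Db: "\<And>x y. x \<in> {0..1} \<Longrightarrow> y \<in> {0..1} \<Longrightarrow> \<bar>D x y\<bar> \<le> C"
    and k[measurable]: "k \<in> borel_measurable \<U>"
    and kb: "\<And>x. x \<in> {0..1} \<Longrightarrow> \<bar>k x\<bar> \<le> C'"
    and e: "e * e = (1::real)"
    and sym: "\<And>x y. x \<in> {0..1} \<Longrightarrow> y \<in> {0..1} \<Longrightarrow> D y x = e * D x y"
    and nonneg: "\<And>x y. x \<in> {0..1} \<Longrightarrow> y \<in> {0..1} \<Longrightarrow> 0 \<le> D x y * (k x + e * k y)"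
    and zero: "\<And>x y. x \<in> {0..1} \<Longrightarrow> y \<in> {0..1} \<Longrightarrow> D x y = 0 \<Longrightarrow> k x + e * k y = 0"
    and le: "\<And>x. x \<in> {0..1} \<Longrightarrow> (\<integral>y. D x y \<partial>\<U>) * k x \<le> 0"
  shows "AE x in \<U>. AE y in \<U>. k x + e * k y = 0"
proof -
  have C': "0 \<le> C'" using kb[of 0] by simp
  have C: "0 \<le> C" using Db[of 0 0] by simp
  have m1: "(\<lambda>(x, y). D x y * k x) \<in> borel_measurable (\<U> \<Otimes>\<^sub>M \<U>)" by measurable
  have m2: "(\<lambda>(x, y). D x y * (e * k y)) \<in> borel_measurable (\<U> \<Otimes>\<^sub>M \<U>)" by measurable
  have b1: "\<bar>D x y * k x\<bar> \<le> C * C'" if "x \<in> {0..1}" "y \<in> {0..1}" for x y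
    unfolding abs_mult using that Db kb C by (intro mult_mono) auto
  have "\<bar>e\<bar> * \<bar>e\<bar> = 1" using e by (simp flip: abs_mult)
  then have "\<bar>e\<bar> = 1" using abs_square_eq_1[of e] e by (simp add: power2_eq_square)
  then have b2: "\<bar>D x y * (e * k y)\<bar> \<le> C * C'" if "x \<in> {0..1}" "y \<in> {0..1}" for x y
    unfolding abs_mult using that Db kb C by (intro mult_mono) auto
  note i1 = integrable_bounded_pair[OF m1 b1] and i2 = integrable_bounded_pair[OF m2 b2]
  note F1 = integrable_inner_unit[OF m1 b1] and F2 = integrable_inner_unit[OF m2 b2]
  have "(\<integral>x. \<integral>y. D x y * k x \<partial>\<U> \<partial>\<U>) \<le> (\<integral>x. 0 \<partial>\<U>)"
    using F1(1) le by (intro integral_mono) auto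
  then have I1: "(\<integral>(x, y). D x y * k x \<partial>(\<U> \<Otimes>\<^sub>M \<U>)) \<le> 0"
    using F1(3) by simp
  \<comment> \<open>Exchanging the variables and using \<open>D y x = e * D x y\<close> turns this
    integral into the previous one.\<close>
  have "(\<integral>(x, y). D x y * (e * k y) \<partial>(\<U> \<Otimes>\<^sub>M \<U>)) = (\<integral>y. \<integral>x. D x y * (e * k y) \<partial>\<U> \<partial>\<U>)"
    using F2(3,4) by simp
  also have "\<dots> = (\<integral>y. \<integral>x. D y x * k y \<partial>\<U> \<partial>\<U>)"
  proof (intro Bochner_Integration.integral_cong refl)
    fix x y assume "x \<in> space \<U>" "y \<in> space \<U>"
    then have "D y x = e * D x y" by (intro sym) auto
    then show "D x y * (e * k y) = D y x * k y" by simp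
  qed
  finally have I2: "(\<integral>(x, y). D x y * (e * k y) \<partial>(\<U> \<Otimes>\<^sub>M \<U>)) \<le> 0"
    using I1 F1(3) by simp
  \<comment> \<open>The sum of the two integrals is nonpositive while the sum of the integrands is
    nonnegative, so it vanishes almost everywhere.\<close>
  let ?G = "\<lambda>z. D (fst z) (snd z) * (k (fst z) + e * k (snd z))"
  have int: "integrable (\<U> \<Otimes>\<^sub>M \<U>) ?G"
    using Bochner_Integration.integrable_add[OF i1 i2] by (simp add: case_prod_beta distrib_left)
  have "(\<integral>z. ?G z \<partial>(\<U> \<Otimes>\<^sub>M \<U>)) \<le> 0"
    using Bochner_Integration.integral_add[OF i1 i2] I1 I2 by (simp add: case_prod_beta distrib_left)
  moreover have nn: "AE z in \<U> \<Otimes>\<^sub>M \<U>. 0 \<le> ?G z"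
    using nonneg by (intro AE_I2) (auto simp: space_pair_measure)
  ultimately have "(\<integral>z. ?G z \<partial>(\<U> \<Otimes>\<^sub>M \<U>)) = 0"
    using integral_nonneg_AE[OF nn] by simp
  then have "AE z in \<U> \<Otimes>\<^sub>M \<U>. ?G z = 0"
    using integral_nonneg_eq_0_iff_AE[OF int nn] by simp
  then have "AE z in \<U> \<Otimes>\<^sub>M \<U>. k (fst z) + e * k (snd z) = 0"
    using AE_space by eventually_elim (use zero in \<open>auto simp: space_pair_measure\<close>)
  from UU.AE_pair[OF this] show ?thesis by simp
qed

lemma AE_unit_ex: "AE x in \<U>. P x \<Longrightarrow> \<exists>x\<in>{0..1}. P x"
proof (rule ccontr)
  assume "AE x in \<U>. P x" "\<not> (\<exists>x\<in>{0..1}. P x)"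
  from this(1) AE_space have "AE x in \<U>. False"
    by eventually_elim (use \<open>\<not> (\<exists>x\<in>{0..1}. P x)\<close> in simp)
  then show False by simp
qed

lemma limit_equation_unique:
  assumes "g \<in> Dprime" "h \<in> Dprime" "solves_limit_equation f g" "solves_limit_equation f h"
  shows "g = h"
proof -
  have g: "antimono_on {0..1} g" and h: "antimono_on {0..1} h"
    using assms by (auto simp: Dprime_def)
  note [measurable] = measurable_antimono_unit[OF g] measurable_antimono_unit[OF h]
  have eq: "logistic_mean g (g x) = logistic_mean h (h x)" if "x \<in> {0..1}" for x
    using assms(3,4) that by (simp add: solves_limit_equation_iff)
  have coupl: "AE x in \<U>. AE y in \<U>. (g x - h x) + 1 * (g y - h y) = 0"
  proof (rule monotone_coupling[where D="\<lambda>x y. logistic (g x + g y) - logistic (h x + h y)"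
        and C=1 and C'="(\<bar>g 0\<bar> + \<bar>g 1\<bar>) + (\<bar>h 0\<bar> + \<bar>h 1\<bar>)"])
    fix x y :: real assume xy: "x \<in> {0..1}" "y \<in> {0..1}"
    show "\<bar>logistic (g x + g y) - logistic (h x + h y)\<bar> \<le> 1"
      using logistic_ge_0[of "g x + g y"] logistic_le_1[of "g x + g y"]
        logistic_ge_0[of "h x + h y"] logistic_le_1[of "h x + h y"] by linarith
    show "0 \<le> (logistic (g x + g y) - logistic (h x + h y)) * (g x - h x + 1 * (g y - h y))"
      using logistic_mono[of "g x + g y" "h x + h y"] logistic_mono[of "h x + h y" "g x + g y"]
      by (cases "g x + g y \<le> h x + h y") (auto intro: mult_nonpos_nonpos)
  next
    fix x :: real assume x: "x \<in> {0..1}"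
    show "\<bar>g x - h x\<bar> \<le> (\<bar>g 0\<bar> + \<bar>g 1\<bar>) + (\<bar>h 0\<bar> + \<bar>h 1\<bar>)"
      using antimono_unit_bounds(3)[OF g x] antimono_unit_bounds(3)[OF h x] by linarith
    have "(\<integral>y. logistic (g x + g y) - logistic (h x + h y) \<partial>\<U>) = 0"
      using eq[OF x] unfolding logistic_mean_def
      by (subst Bochner_Integration.integral_diff) (auto intro!: logistic_mean_integrable)
    then show "(\<integral>y. logistic (g x + g y) - logistic (h x + h y) \<partial>\<U>) * (g x - h x) \<le> 0"
      by simp
  qed (auto simp: add.commute)
  \<comment> \<open>Write \<open>k = g - h\<close>. Almost every \<open>y\<close> has
    \<open>k y = - k x\<close>; taking such a point as \<open>z\<close> gives also
    \<open>k y = - k z = k x\<close> almost everywhere, whence \<open>k x = 0\<close>.\<close>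
  obtain x where x: "AE y in \<U>. (g x - h x) + 1 * (g y - h y) = 0" "x \<in> {0..1}"
    using AE_unit_ex[OF coupl] by blast
  then have ae: "AE y in \<U>. g y - h y = - (g x - h x)" by (auto elim: eventually_mono)
  then obtain z where z: "AE y in \<U>. (g z - h z) + 1 * (g y - h y) = 0" "g z - h z = - (g x - h x)"
    using AE_unit_ex[OF AE_conjI[OF coupl ae]] by auto
  from z(1) ae have "AE y in \<U>. g x - h x = 0"
    by eventually_elim (use z(2) in simp)
  then have "g x - h x = 0" by simp
  then have ae0: "AE y in \<U>. g y = h y" using ae by simp
  \<comment> \<open>Equality almost everywhere makes \<open>logistic_mean g\<close> and
    \<open>logistic_mean h\<close> the same function, and its injectivity upgrades the equality to
    every point.\<close>
  have "g y = h y" if "y \<in> {0..1}" for y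
  proof -
    have "logistic_mean g (g y) = logistic_mean g (h y)"
      using eq[OF that] logistic_mean_cong_AE[OF _ _ ae0, of "h y"] by simp
    then show ?thesis using logistic_mean_eq_iff[of g] by simp
  qed
  then show ?thesis
    using assms(1,2) by (auto simp: Dprime_def intro: extensionalityI)
qed

section \<open>Truncated equations and their antitone cycle\<close>

text \<open>Complementarity form of \<open>logistic_mean u s = y\<close> on \<open>[-B, B]\<close>:
  equality holds strictly inside, at \<open>B\<close> the mean may still be too small, at
  \<open>- B\<close> still too large.\<close>

definition clamped_solution :: "real \<Rightarrow> (real \<Rightarrow> real) \<Rightarrow> real \<Rightarrow> real \<Rightarrow> bool" where
  "clamped_solution B u y s \<longleftrightarrow> - B \<le> s \<and> s \<le> B \<and>
     (s < B \<longrightarrow> y \<le> logistic_mean u s) \<and> (- B < s \<longrightarrow> logistic_mean u s \<le> y)"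

lemma clamped_solution_exists:
  assumes u: "u \<in> borel_measurable \<U>" and B: "0 \<le> B"
  shows "\<exists>s. clamped_solution B u y s"
proof -
  consider "y \<le> logistic_mean u (- B)" | "logistic_mean u B \<le> y"
    | "logistic_mean u (- B) \<le> y" "y \<le> logistic_mean u B" by linarith
  then show ?thesis
  proof cases
    case 1
    then show ?thesis using B by (intro exI[of _ "- B"]) (auto simp: clamped_solution_def)
  next
    case 2
    then show ?thesis using B by (intro exI[of _ B]) (auto simp: clamped_solution_def)
  next
    case 3
    then obtain s where "- B \<le> s" "s \<le> B" "logistic_mean u s = y"
      using IVT'[of "logistic_mean u" "- B" y B] B continuous_on_logistic_mean[OF u] by auto
    then show ?thesis by (auto simp: clamped_solution_def)
  qed
qed

text \<open>If \<open>s' < s\<close>, then \<open>s\<close> is not at the lower end and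
  \<open>s'\<close> not at the upper end, so both inequalities are available and contradict strict
  monotonicity. With \<open>u = v\<close> and \<open>y = y'\<close> the lemma is uniqueness.\<close>

lemma clamped_solution_mono:
  assumes "clamped_solution B u y s" "clamped_solution B v y' s'"
    and u: "u \<in> borel_measurable \<U>" and v: "v \<in> borel_measurable \<U>"
    and vu: "\<And>x. x \<in> {0..1} \<Longrightarrow> v x \<le> u x" and y: "y \<le> y'"
  shows "s \<le> s'"
proof (rule ccontr)
  assume "\<not> s \<le> s'"
  then have s: "s' < s" by simp
  then have "logistic_mean u s \<le> y" "y' \<le> logistic_mean v s'"
    using assms(1,2) by (auto simp: clamped_solution_def)
  moreover have "logistic_mean v s' \<le> logistic_mean u s'"
    by (rule logistic_mean_mono[OF v u vu]) auto
  moreover have "logistic_mean u s' < logistic_mean u s"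
    by (rule logistic_mean_strict_mono[OF u s])
  ultimately show False using y by linarith
qed

text \<open>Solving one of the two equations for given values of the other function is an antitone
  operation, so its square is monotone and has a fixed point by the argument of Knaster and
  Tarski.\<close>

lemma clamped_cycle_exists:
  assumes f: "antimono_on {0..1} f" and B: "0 \<le> (B::real)"
  obtains a b where "antimono_on {0..1} a" "antimono_on {0..1} b"
    "\<And>x. x \<in> {0..1} \<Longrightarrow> clamped_solution B b (f x) (a x)"
    "\<And>x. x \<in> {0..1} \<Longrightarrow> clamped_solution B a (f x) (b x)"
proof -
  define T where "T u x = (SOME s. clamped_solution B u (f x) s)" for u x
  \<comment> \<open>Monotonicity is built into the lattice because it passes to arbitrary pointwise
    infima and implies measurability, which infima of uncountable families may lose.\<close>
  define L where "L = {u. antimono_on {0..1} u \<and> (\<forall>x\<in>{0..1::real}. - B \<le> u x \<and> u x \<le> B)}"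
  have Lm: "u \<in> borel_measurable \<U>" if "u \<in> L" for u
    using that measurable_antimono_unit by (auto simp: L_def)
  have T: "clamped_solution B u (f x) (T u x)" if "u \<in> L" for u x
    unfolding T_def using someI_ex[OF clamped_solution_exists[OF Lm[OF that] B]] .
  have Tmono: "T u x \<le> T v x" if "u \<in> L" "v \<in> L" "\<And>x. x \<in> {0..1} \<Longrightarrow> v x \<le> u x" for u v x
    by (rule clamped_solution_mono[OF T[OF that(1)] T[OF that(2)] Lm[OF that(1)] Lm[OF that(2)] that(3)]) auto
  have TL: "T u \<in> L" if u: "u \<in> L" for u
  proof -
    have "antimono_on {0..1} (T u)"
    proof (rule monotone_onI)
      fix x y :: real assume "x \<in> {0..1}" "y \<in> {0..1}" "x \<le> y"
      then have "f y \<le> f x" by (rule monotone_onD[OF f])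
      then show "T u x \<ge> T u y"
        by (intro clamped_solution_mono[OF T[OF u] T[OF u] Lm[OF u] Lm[OF u]]) auto
    qed
    then show ?thesis using T[OF u] by (auto simp: L_def clamped_solution_def)
  qed
  \<comment> \<open>The pre-fixed points of the monotone map that applies \<open>T\<close> twice;
    their infimum \<open>a\<close> is its least fixed point on the unit interval, and the 2-cycle
    consists of \<open>a\<close> and \<open>T a\<close>.\<close>
  define P where "P = {u \<in> L. \<forall>x\<in>{0..1}. T (T u) x \<le> u x}"
  define a where "a x = (INF u\<in>P. u x)" for x
  have "(\<lambda>_. B) \<in> L" using B by (auto simp: L_def intro: monotone_onI)
  moreover from this have "T (T (\<lambda>_. B)) \<in> L" by (intro TL)
  ultimately have "(\<lambda>_. B) \<in> P" by (simp add: P_def L_def)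
  then have P: "P \<noteq> {}" by blast
  have bdd: "bdd_below ((\<lambda>u. u x) ` P)" if "x \<in> {0..1}" for x
    using that by (intro bdd_belowI[of _ "- B"]) (auto simp: P_def L_def)
  have aP: "a x \<le> u x" if "u \<in> P" "x \<in> {0..1}" for u x
    unfolding a_def using that bdd by (intro cINF_lower) auto
  have aL: "a \<in> L"
  proof -
    have "antimono_on {0..1} a"
    proof (rule monotone_onI)
      fix x y :: real assume xy: "x \<in> {0..1}" "y \<in> {0..1}" "x \<le> y"
      show "a x \<ge> a y"
        unfolding a_def
      proof (rule cINF_greatest[OF P])
        fix u assume "u \<in> P"
        then have "a y \<le> u y" "u y \<le> u x"
          using aP xy by (auto simp: P_def L_def intro: monotone_onD)
        then show "(INF u\<in>P. u y) \<le> u x" by (simp add: a_def)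
      qed
    qed
    moreover have "- B \<le> a x" if "x \<in> {0..1}" for x
      unfolding a_def using that by (intro cINF_greatest[OF P]) (auto simp: P_def L_def)
    moreover have "a x \<le> B" if "x \<in> {0..1}" for x
    proof -
      obtain u where "u \<in> P" using P by auto
      then have "a x \<le> u x" "u x \<le> B" using aP that by (auto simp: P_def L_def)
      then show ?thesis by simp
    qed
    ultimately show ?thesis by (auto simp: L_def)
  qed
  have TTmono: "T (T u) x \<le> T (T v) x" if "u \<in> L" "v \<in> L" "\<And>x. x \<in> {0..1} \<Longrightarrow> u x \<le> v x" for u v x
    using that by (intro Tmono TL)
  have 1: "T (T a) x \<le> a x" if x: "x \<in> {0..1}" for x
    unfolding a_def[of x]
  proof (rule cINF_greatest[OF P])
    fix u assume u: "u \<in> P"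
    then have "T (T a) x \<le> T (T u) x" using aP aL by (intro TTmono) (auto simp: P_def)
    also have "\<dots> \<le> u x" using u x by (auto simp: P_def)
    finally show "T (T a) x \<le> u x" .
  qed
  have "T (T a) \<in> P"
    using TTmono[OF TL[OF TL[OF aL]] aL 1] TL[OF TL[OF aL]] by (simp add: P_def)
  then have 2: "T (T a) x = a x" if "x \<in> {0..1}" for x
    using aP 1 that by (intro antisym) auto
  show ?thesis
  proof (rule that[of a "T a"])
    show "antimono_on {0..1} a" "antimono_on {0..1} (T a)"
      using aL TL[OF aL] by (auto simp: L_def)
    show "clamped_solution B a (f x) (T a x)" for x
      by (rule T[OF aL])
    show "clamped_solution B (T a) (f x) (a x)" if "x \<in> {0..1}" for x
      using T[OF TL[OF aL], of x] 2[OF that] by simp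
  qed
qed

section \<open>A priori bounds and removal of the truncation\<close>

text \<open>Symmetrising replaces \<open>u x\<close> by half of \<open>s = u x + u y\<close>, and
  \<open>logistic s * s \<ge> max 0 s - 1\<close>. The loss \<open>1 / 2\<close> is the same for all
  \<open>u\<close>, which makes the a priori bound independent of the truncation.\<close>

lemma symmetrised_integral:
  fixes u :: "real \<Rightarrow> real"
  assumes u: "antimono_on {0..1} u"
  shows "positive_energy u / 2 - 1 / 2 \<le> (\<integral>x. logistic_mean u (u x) * u x \<partial>\<U>)"
proof -
  note [measurable] = measurable_antimono_unit[OF u]
  let ?C = "\<bar>u 0\<bar> + \<bar>u 1\<bar>"
  note ub = antimono_unit_bounds(3)[OF u]
  have m1: "(\<lambda>(x, y). logistic (u x + u y) * u x) \<in> borel_measurable (\<U> \<Otimes>\<^sub>M \<U>)" by measurable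
  have m2: "(\<lambda>(x, y). logistic (u x + u y) * u y) \<in> borel_measurable (\<U> \<Otimes>\<^sub>M \<U>)" by measurable
  have m3: "(\<lambda>(x, y). max 0 (u x + u y)) \<in> borel_measurable (\<U> \<Otimes>\<^sub>M \<U>)" by measurable
  have b1: "\<bar>logistic (u x + u y) * u x\<bar> \<le> 1 * ?C" if "x \<in> {0..1}" "y \<in> {0..1}" for x y
    unfolding abs_mult using ub[OF that(1)] by (intro mult_mono) auto
  have b2: "\<bar>logistic (u x + u y) * u y\<bar> \<le> 1 * ?C" if "x \<in> {0..1}" "y \<in> {0..1}" for x y
    unfolding abs_mult using ub[OF that(2)] by (intro mult_mono) auto
  note b3 = abs_positive_part_bound[OF u]
  note i = integrable_bounded_pair[OF m1 b1] integrable_bounded_pair[OF m2 b2] integrable_bounded_pair[OF m3 b3]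
  note F1 = integrable_inner_unit[OF m1 b1] and F2 = integrable_inner_unit[OF m2 b2]
    and F3 = integrable_inner_unit[OF m3 b3]
  let ?l1 = "\<lambda>z. case z of (x, y) \<Rightarrow> logistic (u x + u y) * u x"
  let ?l2 = "\<lambda>z. case z of (x, y) \<Rightarrow> logistic (u x + u y) * u y"
  let ?m = "\<lambda>z. case z of (x, y) \<Rightarrow> max 0 (u x + u y)"
  have "(\<integral>x. logistic_mean u (u x) * u x \<partial>\<U>) = (\<integral>z. ?l1 z \<partial>(\<U> \<Otimes>\<^sub>M \<U>))"
    unfolding logistic_mean_def using F1(3) by simp
  moreover have "(\<integral>z. ?l2 z \<partial>(\<U> \<Otimes>\<^sub>M \<U>)) = (\<integral>z. ?l1 z \<partial>(\<U> \<Otimes>\<^sub>M \<U>))"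
  proof -
    have "(\<integral>z. ?l2 z \<partial>(\<U> \<Otimes>\<^sub>M \<U>)) = (\<integral>y. \<integral>x. logistic (u x + u y) * u y \<partial>\<U> \<partial>\<U>)"
      by (rule trans[OF F2(3)[symmetric] F2(4)])
    also have "\<dots> = (\<integral>x. \<integral>y. logistic (u x + u y) * u x \<partial>\<U> \<partial>\<U>)"
      by (simp only: add.commute)
    finally show ?thesis by (simp only: F1(3))
  qed
  ultimately have "2 * (\<integral>x. logistic_mean u (u x) * u x \<partial>\<U>) =
      (\<integral>z. ?l1 z + ?l2 z \<partial>(\<U> \<Otimes>\<^sub>M \<U>))"
    using Bochner_Integration.integral_add[OF i(1,2)] by linarith
  moreover have "(\<integral>z. ?m z - 1 \<partial>(\<U> \<Otimes>\<^sub>M \<U>)) \<le> (\<integral>z. ?l1 z + ?l2 z \<partial>(\<U> \<Otimes>\<^sub>M \<U>))"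
  proof (rule integral_mono)
    show "integrable (\<U> \<Otimes>\<^sub>M \<U>) (\<lambda>z. ?m z - 1)"
      using i(3) by auto
    show "integrable (\<U> \<Otimes>\<^sub>M \<U>) (\<lambda>z. ?l1 z + ?l2 z)"
      using i(1,2) by (rule Bochner_Integration.integrable_add)
    have *: "max 0 s - 1 \<le> logistic s * s" for s :: real
    proof -
      \<comment> \<open>This is \<open>s / (1 + exp s) \<le> 1\<close>; negative arguments reduce to
        it by \<open>logistic_minus\<close>.\<close>
      have pos: "s * (1 - logistic s) \<le> 1" if "s \<ge> 0" for s
      proof -
        have "s \<le> 1 + exp s" using exp_ge_add_one_self[of s] by linarith
        then show ?thesis using that by (simp add: one_minus_logistic field_simps add_pos_pos)
      qed
      show ?thesis
      proof (cases "s \<ge> 0")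
        case True
        then show ?thesis using pos[of s] by (simp add: algebra_simps)
      next
        case False
        then show ?thesis using pos[of "- s"] by (simp add: logistic_minus algebra_simps)
      qed
    qed
    show "?m z - 1 \<le> ?l1 z + ?l2 z" for z
      using *[of "u (fst z) + u (snd z)"] by (simp add: case_prod_beta distrib_left)
  qed
  moreover have "(\<integral>z. ?m z - 1 \<partial>(\<U> \<Otimes>\<^sub>M \<U>)) = positive_energy u - 1"
    unfolding F3(3)[symmetric]
    using Bochner_Integration.integral_diff[OF i(3), of "\<lambda>_. 1"] UU.prob_space F3(3) by simp
  ultimately show ?thesis by simp
qed

text \<open>Where \<open>a x = B\<close> the mean is at most \<open>f x\<close>, and where
  \<open>a x = - B\<close> it is at least \<open>f x\<close>, so the mean times \<open>a\<close> is
  pointwise at most \<open>f\<close> times \<open>a\<close>. With coercivity and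
  \<open>symmetrised_integral\<close>, \<delta> times the integral of the absolute value of
  \<open>a\<close> is then at most \<open>1 / 2\<close>, and the assumptions on \<open>B\<close>
  exclude both ends.\<close>

lemma clamped_fixed_point_solves:
  assumes f: "antimono_on {0..1} f" and a: "antimono_on {0..1} a" and \<delta>: "\<delta> > 0" and B: "B > 0"
    and coercive: "(\<integral>x. f x * a x \<partial>\<U>) + \<delta> * (\<integral>x. \<bar>a x\<bar> \<partial>\<U>) \<le>
       positive_energy a / 2"
    and B1: "f 0 < logistic (B / 2) - 1 / (\<delta> * B)"
    and B2: "logistic (- B / 2) + 1 / (\<delta> * B) < f 1"
    and fix_pt: "\<And>x. x \<in> {0..1} \<Longrightarrow> clamped_solution B a (f x) (a x)"
    and x: "x \<in> {0..1}"
  shows "logistic_mean a (a x) = f x"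
proof -
  note am[measurable] = measurable_antimono_unit[OF a] and fm[measurable] = measurable_antimono_unit[OF f]
  have mean_bound: "\<bar>logistic_mean a s\<bar> \<le> 1" for s
  proof -
    have "0 \<le> logistic_mean a s" unfolding logistic_mean_def
      by (rule Bochner_Integration.integral_nonneg) simp
    moreover have "logistic_mean a s \<le> (\<integral>y. 1 \<partial>\<U>)" unfolding logistic_mean_def
      by (intro integral_mono logistic_mean_integrable am) auto
    ultimately show ?thesis using U.prob_space by simp
  qed
  have "logistic_mean a \<in> borel_measurable borel"
    by (intro borel_measurable_continuous_onI continuous_on_logistic_mean am)
  from measurable_compose[OF am this]
  have meanm[measurable]: "(\<lambda>x. logistic_mean a (a x)) \<in> borel_measurable \<U>" .
  have "(\<integral>x. logistic_mean a (a x) * a x \<partial>\<U>) \<le> (\<integral>x. f x * a x \<partial>\<U>)"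
  proof (rule integral_mono)
    show "integrable \<U> (\<lambda>x. logistic_mean a (a x) * a x)"
    proof (rule integrable_bounded_unit[where C="1 * (\<bar>a 0\<bar> + \<bar>a 1\<bar>)"])
      show "\<bar>logistic_mean a (a x) * a x\<bar> \<le> 1 * (\<bar>a 0\<bar> + \<bar>a 1\<bar>)" if "x \<in> {0..1}" for x
        unfolding abs_mult using antimono_unit_bounds(3)[OF a that] mean_bound by (intro mult_mono) auto
    qed measurable
    show "integrable \<U> (\<lambda>x. f x * a x)" by (rule integrable_mult_antimono_unit[OF f a])
    fix x assume "x \<in> space \<U>"
    then have "clamped_solution B a (f x) (a x)" using fix_pt by simp
    then show "logistic_mean a (a x) * a x \<le> f x * a x"
      using B unfolding clamped_solution_def
      by (cases "a x" "0::real" rule: linorder_cases) (auto intro: mult_right_mono mult_right_mono_neg)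
  qed
  then have "\<delta> * (\<integral>x. \<bar>a x\<bar> \<partial>\<U>) \<le> 1 / 2"
    using coercive symmetrised_integral[OF a] by linarith
  then have "(\<integral>x. \<bar>a x\<bar> \<partial>\<U>) \<le> 1 / (2 * \<delta>)"
    using \<delta> by (simp add: field_simps)
  \<comment> \<open>The error term of the mean bounds at argument \<open>B\<close>; its bound
    \<open>1 / (\<delta> * B)\<close> is the correction in the assumptions on
    \<open>B\<close>.\<close>
  then have "2 / B * (\<integral>x. \<bar>a x\<bar> \<partial>\<U>) \<le> 2 / B * (1 / (2 * \<delta>))"
    using B by (intro mult_left_mono) auto
  also have "\<dots> = 1 / (\<delta> * B)" by simp
  finally have small: "2 / B * (\<integral>x. \<bar>a x\<bar> \<partial>\<U>) \<le> 1 / (\<delta> * B)" .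
  have "f 0 < logistic_mean a B" "logistic_mean a (- B) < f 1"
    using logistic_mean_lower[OF integrable_antimono_unit[OF a] B]
      logistic_mean_upper[OF integrable_antimono_unit[OF a] B] B1 B2 small by linarith+
  moreover have "f 1 \<le> f x" "f x \<le> f 0" using antimono_unit_bounds[OF f x] by auto
  ultimately have "a x \<noteq> B" "a x \<noteq> - B"
    using fix_pt[OF x] B by (auto simp: clamped_solution_def)
  then show ?thesis using fix_pt[OF x] by (auto simp: clamped_solution_def)
qed

text \<open>Since \<open>b = a + c\<close>, both \<open>logistic_mean b (a x)\<close> and
  \<open>logistic_mean a (b x)\<close> average \<open>logistic (a x + a y + c)\<close>, which is the
  mean for the shifted function. As \<open>a x < b x\<close>, the value \<open>a x\<close> is not at
  the upper and \<open>b x\<close> not at the lower end, so \<open>f x\<close> is squeezed between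
  equal quantities whether or not the truncation is active.\<close>

lemma clamped_cycle_solves:
  assumes a: "antimono_on {0..1} a" and b: "antimono_on {0..1} b"
    and cl: "\<And>x. x \<in> {0..1} \<Longrightarrow> clamped_solution B b (f x) (a x)"
      "\<And>x. x \<in> {0..1} \<Longrightarrow> clamped_solution B a (f x) (b x)"
    and c: "AE y in \<U>. b y = a y + c" "c > 0"
  shows "AE x in \<U>. logistic_mean (\<lambda>y. a y + c / 2) (a x + c / 2) = f x"
proof -
  note [measurable] = measurable_antimono_unit[OF a] measurable_antimono_unit[OF b]
  have shift: "logistic_mean (\<lambda>y. a y + c / 2) (s + c / 2) = logistic_mean (\<lambda>y. a y + c) s"
      "logistic_mean (\<lambda>y. a y + c / 2) (s + c / 2) = logistic_mean a (s + c)" for s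
    unfolding logistic_mean_def by (simp_all add: algebra_simps)
  have b': "logistic_mean b s = logistic_mean (\<lambda>y. a y + c) s" for s
    using c by (intro logistic_mean_cong_AE) auto
  from c(1) AE_space show ?thesis
  proof eventually_elim
    case (elim x)
    then have x: "x \<in> {0..1}" by simp
    have "f x \<le> logistic_mean b (a x)" "logistic_mean a (b x) \<le> f x"
      using cl[OF x] elim c(2) by (auto simp: clamped_solution_def)
    then show ?case using elim shift[of "a x"] b'[of "a x"] by simp
  qed
qed

lemma filterlim_half_at_top: "filterlim (\<lambda>s::real. s / 2) at_top at_top"
  using filterlim_tendsto_pos_mult_at_top[OF tendsto_const[of "1/2 :: real"] _ filterlim_ident] by simp

lemma logistic_bounds_eventually:
  fixes p q C :: real
  assumes "p < 1" "0 < q"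
  obtains s where "s > 0" "p < logistic (s / 2) - C / s" "logistic (- s / 2) + C / s < q"
proof -
  have inv: "((\<lambda>s::real. C / s) \<longlongrightarrow> 0) at_top"
    by (intro tendsto_divide_0[OF tendsto_const] filterlim_at_top_imp_at_infinity filterlim_ident)
  have "((\<lambda>s. logistic (s / 2) - C / s) \<longlongrightarrow> 1 - 0) at_top"
    by (intro tendsto_diff inv filterlim_compose[OF logistic_at_top filterlim_half_at_top])
  then have 1: "eventually (\<lambda>s. p < logistic (s / 2) - C / s) at_top"
    using assms by (intro order_tendstoD) auto
  have "((\<lambda>s. logistic (- s / 2) + C / s) \<longlongrightarrow> 0 + 0) at_top"
    using filterlim_compose[OF logistic_at_bot
        filterlim_compose[OF filterlim_uminus_at_bot_at_top filterlim_half_at_top]]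
    by (intro tendsto_add inv) simp
  then have 2: "eventually (\<lambda>s. logistic (- s / 2) + C / s < q) at_top"
    using assms by (intro order_tendstoD) auto
  show ?thesis
    using eventually_happens[OF eventually_conj[OF 1 eventually_conj[OF 2 eventually_gt_at_top[of 0]]]] that
    by auto
qed

text \<open>The function \<open>logistic_mean u\<close> does not see null sets, so inverting it at
  \<open>f x\<close> for every \<open>x\<close> defines \<open>g\<close> pointwise. Monotonicity and
  left continuity of \<open>f\<close> pass to \<open>g\<close> through the inverse.\<close>

lemma limit_equation_of_AE_solution:
  assumes fD: "f \<in> Dprime" and f01: "f 0 < 1" "0 < f 1" and u: "antimono_on {0..1} u"
    and sol: "AE x in \<U>. logistic_mean u (u x) = f x"
  shows "\<exists>g\<in>Dprime. solves_limit_equation f g"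
proof -
  have f: "antimono_on {0..1} f" and fl: "\<And>x. x \<in> {0<..<1} \<Longrightarrow> continuous (at_left x) f"
    using fD by (auto simp: Dprime_def)
  note um = measurable_antimono_unit[OF u] and ui = integrable_antimono_unit[OF u]
  let ?I = "(\<integral>y. \<bar>u y\<bar> \<partial>\<U>)"
  \<comment> \<open>By the two mean bounds, \<open>logistic_mean u\<close> then passes every value
    of \<open>f\<close> between \<open>- s\<close> and \<open>s\<close>.\<close>
  obtain s where s: "s > 0" "f 0 < logistic (s / 2) - 2 * ?I / s" "logistic (- s / 2) + 2 * ?I / s < f 1"
    using logistic_bounds_eventually[OF f01] by blast
  have ex: "\<exists>s. logistic_mean u s = f x" if x: "x \<in> {0..1}" for x
  proof -
    have "f 1 \<le> f x" "f x \<le> f 0" using antimono_unit_bounds[OF f x] by auto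
    then have "logistic_mean u (- s) \<le> f x" "f x \<le> logistic_mean u s"
      using logistic_mean_lower[OF ui s(1)] logistic_mean_upper[OF ui s(1)] s(2,3) by auto
    then show ?thesis
      using IVT'[of "logistic_mean u" "- s" "f x" s] s(1) continuous_on_logistic_mean[OF um] by auto
  qed
  define g where "g = (\<lambda>x\<in>{0..1}. SOME s. logistic_mean u s = f x)"
  have g: "logistic_mean u (g x) = f x" if "x \<in> {0..1}" for x
    using someI_ex[OF ex[OF that]] that by (simp add: g_def)
  have gm: "antimono_on {0..1} g"
  proof (rule monotone_onI)
    fix x y :: real assume "x \<in> {0..1}" "y \<in> {0..1}" "x \<le> y"
    then have "f y \<le> f x" "f x = logistic_mean u (g x)" "f y = logistic_mean u (g y)"
      using monotone_onD[OF f, of x y] g by auto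
    then show "g x \<ge> g y" using logistic_mean_less_iff[OF um, of "g x" "g y"] by simp
  qed
  have "continuous (at_left x) g" if x: "x \<in> {0<..<1}" for x
  proof -
    have ev: "eventually (\<lambda>y. y \<in> {0..1} \<and> y < x) (at_left x)"
      using x by (auto simp: eventually_at_left_field intro!: exI[of _ 0])
    have x': "x \<in> {0..1}" using x by auto
    have "(g \<longlongrightarrow> g x) (at_left x)"
    proof (rule order_tendstoI)
      fix a assume a: "a < g x"
      show "eventually (\<lambda>y. a < g y) (at_left x)"
        using ev
      proof eventually_elim
        case (elim y)
        then have "g x \<le> g y" using monotone_onD[OF gm, of y x] x' by auto
        then show ?case using a by simp
      qed
    next
      fix a assume a: "g x < a"
      then have "f x < logistic_mean u a"
        using logistic_mean_strict_mono[OF um a] g[OF x'] by simp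
      moreover have "(f \<longlongrightarrow> f x) (at_left x)" using fl[OF x] by (simp add: continuous_within)
      ultimately have "eventually (\<lambda>y. f y < logistic_mean u a) (at_left x)"
        by (intro order_tendstoD)
      with ev show "eventually (\<lambda>y. g y < a) (at_left x)"
      proof eventually_elim
        case (elim y)
        then have "logistic_mean u (g y) < logistic_mean u a" using g by simp
        then show ?case using logistic_mean_less_iff[OF um] by simp
      qed
    qed
    then show ?thesis by (simp add: continuous_within)
  qed
  then have gD: "g \<in> Dprime" using gm by (auto simp: Dprime_def g_def)
  have "AE x in \<U>. u x = g x"
    using sol AE_space
  proof eventually_elim
    case (elim x)
    then have "logistic_mean u (u x) = logistic_mean u (g x)" using g by simp
    then show ?case using logistic_mean_eq_iff[OF um] by simp
  qed
  then have "logistic_mean u s = logistic_mean g s" for s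
    by (intro logistic_mean_cong_AE um measurable_antimono_unit[OF gm])
  then have "solves_limit_equation f g"
    using g by (simp add: solves_limit_equation_iff)
  then show ?thesis using gD by blast
qed

lemma limit_equation_solvable:
  assumes fD: "f \<in> Dprime" and int: "f \<in> Dprime_topology interior_of scaling_limits"
  shows "\<exists>!g. g \<in> Dprime \<and> solves_limit_equation f g"
proof -
  obtain \<delta> where \<delta>: "\<delta> > 0" and f01: "f 0 < 1" "0 < f 1" and
    coercive: "\<And>u. antimono_on {0..1} u \<Longrightarrow> (\<integral>x. f x * u x \<partial>\<U>) + \<delta> * (\<integral>x. \<bar>u x\<bar> \<partial>\<U>) \<le>
       positive_energy u / 2"
    using interior_coercive[OF int fD] by blast
  have f: "antimono_on {0..1} f" using fD by (simp add: Dprime_def)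
  \<comment> \<open>The constant is \<open>1 / \<delta>\<close> because the solution will have
    integral norm at most \<open>1 / (2 * \<delta>)\<close>, and the mean bounds double it.\<close>
  obtain B where "B > 0" "f 0 < logistic (B / 2) - (1 / \<delta>) / B" "logistic (- B / 2) + (1 / \<delta>) / B < f 1"
    using logistic_bounds_eventually[OF f01] by blast
  then have B: "f 0 < logistic (B / 2) - 1 / (\<delta> * B)" "logistic (- B / 2) + 1 / (\<delta> * B) < f 1" "B > 0"
    by simp_all
  obtain a b where a: "antimono_on {0..1} a" and b: "antimono_on {0..1} b"
    and cl: "\<And>x. x \<in> {0..1} \<Longrightarrow> clamped_solution B b (f x) (a x)"
      "\<And>x. x \<in> {0..1} \<Longrightarrow> clamped_solution B a (f x) (b x)"
    using clamped_cycle_exists[OF f, of B] B(3) by auto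
  note am[measurable] = measurable_antimono_unit[OF a] and bm[measurable] = measurable_antimono_unit[OF b]
  \<comment> \<open>The coupling with \<open>e = - 1\<close>: its conclusion says that
    \<open>a - b\<close> is constant almost everywhere.\<close>
  have "AE x in \<U>. AE y in \<U>. (a x - b x) + (- 1) * (a y - b y) = 0"
  proof (rule monotone_coupling[where D="\<lambda>x y. logistic (a x + b y) - logistic (b x + a y)" and C=1 and C'="2 * B"])
    fix x y :: real
    show "\<bar>logistic (a x + b y) - logistic (b x + a y)\<bar> \<le> 1"
      using logistic_ge_0[of "a x + b y"] logistic_le_1[of "a x + b y"]
        logistic_ge_0[of "b x + a y"] logistic_le_1[of "b x + a y"] by linarith
    show "0 \<le> (logistic (a x + b y) - logistic (b x + a y)) * ((a x - b x) + (- 1) * (a y - b y))"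
      using logistic_mono[of "a x + b y" "b x + a y"] logistic_mono[of "b x + a y" "a x + b y"]
      by (cases "a x + b y \<le> b x + a y") (auto intro: mult_nonpos_nonpos)
  next
    fix x :: real assume x: "x \<in> {0..1}"
    show "\<bar>a x - b x\<bar> \<le> 2 * B"
      using cl[OF x] by (auto simp: clamped_solution_def)
    have "(\<integral>y. logistic (a x + b y) - logistic (b x + a y) \<partial>\<U>) = logistic_mean b (a x) - logistic_mean a (b x)"
      unfolding logistic_mean_def
      by (subst Bochner_Integration.integral_diff) (auto intro!: logistic_mean_integrable)
    \<comment> \<open>The smaller of the two values is not at the upper end and the larger not at
      the lower end, so one clamped inequality of each is available, and \<open>f x\<close>
      separates the two means.\<close>
    moreover have "(logistic_mean b (a x) - logistic_mean a (b x)) * (a x - b x) \<le> 0"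
    proof (cases "a x" "b x" rule: linorder_cases)
      case less
      then have "f x \<le> logistic_mean b (a x)" "logistic_mean a (b x) \<le> f x"
        using cl[OF x] by (auto simp: clamped_solution_def)
      then show ?thesis using less by (intro mult_nonneg_nonpos) auto
    next
      case greater
      then have "logistic_mean b (a x) \<le> f x" "f x \<le> logistic_mean a (b x)"
        using cl[OF x] by (auto simp: clamped_solution_def)
      then show ?thesis using greater by (intro mult_nonpos_nonneg) auto
    qed simp
    ultimately show "(\<integral>y. logistic (a x + b y) - logistic (b x + a y) \<partial>\<U>) * (a x - b x) \<le> 0"
      by simp
  qed (auto simp: add.commute)
  then obtain x where "AE y in \<U>. (a x - b x) + (- 1) * (a y - b y) = 0"
    using AE_unit_ex by blast
  then have "AE y in \<U>. b y = a y + (b x - a x)" by eventually_elim simp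
  then obtain c where c: "AE y in \<U>. b y = a y + c" by blast
  have "\<exists>u. antimono_on {0..1} u \<and> (AE x in \<U>. logistic_mean u (u x) = f x)"
  proof (cases c "0::real" rule: linorder_cases)
    case greater
    have "antimono_on {0..1} (\<lambda>y. a y + c / 2)" using a by (auto simp: monotone_on_def)
    then show ?thesis using clamped_cycle_solves[OF a b cl c greater] by blast
  next
    case less
    have "AE y in \<U>. a y = b y + (- c)" using c by eventually_elim simp
    moreover have "antimono_on {0..1} (\<lambda>y. b y + (- c) / 2)" using b by (auto simp: monotone_on_def)
    ultimately show ?thesis
      using clamped_cycle_solves[OF b a cl(2,1), of "- c"] less
      by (intro exI[of _ "\<lambda>y. b y + (- c) / 2"]) auto
  next
    case equal
    then have "logistic_mean b s = logistic_mean a s" for s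
      using c by (intro logistic_mean_cong_AE) auto
    then have "clamped_solution B a (f x) (a x)" if "x \<in> {0..1}" for x
      using cl(1)[OF that] by (simp add: clamped_solution_def)
    then have "logistic_mean a (a x) = f x" if "x \<in> {0..1}" for x
      using clamped_fixed_point_solves[OF f a \<delta> B(3) coercive[OF a] B(1,2)] that by blast
    then show ?thesis using a by (intro exI[of _ a]) (auto intro: AE_I2)
  qed
  then have "\<exists>g\<in>Dprime. solves_limit_equation f g"
    using limit_equation_of_AE_solution[OF fD f01] by blast
  then show ?thesis using limit_equation_unique by blast
qed

section \<open>Independent edges\<close>

text \<open>Law of a random edge set with independent edges whose log-odds are \<theta>. As a finite
  weight it makes all probabilities of this model finite sums over edge sets.\<close>

definition gibbs_weight :: "('e \<Rightarrow> real) \<Rightarrow> 'e set \<Rightarrow> 'e set \<Rightarrow> real" where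
  "gibbs_weight \<theta> E F = (\<Prod>e\<in>E. if e \<in> F then logistic (\<theta> e) else 1 - logistic (\<theta> e))"

lemma sum_Pow_prod_if:
  fixes a b :: "'e \<Rightarrow> real"
  assumes "finite E"
  shows "(\<Sum>F\<in>Pow E. \<Prod>e\<in>E. if e \<in> F then a e else b e) = (\<Prod>e\<in>E. a e + b e)"
proof -
  have "(\<Prod>e\<in>E. if e \<in> F then a e else b e) = (\<Prod>e\<in>F. a e) * (\<Prod>e\<in>E - F. b e)" if "F \<in> Pow E" for F
    using assms that by (simp add: prod.If_cases Int_absorb1 Diff_eq[symmetric])
  then show ?thesis
    using prod_add[OF assms, of a b] by simp
qed

lemma gibbs_weight_pos: "gibbs_weight \<theta> E F > 0"
  unfolding gibbs_weight_def by (rule prod_pos) simp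

text \<open>The exponential family form: the denominator does not involve \<open>F\<close>, so the
  weight depends on \<open>F\<close> only through the total of \<theta> over it.\<close>

lemma gibbs_weight_eq:
  assumes "finite E" "F \<subseteq> E"
  shows "gibbs_weight \<theta> E F = exp (\<Sum>e\<in>F. \<theta> e) / (\<Prod>e\<in>E. 1 + exp (\<theta> e))"
proof -
  have "gibbs_weight \<theta> E F = (\<Prod>e\<in>E. (if e \<in> F then exp (\<theta> e) else 1) / (1 + exp (\<theta> e)))"
    unfolding gibbs_weight_def one_minus_logistic by (intro prod.cong) (auto simp: logistic_def)
  also have "\<dots> = (\<Prod>e\<in>E. if e \<in> F then exp (\<theta> e) else 1) / (\<Prod>e\<in>E. 1 + exp (\<theta> e))"
    by (rule prod_dividef)
  also have "(\<Prod>e\<in>E. if e \<in> F then exp (\<theta> e) else 1) = (\<Prod>e\<in>F. exp (\<theta> e))"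
    using assms by (simp add: prod.If_cases Int_absorb1)
  finally show ?thesis
    using assms by (simp add: exp_sum finite_subset)
qed

lemma sum_gibbs_weight: "finite E \<Longrightarrow> (\<Sum>F\<in>Pow E. gibbs_weight \<theta> E F) = 1"
  unfolding gibbs_weight_def by (subst sum_Pow_prod_if) auto

lemma exp_le_quadratic: "exp u \<le> 1 + u + u\<^sup>2" if "\<bar>u\<bar> \<le> 1" for u :: real
proof (cases "u \<ge> 0")
  case True
  then show ?thesis using exp_bound[of u] that by simp
next
  case False
  define v where "v = - u"
  have v: "v > 0" using False by (simp add: v_def)
  \<comment> \<open>With \<open>v = - u\<close> the claim is
    \<open>(1 - v + v^2) * exp v \<ge> 1\<close>, and here the quadratic Taylor polynomial already
    suffices in place of \<open>exp v\<close>.\<close>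
  have "1 \<le> 1 + v\<^sup>2 / 2 + v ^ 3 / 2 + v ^ 4 / 2" using v by simp
  also have "\<dots> = (1 - v + v\<^sup>2) * (1 + v + v\<^sup>2 / 2)"
    by (simp add: power2_eq_square power3_eq_cube power4_eq_xxxx field_simps)
  also have "\<dots> \<le> (1 - v + v\<^sup>2) * exp v"
  proof (rule mult_left_mono)
    show "1 + v + v\<^sup>2 / 2 \<le> exp v" using exp_lower_Taylor_quadratic[of v] v by simp
    have "0 \<le> (1 - v / 2)\<^sup>2 + 3 / 4 * v\<^sup>2" by simp
    then show "0 \<le> 1 - v + v\<^sup>2" by (simp add: power2_eq_square algebra_simps)
  qed
  finally have "1 / exp v \<le> 1 - v + v\<^sup>2" by (simp add: field_simps)
  then show ?thesis by (simp add: v_def exp_minus field_simps)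
qed

text \<open>For a centred Bernoulli variable the linear terms cancel in the quadratic bound on
  \<open>exp\<close>, which leaves the square of \<open>c\<close> times the variance.\<close>

lemma bernoulli_mgf_bound:
  fixes c p :: real
  assumes c: "\<bar>c\<bar> \<le> 1" and p: "0 \<le> p" "p \<le> 1"
  shows "p * exp (c * (1 - p)) + (1 - p) * exp (- (c * p)) \<le> exp (c\<^sup>2)"
proof -
  have c2: "\<bar>c * (1 - p)\<bar> \<le> 1" "\<bar>- (c * p)\<bar> \<le> 1"
    using c p by (auto simp: abs_mult intro!: mult_le_one)
  have "p * exp (c * (1 - p)) + (1 - p) * exp (- (c * p)) \<le>
      p * (1 + c * (1 - p) + (c * (1 - p))\<^sup>2) + (1 - p) * (1 + (- (c * p)) + (- (c * p))\<^sup>2)"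
    using p by (intro add_mono mult_left_mono exp_le_quadratic c2) auto
  also have "\<dots> = 1 + c\<^sup>2 * (p * (1 - p))"
    by (simp add: power2_eq_square algebra_simps)
  also have "\<dots> \<le> 1 + c\<^sup>2 * (1 * 1)"
    using p by (intro add_mono mult_mono) auto
  also have "\<dots> \<le> exp (c\<^sup>2)"
    using exp_ge_add_one_self[of "c\<^sup>2"] by simp
  finally show ?thesis .
qed

text \<open>Chernoff's bound. Each weight is multiplied by \<open>exp (l * (X - t)) \<ge> 1\<close>,
  the sum is extended to all edge sets, and there the exponential moment factorises over the
  edges.\<close>

lemma gibbs_weight_tail:
  fixes c \<theta> :: "'e \<Rightarrow> real"
  assumes E: "finite E" and l: "0 \<le> l" and c: "\<And>e. e \<in> E \<Longrightarrow> \<bar>l * c e\<bar> \<le> 1"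
    and C: "(\<Sum>e\<in>E. (c e)\<^sup>2) \<le> C"
  shows "(\<Sum>F | F \<subseteq> E \<and> t \<le> (\<Sum>e\<in>E. c e * (of_bool (e \<in> F) - logistic (\<theta> e))). gibbs_weight \<theta> E F)
    \<le> exp (l\<^sup>2 * C - l * t)"
proof -
  let ?p = "\<lambda>e. logistic (\<theta> e)"
  let ?X = "\<lambda>F. \<Sum>e\<in>E. c e * (of_bool (e \<in> F) - ?p e)"
  let ?w = "gibbs_weight \<theta> E"
  have fin: "finite (Pow E)" using E by simp
  have wX: "?w F * exp (l * ?X F) =
      (\<Prod>e\<in>E. if e \<in> F then ?p e * exp (l * c e * (1 - ?p e)) else (1 - ?p e) * exp (- (l * c e * ?p e)))" for F
  proof -
    have "exp (l * ?X F) = (\<Prod>e\<in>E. exp (l * (c e * (of_bool (e \<in> F) - ?p e))))"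
      using E by (simp add: sum_distrib_left exp_sum)
    then have "?w F * exp (l * ?X F) = (\<Prod>e\<in>E. (if e \<in> F then ?p e else 1 - ?p e) *
        exp (l * (c e * (of_bool (e \<in> F) - ?p e))))"
      by (simp only: gibbs_weight_def prod.distrib)
    then show ?thesis
      by (simp only:, intro prod.cong refl) (simp add: algebra_simps)
  qed
  have "(\<Sum>F | F \<subseteq> E \<and> t \<le> ?X F. ?w F) \<le> (\<Sum>F | F \<subseteq> E \<and> t \<le> ?X F. ?w F * exp (l * (?X F - t)))"
  proof (rule sum_mono)
    fix F assume "F \<in> {F. F \<subseteq> E \<and> t \<le> ?X F}"
    then have "1 \<le> exp (l * (?X F - t))" using l by simp
    then show "?w F \<le> ?w F * exp (l * (?X F - t))"
      using gibbs_weight_pos[of \<theta> E F] by simp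
  qed
  also have "\<dots> \<le> (\<Sum>F\<in>Pow E. ?w F * exp (l * (?X F - t)))"
    using fin by (intro sum_mono2) (auto intro: mult_nonneg_nonneg less_imp_le[OF gibbs_weight_pos])
  also have "\<dots> = exp (- (l * t)) * (\<Sum>F\<in>Pow E. ?w F * exp (l * ?X F))"
    by (simp add: sum_distrib_left right_diff_distrib exp_diff exp_minus field_simps)
  also have "(\<Sum>F\<in>Pow E. ?w F * exp (l * ?X F)) =
      (\<Prod>e\<in>E. ?p e * exp (l * c e * (1 - ?p e)) + (1 - ?p e) * exp (- (l * c e * ?p e)))"
    unfolding wX by (rule sum_Pow_prod_if[OF E])
  also have "\<dots> \<le> (\<Prod>e\<in>E. exp ((l * c e)\<^sup>2))"
    using c by (intro prod_mono conjI bernoulli_mgf_bound) (auto intro!: add_nonneg_nonneg mult_nonneg_nonneg)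
  also have "\<dots> = exp (l\<^sup>2 * (\<Sum>e\<in>E. (c e)\<^sup>2))"
    using E by (simp add: exp_sum[symmetric] sum_distrib_left power_mult_distrib)
  also have "\<dots> \<le> exp (l\<^sup>2 * C)"
    using C by (simp add: mult_left_mono)
  finally show ?thesis
    by (simp add: exp_diff exp_minus field_simps)
qed

lemma finite_subset_family: "finite E \<Longrightarrow> finite {F. F \<subseteq> E \<and> P F}"
  by (rule finite_subset[of _ "Pow E"]) auto

lemma sum_Un_le:
  fixes f :: "'b \<Rightarrow> real"
  assumes "finite A" "finite B" "\<And>x. 0 \<le> f x"
  shows "sum f (A \<union> B) \<le> sum f A + sum f B"
  using sum.union_inter[OF assms(1,2), of f] sum_nonneg[of "A \<inter> B" f] assms(3) by simp

lemma sum_UN_le: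
  fixes f :: "'b \<Rightarrow> real"
  assumes "finite I" "\<And>i. i \<in> I \<Longrightarrow> finite (A i)" "\<And>x. 0 \<le> f x"
  shows "sum f (\<Union>i\<in>I. A i) \<le> (\<Sum>i\<in>I. sum f (A i))"
  using assms(1,2)
proof (induction I rule: finite_induct)
  case (insert i I)
  have "sum f (\<Union>i\<in>insert i I. A i) \<le> sum f (A i) + sum f (\<Union>i\<in>I. A i)"
    using insert assms(3) by (simp add: sum_Un_le)
  moreover have "sum f (\<Union>i\<in>I. A i) \<le> (\<Sum>i\<in>I. sum f (A i))"
    using insert by simp
  ultimately show ?case using insert(1,2) by simp
qed simp

section \<open>Deviations of cuts and degrees\<close>

definition all_edges :: "nat \<Rightarrow> nat set set" where
  "all_edges n = {e. e \<subseteq> {1..n} \<and> card e = 2}"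

lemma finite_all_edges [simp]: "finite (all_edges n)"
  unfolding all_edges_def by (rule finite_subset[of _ "Pow {1..n}"]) auto

lemma doubleton_in_all_edges: "{i, j} \<in> all_edges n \<longleftrightarrow> i \<in> {1..n} \<and> j \<in> {1..n} \<and> i \<noteq> j"
  by (auto simp: all_edges_def card_insert_if)

lemma singleton_notin_all_edges [simp]: "{i} \<notin> all_edges n"
  by (simp add: all_edges_def)

lemma all_edgesE:
  assumes "e \<in> all_edges n"
  obtains i j where "e = {i, j}" "i \<noteq> j" "i \<in> {1..n}" "j \<in> {1..n}"
  using assms by (auto simp: all_edges_def card_2_iff)

lemma card_all_edges_le: "card (all_edges n) \<le> n\<^sup>2"
proof -
  have "all_edges n \<subseteq> (\<lambda>(i, j). {i, j}) ` ({1..n} \<times> {1..n})"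
  proof
    fix e assume "e \<in> all_edges n"
    then obtain i j where "e = {i, j}" "i \<in> {1..n}" "j \<in> {1..n}" by (rule all_edgesE)
    then show "e \<in> (\<lambda>(i, j). {i, j}) ` ({1..n} \<times> {1..n})"
      by (intro rev_image_eqI[of "(i, j)"]) auto
  qed
  then have "card (all_edges n) \<le> card ({1..n} \<times> {1..n})"
    by (rule surj_card_le[rotated]) simp
  then show ?thesis by (simp add: power2_eq_square card_cartesian_product)
qed

lemma card_ordered_pairs_le_2:
  fixes e :: "'a set"
  shows "card {(x, y). {x, y} = e} \<le> 2" "finite {(x, y). {x, y} = e}"
proof -
  have sub: "{(x, y). {x, y} = e} \<subseteq> {(a, b), (b, a)}" if "e = {a, b}" for a b :: 'a
    using that by (auto simp: doubleton_eq_iff)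
  have "card {(x, y). {x, y} = e} \<le> 2 \<and> finite {(x, y). {x, y} = e}"
  proof (cases "\<exists>a b. e = {a, b}")
    case True
    then obtain a b where e: "e = {a, b}" by blast
    have "card {(x, y). {x, y} = e} \<le> card {(a, b), (b, a)}"
      by (rule card_mono[OF _ sub[OF e]]) simp
    moreover have "card {p, q} \<le> 2" for p q :: "'a \<times> 'a" by (simp add: card_insert_if)
    moreover have "finite {(x, y). {x, y} = e}"
      by (rule finite_subset[OF sub[OF e]]) simp
    ultimately show ?thesis by (meson le_trans)
  next
    case False
    have "{(x, y). {x, y} = e} = {}"
    proof (intro equals0I, clarify)
      fix x y assume "e = {x, y}"
      then show False using False by blast
    qed
    then show ?thesis by (simp only:) simp
  qed
  then show "card {(x, y). {x, y} = e} \<le> 2" "finite {(x, y). {x, y} = e}" by blast+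
qed

text \<open>Ordered pairs are counted, so an edge inside \<open>S \<inter> T\<close> counts twice.
  The diagonal is left out because a simple graph has no loops.\<close>

definition cut_deviation :: "(nat set \<Rightarrow> real) \<Rightarrow> nat set set \<Rightarrow> nat set \<Rightarrow> nat set \<Rightarrow> real" where
  "cut_deviation p F S T =
    (\<Sum>(i, j)\<in>{(i, j). i \<in> S \<and> j \<in> T \<and> i \<noteq> j}. of_bool ({i, j} \<in> F) - p {i, j})"

text \<open>Grouping the pairs by edges exhibits the deviation as a linear form in independent
  centred variables, the shape required by \<open>gibbs_weight_tail\<close>.\<close>

lemma cut_deviation_eq:
  assumes S: "S \<subseteq> {1..n}" and T: "T \<subseteq> {1..n}"
  shows "cut_deviation p F S T = (\<Sum>e\<in>all_edges n.
      real (card {(i, j). i \<in> S \<and> j \<in> T \<and> {i, j} = e}) * (of_bool (e \<in> F) - p e))"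
proof -
  let ?P = "{(i, j). i \<in> S \<and> j \<in> T \<and> i \<noteq> j}"
  have fin: "finite ?P"
    by (rule finite_subset[of _ "{1..n} \<times> {1..n}"]) (use S T in auto)
  have "cut_deviation p F S T = (\<Sum>x\<in>?P. (\<lambda>e. of_bool (e \<in> F) - p e) ((\<lambda>(i, j). {i, j}) x))"
    unfolding cut_deviation_def by (intro sum.cong) auto
  also have "\<dots> = (\<Sum>e\<in>all_edges n. \<Sum>x\<in>{x \<in> ?P. (\<lambda>(i, j). {i, j}) x = e}. (\<lambda>e. of_bool (e \<in> F) - p e) ((\<lambda>(i, j). {i, j}) x))"
    using fin subsetD[OF S] subsetD[OF T]
    by (intro sum.group[symmetric]) (auto simp: doubleton_in_all_edges)
  also have "\<dots> = (\<Sum>e\<in>all_edges n. \<Sum>x\<in>{(i, j). i \<in> S \<and> j \<in> T \<and> {i, j} = e}. of_bool (e \<in> F) - p e)"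
  proof (rule sum.cong[OF refl])
    fix e assume "e \<in> all_edges n"
    then have "{x \<in> ?P. (\<lambda>(i, j). {i, j}) x = e} = {(i, j). i \<in> S \<and> j \<in> T \<and> {i, j} = e}"
      by (auto simp: all_edges_def)
    then show "(\<Sum>x\<in>{x \<in> ?P. (\<lambda>(i, j). {i, j}) x = e}. (\<lambda>e. of_bool (e \<in> F) - p e) ((\<lambda>(i, j). {i, j}) x)) =
        (\<Sum>x\<in>{(i, j). i \<in> S \<and> j \<in> T \<and> {i, j} = e}. of_bool (e \<in> F) - p e)"
      by (intro sum.cong) auto
  qed
  finally show ?thesis by (simp add: sum_constant)
qed

text \<open>The parameter \<open>N\<close> serves two scales: the square of \<open>n\<close> for
  arbitrary cuts and \<open>n\<close> for the degree of one vertex.\<close>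

lemma cut_deviation_tail:
  fixes \<theta> :: "nat set \<Rightarrow> real"
  assumes S: "S \<subseteq> {1..n}" and T: "T \<subseteq> {1..n}" and N: "card S * card T \<le> N"
    and \<epsilon>: "0 < \<epsilon>" "\<epsilon> \<le> 1"
  shows "(\<Sum>F | F \<subseteq> all_edges n \<and> \<epsilon> * real N \<le> \<bar>cut_deviation (\<lambda>e. logistic (\<theta> e)) F S T\<bar>.
      gibbs_weight \<theta> (all_edges n) F) \<le> 2 * exp (- \<epsilon>\<^sup>2 * real N / 8)"
proof -
  let ?E = "all_edges n" and ?p = "\<lambda>e. logistic (\<theta> e)"
  define A where "A e = {(i, j). i \<in> S \<and> j \<in> T \<and> {i, j} = e}" for e
  define c where "c e = real (card (A e))" for e
  let ?X = "\<lambda>c F. \<Sum>e\<in>?E. c e * (of_bool (e \<in> F) - ?p e)"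
  let ?w = "gibbs_weight \<theta> ?E"
  have finST: "finite S" "finite T" using S T finite_subset by blast+
  have Asub: "A e \<subseteq> S \<times> T" for e
    unfolding A_def by blast
  have c2: "c e \<le> 2" for e
  proof -
    have "A e \<subseteq> {(x, y). {x, y} = e}" unfolding A_def by blast
    from card_mono[OF card_ordered_pairs_le_2(2) this] show ?thesis
      using card_ordered_pairs_le_2(1)[of e] unfolding c_def by linarith
  qed
  \<comment> \<open>Coefficients are 0, 1 or 2, so their squares are at most twice themselves, and
    they add up to at most the number of pairs in \<open>S \<times> T\<close>.\<close>
  have "(\<Sum>e\<in>?E. (c e)\<^sup>2) \<le> (\<Sum>e\<in>?E. 2 * c e)"
  proof (rule sum_mono)
    show "(c e)\<^sup>2 \<le> 2 * c e" for e
      unfolding power2_eq_square by (rule mult_right_mono[OF c2]) (simp add: c_def)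
  qed
  moreover have "(\<Sum>e\<in>?E. 2 * c e) = 2 * real (\<Sum>e\<in>?E. card (A e))"
    by (simp only: c_def of_nat_sum sum_distrib_left)
  moreover have "(\<Sum>e\<in>?E. card (A e)) = card (\<Union>e\<in>?E. A e)"
  proof (rule card_UN_disjoint[symmetric])
    show "\<forall>e\<in>?E. finite (A e)"
      using finST by (auto intro: finite_subset[OF Asub])
    show "\<forall>e\<in>?E. \<forall>e'\<in>?E. e \<noteq> e' \<longrightarrow> A e \<inter> A e' = {}"
      unfolding A_def by blast
  qed simp
  moreover have "card (\<Union>e\<in>?E. A e) \<le> card (S \<times> T)"
    using finST Asub by (intro card_mono UN_least) auto
  moreover have "card (S \<times> T) \<le> N" using N by (simp add: card_cartesian_product)
  ultimately have C: "(\<Sum>e\<in>?E. (c e)\<^sup>2) \<le> 2 * real N" by linarith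
  \<comment> \<open>The exponent \<open>2 * l^2 * N - l * \<epsilon> * N\<close> is least at
    \<open>l = \<epsilon> / 4\<close>, with value \<open>- \<epsilon>^2 * N / 8\<close>; there
    \<open>l\<close> times a coefficient is at most \<open>1 / 2\<close>.\<close>
  have l: "0 \<le> \<epsilon> / 4" "\<bar>\<epsilon> / 4 * c e\<bar> \<le> 1" "\<bar>\<epsilon> / 4 * (- c e)\<bar> \<le> 1" for e
  proof -
    have "0 \<le> c e" by (simp add: c_def)
    moreover from this have "\<epsilon> / 4 * c e \<le> 1 / 4 * 2" using \<epsilon> c2[of e] by (intro mult_mono) auto
    ultimately show "\<bar>\<epsilon> / 4 * c e\<bar> \<le> 1" "\<bar>\<epsilon> / 4 * (- c e)\<bar> \<le> 1" using \<epsilon> by (auto simp: abs_mult)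
  qed (use \<epsilon> in auto)
  have exponent: "(\<epsilon> / 4)\<^sup>2 * (2 * real N) - \<epsilon> / 4 * (\<epsilon> * real N) = - \<epsilon>\<^sup>2 * real N / 8"
    by (simp add: power2_eq_square field_simps)
  have t1: "(\<Sum>F | F \<subseteq> ?E \<and> \<epsilon> * real N \<le> ?X c F. ?w F) \<le> exp (- \<epsilon>\<^sup>2 * real N / 8)"
    using gibbs_weight_tail[where E="?E" and l="\<epsilon> / 4" and c=c and C="2 * real N" and t="\<epsilon> * real N" and \<theta>=\<theta>, OF finite_all_edges l(1)] l(2) C exponent
    by simp
  have t2: "(\<Sum>F | F \<subseteq> ?E \<and> \<epsilon> * real N \<le> ?X (\<lambda>e. - c e) F. ?w F) \<le> exp (- \<epsilon>\<^sup>2 * real N / 8)"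
    using gibbs_weight_tail[where E="?E" and l="\<epsilon> / 4" and c="\<lambda>e. - c e" and C="2 * real N" and t="\<epsilon> * real N" and \<theta>=\<theta>, OF finite_all_edges l(1)] l(3) C exponent
    by simp
  have neg: "?X (\<lambda>e. - c e) F = - ?X c F" for F
    by (simp add: sum_negf[symmetric])
  note fin = finite_subset_family[OF finite_all_edges, of n]
  have X: "cut_deviation ?p F S T = ?X c F" for F
    unfolding c_def A_def by (rule cut_deviation_eq[OF S T])
  have "(\<Sum>F | F \<subseteq> ?E \<and> \<epsilon> * real N \<le> \<bar>cut_deviation ?p F S T\<bar>. ?w F) \<le>
      (\<Sum>F\<in>{F. F \<subseteq> ?E \<and> \<epsilon> * real N \<le> ?X c F} \<union> {F. F \<subseteq> ?E \<and> \<epsilon> * real N \<le> ?X (\<lambda>e. - c e) F}. ?w F)"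
  proof (rule sum_mono2)
    show "{F. F \<subseteq> ?E \<and> \<epsilon> * real N \<le> \<bar>cut_deviation ?p F S T\<bar>} \<subseteq>
        {F. F \<subseteq> ?E \<and> \<epsilon> * real N \<le> ?X c F} \<union> {F. F \<subseteq> ?E \<and> \<epsilon> * real N \<le> ?X (\<lambda>e. - c e) F}"
      unfolding X neg by (auto simp: abs_real_def split: if_splits)
  qed (use fin in \<open>auto intro: less_imp_le[OF gibbs_weight_pos]\<close>)
  also have "\<dots> \<le> (\<Sum>F | F \<subseteq> ?E \<and> \<epsilon> * real N \<le> ?X c F. ?w F) + (\<Sum>F | F \<subseteq> ?E \<and> \<epsilon> * real N \<le> ?X (\<lambda>e. - c e) F. ?w F)"
    by (intro sum_Un_le fin less_imp_le[OF gibbs_weight_pos])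
  finally show ?thesis using t1 t2 by linarith
qed

definition cut_close :: "nat \<Rightarrow> (nat set \<Rightarrow> real) \<Rightarrow> real \<Rightarrow> nat set set \<Rightarrow> bool" where
  "cut_close n p \<epsilon> F \<longleftrightarrow>
    (\<forall>S T. S \<subseteq> {1..n} \<and> T \<subseteq> {1..n} \<longrightarrow> \<bar>cut_deviation p F S T\<bar> \<le> \<epsilon> * (real n)\<^sup>2)"

text \<open>A cut bound of order \<open>n^2\<close> is trivial for a single vertex once
  \<open>n\<close> is large. Degrees are therefore controlled on their own scale, vertex by
  vertex.\<close>

definition degree_close :: "nat \<Rightarrow> (nat set \<Rightarrow> real) \<Rightarrow> real \<Rightarrow> nat set set \<Rightarrow> bool" where
  "degree_close n p \<epsilon> F \<longleftrightarrow> (\<forall>v\<in>{1..n}. \<bar>cut_deviation p F {v} {1..n}\<bar> \<le> \<epsilon> * real n)"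

text \<open>A union bound over the \<open>4 ^ n\<close> pairs of vertex sets, affordable because the
  exponent is quadratic in \<open>n\<close>.\<close>

lemma not_cut_close_weight:
  assumes \<epsilon>: "0 < \<epsilon>" "\<epsilon> \<le> 1"
  shows "(\<Sum>F | F \<subseteq> all_edges n \<and> \<not> cut_close n (\<lambda>e. logistic (\<theta> e)) \<epsilon> F. gibbs_weight \<theta> (all_edges n) F)
    \<le> 2 * 4 ^ n * exp (- \<epsilon>\<^sup>2 * (real n)\<^sup>2 / 8)"
proof -
  let ?I = "Pow {1..n} \<times> Pow {1..n}"
  let ?B = "\<lambda>(S, T). {F. F \<subseteq> all_edges n \<and> \<epsilon> * real (n\<^sup>2) \<le> \<bar>cut_deviation (\<lambda>e. logistic (\<theta> e)) F S T\<bar>}"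
  let ?w = "gibbs_weight \<theta> (all_edges n)"
  note fin = finite_subset_family[OF finite_all_edges, of n]
  have "(\<Sum>F | F \<subseteq> all_edges n \<and> \<not> cut_close n (\<lambda>e. logistic (\<theta> e)) \<epsilon> F. ?w F) \<le> (\<Sum>F\<in>(\<Union>i\<in>?I. ?B i). ?w F)"
  proof (rule sum_mono2)
    show "finite (\<Union>i\<in>?I. ?B i)" using fin by (intro finite_UN_I) auto
    show "{F. F \<subseteq> all_edges n \<and> \<not> cut_close n (\<lambda>e. logistic (\<theta> e)) \<epsilon> F} \<subseteq> (\<Union>i\<in>?I. ?B i)"
    proof
      fix F assume F: "F \<in> {F. F \<subseteq> all_edges n \<and> \<not> cut_close n (\<lambda>e. logistic (\<theta> e)) \<epsilon> F}"
      then obtain S T where "S \<subseteq> {1..n}" "T \<subseteq> {1..n}"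
          "\<epsilon> * (real n)\<^sup>2 < \<bar>cut_deviation (\<lambda>e. logistic (\<theta> e)) F S T\<bar>"
        unfolding cut_close_def by (auto simp: not_le)
      then show "F \<in> (\<Union>i\<in>?I. ?B i)"
        using F by (intro UN_I[of "(S, T)"]) auto
    qed
  qed (rule less_imp_le[OF gibbs_weight_pos])
  also have "\<dots> \<le> (\<Sum>i\<in>?I. sum ?w (?B i))"
    using fin by (intro sum_UN_le) (auto intro: less_imp_le[OF gibbs_weight_pos])
  also have "\<dots> \<le> (\<Sum>i\<in>?I. 2 * exp (- \<epsilon>\<^sup>2 * real (n\<^sup>2) / 8))"
  proof (rule sum_mono)
    fix i assume "i \<in> ?I"
    then obtain S T where i: "i = (S, T)" and ST: "S \<subseteq> {1..n}" "T \<subseteq> {1..n}" by auto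
    have "card S \<le> n" "card T \<le> n" using card_mono[OF _ ST(1)] card_mono[OF _ ST(2)] by auto
    then have "card S * card T \<le> n\<^sup>2" by (simp add: power2_eq_square mult_mono)
    then show "sum ?w (?B i) \<le> 2 * exp (- \<epsilon>\<^sup>2 * real (n\<^sup>2) / 8)"
      unfolding i using cut_deviation_tail[OF ST, of "n\<^sup>2" \<epsilon> \<theta>] \<epsilon> by simp
  qed
  also have "\<dots> = 2 * 4 ^ n * exp (- \<epsilon>\<^sup>2 * (real n)\<^sup>2 / 8)"
    by (simp add: card_cartesian_product card_Pow power_mult_distrib[symmetric])
  finally show ?thesis .
qed

lemma not_degree_close_weight:
  assumes \<epsilon>: "0 < \<epsilon>" "\<epsilon> \<le> 1"
  shows "(\<Sum>F | F \<subseteq> all_edges n \<and> \<not> degree_close n (\<lambda>e. logistic (\<theta> e)) \<epsilon> F. gibbs_weight \<theta> (all_edges n) F)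
    \<le> 2 * real n * exp (- \<epsilon>\<^sup>2 * real n / 8)"
proof -
  let ?B = "\<lambda>v. {F. F \<subseteq> all_edges n \<and> \<epsilon> * real n \<le> \<bar>cut_deviation (\<lambda>e. logistic (\<theta> e)) F {v} {1..n}\<bar>}"
  let ?w = "gibbs_weight \<theta> (all_edges n)"
  note fin = finite_subset_family[OF finite_all_edges, of n]
  have "(\<Sum>F | F \<subseteq> all_edges n \<and> \<not> degree_close n (\<lambda>e. logistic (\<theta> e)) \<epsilon> F. ?w F) \<le> (\<Sum>F\<in>(\<Union>v\<in>{1..n}. ?B v). ?w F)"
    using fin by (intro sum_mono2) (auto simp: degree_close_def not_le intro: less_imp_le[OF gibbs_weight_pos] finite_UN_I)
  also have "\<dots> \<le> (\<Sum>v\<in>{1..n}. sum ?w (?B v))"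
    using fin by (intro sum_UN_le) (auto intro: less_imp_le[OF gibbs_weight_pos])
  also have "\<dots> \<le> (\<Sum>v\<in>{1..n}. 2 * exp (- \<epsilon>\<^sup>2 * real n / 8))"
  proof (rule sum_mono)
    fix v assume "v \<in> {1..n}"
    then show "sum ?w (?B v) \<le> 2 * exp (- \<epsilon>\<^sup>2 * real n / 8)"
      using cut_deviation_tail[of "{v}" n "{1..n}" n \<epsilon> \<theta>] \<epsilon> by simp
  qed
  also have "\<dots> = 2 * real n * exp (- \<epsilon>\<^sup>2 * real n / 8)" by simp
  finally show ?thesis .
qed

section \<open>Counting graphs near a given one\<close>

definition edit_dist :: "'e set \<Rightarrow> 'e set \<Rightarrow> nat" where
  "edit_dist A B = card (sym_diff A B)"

lemma edit_dist_self [simp]: "edit_dist A A = 0"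
  by (simp add: edit_dist_def)

lemma edit_dist_commute: "edit_dist A B = edit_dist B A"
  by (simp add: edit_dist_def Un_commute)

lemma edit_dist_triangle:
  assumes "finite A" "finite B" "finite C"
  shows "edit_dist A C \<le> edit_dist A B + edit_dist B C"
proof -
  have "edit_dist A C \<le> card (sym_diff A B \<union> sym_diff B C)"
    unfolding edit_dist_def using assms by (intro card_mono) auto
  also have "\<dots> \<le> edit_dist A B + edit_dist B C"
    unfolding edit_dist_def by (rule card_Un_le)
  finally show ?thesis .
qed

text \<open>Each admissible difference \<open>D\<close> has
  \<open>(1 / x) ^ K * x ^ card D \<ge> 1\<close>, and summing this over all subsets of
  \<open>E\<close> gives a binomial expansion. A small \<open>x\<close> makes the second factor
  cheap, a \<open>K\<close> small compared with \<open>card E\<close> then the first.\<close>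

lemma card_near_bound:
  assumes E: "finite E" and F: "F' \<subseteq> E" and x: "0 < x" "x \<le> (1::real)"
  shows "real (card {F. F \<subseteq> E \<and> edit_dist F F' \<le> K}) \<le> (1 / x) ^ K * (1 + x) ^ card E"
proof -
  let ?N = "{F. F \<subseteq> E \<and> edit_dist F F' \<le> K}"
  let ?D = "{D. D \<subseteq> E \<and> card D \<le> K}"
  have inj: "inj_on (\<lambda>F. sym_diff F F') ?N"
  proof (rule inj_on_inverseI)
    show "sym_diff (sym_diff F F') F' = F" for F by auto
  qed
  have "(\<lambda>F. sym_diff F F') ` ?N \<subseteq> ?D" using F by (auto simp: edit_dist_def)
  then have "card ?N \<le> card ?D"
    using E by (intro card_inj_on_le[OF inj]) auto
  then have "real (card ?N) \<le> (\<Sum>D\<in>?D. 1)" by simp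
  also have "\<dots> \<le> (\<Sum>D\<in>?D. (1 / x) ^ K * x ^ card D)"
  proof (rule sum_mono)
    fix D assume "D \<in> ?D"
    then have "x ^ K \<le> x ^ card D" using x by (intro power_decreasing) auto
    then show "1 \<le> (1 / x) ^ K * x ^ card D" using x by (simp add: power_one_over field_simps)
  qed
  also have "\<dots> \<le> (\<Sum>D\<in>Pow E. (1 / x) ^ K * x ^ card D)"
    using E x by (intro sum_mono2) auto
  also have "\<dots> = (1 / x) ^ K * (\<Sum>D\<in>Pow E. (\<Prod>e\<in>D. x) * (\<Prod>e\<in>E - D. 1))"
    by (simp add: sum_distrib_left)
  also have "\<dots> = (1 / x) ^ K * (1 + x) ^ card E"
    by (subst prod_add[OF E, symmetric]) (simp add: add.commute)
  finally show ?thesis .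
qed

text \<open>The normalising factors cancel, and the exponents differ only on the symmetric
  difference.\<close>

lemma gibbs_weight_ratio:
  assumes E: "finite E" and F: "F \<subseteq> E" "F' \<subseteq> E" and C: "\<And>e. e \<in> E \<Longrightarrow> \<bar>\<theta> e\<bar> \<le> C"
    and K: "edit_dist F F' \<le> K" and C0: "0 \<le> C"
  shows "gibbs_weight \<theta> E F \<le> exp (C * real K) * gibbs_weight \<theta> E F'"
proof -
  have fin: "finite F" "finite F'" using E F finite_subset by blast+
  have "(\<Sum>e\<in>F. \<theta> e) - (\<Sum>e\<in>F'. \<theta> e) = (\<Sum>e\<in>F - F'. \<theta> e) - (\<Sum>e\<in>F' - F. \<theta> e)"
    using sum.Int_Diff[OF fin(1), of \<theta> F'] sum.Int_Diff[OF fin(2), of \<theta> F] by (simp add: Int_commute)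
  also have "\<dots> \<le> (\<Sum>e\<in>F - F'. \<bar>\<theta> e\<bar>) + (\<Sum>e\<in>F' - F. \<bar>\<theta> e\<bar>)"
    using sum_abs[of \<theta> "F - F'"] sum_abs[of \<theta> "F' - F"] by linarith
  also have "\<dots> = (\<Sum>e\<in>sym_diff F F'. \<bar>\<theta> e\<bar>)"
    using fin by (intro sum.union_disjoint[symmetric]) auto
  also have "\<dots> \<le> (\<Sum>e\<in>sym_diff F F'. C)"
    using F C by (intro sum_mono) auto
  also have "\<dots> \<le> C * real K"
    using K C0 by (simp add: edit_dist_def mult.commute mult_left_mono)
  finally have "exp (\<Sum>e\<in>F. \<theta> e) \<le> exp (C * real K) * exp (\<Sum>e\<in>F'. \<theta> e)"
    by (simp add: exp_add[symmetric])
  moreover have "0 < (\<Prod>e\<in>E. 1 + exp (\<theta> e))"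
    by (intro prod_pos) (simp add: add_pos_pos)
  ultimately show ?thesis
    unfolding gibbs_weight_eq[OF E F(1)] gibbs_weight_eq[OF E F(2)]
    by (simp add: divide_right_mono)
qed

text \<open>Every member of \<open>\<A>\<close> is charged to a near member of \<open>\<D>\<close>;
  \<open>card_near_bound\<close> limits the number of charges and \<open>gibbs_weight_ratio\<close>
  the size of each.\<close>

lemma gibbs_weight_neighbourhood:
  fixes \<theta> :: "'e \<Rightarrow> real"
  assumes E: "finite E" and \<A>: "\<A> \<subseteq> Pow E" and \<D>: "\<D> \<subseteq> Pow E" and C: "\<And>e. e \<in> E \<Longrightarrow> \<bar>\<theta> e\<bar> \<le> C" "0 \<le> C"
    and near: "\<And>F. F \<in> \<A> \<Longrightarrow> \<exists>F'\<in>\<D>. edit_dist F F' \<le> K" and x: "0 < x" "x \<le> (1::real)"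
  shows "(\<Sum>F\<in>\<A>. gibbs_weight \<theta> E F) \<le>
    exp (C * real K) * (1 / x) ^ K * (1 + x) ^ card E * (\<Sum>F\<in>\<D>. gibbs_weight \<theta> E F)"
proof -
  let ?w = "gibbs_weight \<theta> E"
  let ?N = "\<lambda>F'. {F. F \<subseteq> E \<and> edit_dist F F' \<le> K}"
  have finD: "finite \<D>" using E \<D> finite_subset by blast
  note finN = finite_subset_family[OF E]
  have "(\<Sum>F\<in>\<A>. ?w F) \<le> (\<Sum>F\<in>(\<Union>F'\<in>\<D>. ?N F'). ?w F)"
    using near \<A> finD finN by (intro sum_mono2) (auto intro: less_imp_le[OF gibbs_weight_pos])
  also have "\<dots> \<le> (\<Sum>F'\<in>\<D>. sum ?w (?N F'))"
    using finD finN by (intro sum_UN_le) (auto intro: less_imp_le[OF gibbs_weight_pos])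
  also have "\<dots> \<le> (\<Sum>F'\<in>\<D>. exp (C * real K) * (1 / x) ^ K * (1 + x) ^ card E * ?w F')"
  proof (rule sum_mono)
    fix F' assume "F' \<in> \<D>"
    then have F': "F' \<subseteq> E" using \<D> by auto
    have "sum ?w (?N F') \<le> (\<Sum>F\<in>?N F'. exp (C * real K) * ?w F')"
      using gibbs_weight_ratio[OF E _ F' C(1) _ C(2)] by (intro sum_mono) auto
    also have "\<dots> = (exp (C * real K) * ?w F') * real (card (?N F'))" by simp
    also have "\<dots> \<le> (exp (C * real K) * ?w F') * ((1 / x) ^ K * (1 + x) ^ card E)"
      using card_near_bound[OF E F' x] gibbs_weight_pos[of \<theta> E F'] by (intro mult_left_mono) auto
    finally show "sum ?w (?N F') \<le> exp (C * real K) * (1 / x) ^ K * (1 + x) ^ card E * ?w F'"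
      by (simp add: mult_ac)
  qed
  finally show ?thesis by (simp add: sum_distrib_left)
qed

section \<open>Correcting degrees by local moves\<close>

definition edge_degree :: "'a set set \<Rightarrow> 'a \<Rightarrow> nat" where
  "edge_degree F v = card {e \<in> F. v \<in> e}"

lemma edge_degree_eq_vertex_degree: "edge_degree F v = vertex_degree (V, F) v"
  by (simp add: edge_degree_def vertex_degree_def)

lemma finite_subset_all_edges: "F \<subseteq> all_edges n \<Longrightarrow> finite F"
  using finite_subset finite_all_edges by blast

lemma simple_graph_all_edges: "simple_graph ({1..n}, F) \<longleftrightarrow> F \<subseteq> all_edges n"
  by (simp add: simple_graph_def all_edges_def)

lemma edge_degree_eq_sum:
  assumes "F \<subseteq> all_edges n" "v \<in> {1..n}"
  shows "edge_degree F v = (\<Sum>x=1..n. if {v, x} \<in> F then 1 else 0)"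
    and "edge_degree F v = card {x \<in> {1..n}. {v, x} \<in> F}"
proof -
  show "edge_degree F v = (\<Sum>x=1..n. if {v, x} \<in> F then 1 else 0)"
    unfolding edge_degree_eq_vertex_degree[of F v "{1..n}"]
    using vertex_degree_eq_sum[OF iffD2[OF simple_graph_all_edges assms(1)], of v] assms(2) by simp
  then show "edge_degree F v = card {x \<in> {1..n}. {v, x} \<in> F}"
    by (simp add: sum.If_cases Int_def)
qed

lemma int_edge_degree:
  assumes "finite F"
  shows "int (edge_degree F v) = (\<Sum>e\<in>F. of_bool (v \<in> e))"
  using assms by (simp add: edge_degree_def of_bool_def sum.If_cases Int_def)

lemma handshake:
  assumes F: "F \<subseteq> all_edges n"
  shows "(\<Sum>v=1..n. int (edge_degree F v)) = 2 * int (card F)"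
proof -
  note fin = finite_subset_all_edges[OF F]
  have "(\<Sum>v=1..n. int (edge_degree F v)) = (\<Sum>v=1..n. \<Sum>e\<in>F. of_bool (v \<in> e))"
    by (simp add: int_edge_degree[OF fin])
  also have "\<dots> = (\<Sum>e\<in>F. \<Sum>v=1..n. of_bool (v \<in> e))" by (rule sum.swap)
  also have "\<dots> = (\<Sum>e\<in>F. 2)"
  proof (rule sum.cong[OF refl])
    fix e assume "e \<in> F"
    then have e: "e \<subseteq> {1..n}" "card e = 2" using F by (auto simp: all_edges_def)
    have "(\<Sum>v=1..n. of_bool (v \<in> e)) = int (card ({1..n} \<inter> e))"
      by (simp add: of_bool_def sum.If_cases Int_def)
    also have "{1..n} \<inter> e = e" using e(1) by blast
    finally show "(\<Sum>v=1..n. of_bool (v \<in> e)) = (2 :: int)" using e(2) by simp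
  qed
  finally show ?thesis by simp
qed

lemma edge_degree_complement:
  assumes F: "F \<subseteq> all_edges n" and v: "v \<in> {1..n}"
  shows "int (edge_degree (all_edges n - F) v) = int n - 1 - int (edge_degree F v)"
proof -
  have deg: "int (edge_degree G v) = (\<Sum>x=1..n. if {v, x} \<in> G then 1 else 0)" if "G \<subseteq> all_edges n" for G
    unfolding edge_degree_eq_sum(1)[OF that v] of_nat_sum by (intro sum.cong) auto
  have "(\<Sum>x=1..n. if {v, x} \<in> all_edges n - F then 1 else 0) + (\<Sum>x=1..n. if {v, x} \<in> F then 1 else 0)
      = (\<Sum>x=1..n. if x = v then 0 else (1::int))"
    unfolding sum.distrib[symmetric]
    using F v by (intro sum.cong) (auto simp: doubleton_in_all_edges dest!: subsetD[OF F])
  also have "\<dots> = (\<Sum>x=1..n. 1 - of_bool (x = v))"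
    by (intro sum.cong) auto
  also have "\<dots> = int n - 1"
    using v by (simp add: sum_subtractf of_bool_def sum.delta)
  finally show ?thesis
    using deg[OF F] deg[OF Diff_subset, of F] by linarith
qed

text \<open>The threshold is \<open>2 * K\<close> because \<open>K\<close> edits change at most
  \<open>2 * K\<close> ordered pairs: one of the adjacent pairs between two large sets survives in
  every graph at distance at most \<open>K\<close>.\<close>

definition edge_rich :: "nat \<Rightarrow> nat \<Rightarrow> nat \<Rightarrow> nat set set \<Rightarrow> bool" where
  "edge_rich n m K F \<longleftrightarrow> (\<forall>S T. S \<subseteq> {1..n} \<longrightarrow> T \<subseteq> {1..n} \<longrightarrow> m \<le> card S \<longrightarrow> m \<le> card T \<longrightarrow>
     2 * K < card {(x, y). x \<in> S \<and> y \<in> T \<and> {x, y} \<in> F})"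

lemma card_pairs_le:
  fixes D :: "'a set set"
  assumes "finite D"
  shows "card {(x, y). {x, y} \<in> D} \<le> 2 * card D" "finite {(x, y). {x, y} \<in> D}"
proof -
  have eq: "{(x, y). {x, y} \<in> D} = (\<Union>e\<in>D. {(x, y). {x, y} = e})" by blast
  show "finite {(x, y). {x, y} \<in> D}"
    unfolding eq using assms card_ordered_pairs_le_2(2) by (rule finite_UN_I)
  have "card {(x, y). {x, y} \<in> D} \<le> (\<Sum>e\<in>D. card {(x, y). {x, y} = e})"
    unfolding eq by (rule card_UN_le[OF assms])
  also have "\<dots> \<le> (\<Sum>e\<in>D. 2)" by (intro sum_mono card_ordered_pairs_le_2(1))
  finally show "card {(x, y). {x, y} \<in> D} \<le> 2 * card D" by simp
qed

text \<open>Replacing the edges \<open>{i, x}\<close> and \<open>{j, y}\<close> by \<open>{x, y}\<close> affects the degrees of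
  \<open>i\<close> and \<open>j\<close> only.\<close>

lemma lower_two_degrees:
  assumes F: "F \<subseteq> all_edges n" and F0: "F0 \<subseteq> all_edges n" and rich: "edge_rich n m K (all_edges n - F0)"
    and near: "edit_dist F F0 \<le> K" and ij: "i \<in> {1..n}" "j \<in> {1..n}" "i \<noteq> j"
    and deg: "m \<le> edge_degree F i" "m \<le> edge_degree F j"
  obtains F' where "F' \<subseteq> all_edges n" "edit_dist F F' \<le> 3"
    "\<And>v. int (edge_degree F' v) = int (edge_degree F v) - of_bool (v = i) - of_bool (v = j)"
proof -
  note fin = finite_subset_all_edges[OF F] finite_subset_all_edges[OF F0]
  let ?S = "{x \<in> {1..n}. {i, x} \<in> F}" and ?T = "{y \<in> {1..n}. {j, y} \<in> F}"
  have ST: "?S \<subseteq> {1..n}" "?T \<subseteq> {1..n}" "m \<le> card ?S" "m \<le> card ?T"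
    using edge_degree_eq_sum(2)[OF F ij(1)] edge_degree_eq_sum(2)[OF F ij(2)] deg by auto
  let ?P = "{(x, y). x \<in> ?S \<and> y \<in> ?T \<and> {x, y} \<in> all_edges n - F0}"
  let ?D = "{(x, y). {x, y} \<in> sym_diff F F0}"
  have "2 * K < card ?P" using rich ST unfolding edge_rich_def by blast
  moreover have "card ?D \<le> 2 * K" "finite ?D"
    using card_pairs_le[of "sym_diff F F0"] fin near by (auto simp: edit_dist_def)
  \<comment> \<open>Not all pairs in \<open>?P\<close> can have been edited, so some
    \<open>x\<close> and \<open>y\<close> are non-adjacent in \<open>F\<close> as well as in
    \<open>F0\<close>.\<close>
  ultimately have "\<not> ?P \<subseteq> ?D" using card_mono[of ?D ?P] by linarith
  then obtain x y where xy: "x \<in> ?S" "y \<in> ?T" "{x, y} \<in> all_edges n - F0" "{x, y} \<notin> sym_diff F F0"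
    by blast
  then have nF: "{x, y} \<notin> F" and ne: "x \<noteq> y" and ix: "{i, x} \<in> F" and jy: "{j, y} \<in> F"
    by (auto simp: doubleton_in_all_edges)
  have "i \<noteq> x" "j \<noteq> y"
    using ix jy F doubleton_in_all_edges by blast+
  \<comment> \<open>Otherwise \<open>{x, y}\<close> would be the edge \<open>{i, x}\<close> of
    \<open>F\<close>; likewise \<open>x = j\<close> would make it the edge
    \<open>{j, y}\<close>.\<close>
  have "y \<noteq> i" using ix nF by (metis insert_commute)
  have "x \<noteq> j" using jy nF by metis
  define F' where "F' = insert {x, y} (F - {{i, x}} - {{j, y}})"
  have "F' \<subseteq> all_edges n" using F xy(3) by (auto simp: F'_def)
  moreover have "edit_dist F F' \<le> 3"
  proof -
    have "sym_diff F F' \<subseteq> set [{i, x}, {j, y}, {x, y}]" unfolding F'_def by auto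
    then have "edit_dist F F' \<le> card (set [{i, x}, {j, y}, {x, y}])"
      unfolding edit_dist_def by (intro card_mono) auto
    also have "\<dots> \<le> 3" using card_length[of "[{i, x}, {j, y}, {x, y}]"] by simp
    finally show ?thesis .
  qed
  moreover have "int (edge_degree F' v) = int (edge_degree F v) - of_bool (v = i) - of_bool (v = j)" for v
  proof -
    have finF': "finite (F - {{i, x}} - {{j, y}})" using fin by simp
    have "{j, y} \<in> F - {{i, x}}" using jy ij(3) \<open>y \<noteq> i\<close> by (auto simp: doubleton_eq_iff)
    then have "(\<Sum>e\<in>F. of_bool (v \<in> e)) = of_bool (v \<in> {i, x}) + (of_bool (v \<in> {j, y}) +
        (\<Sum>e\<in>F - {{i, x}} - {{j, y}}. of_bool (v \<in> e)) :: int)"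
      using sum.remove[OF fin(1) ix, of "\<lambda>e. of_bool (v \<in> e) :: int"]
        sum.remove[of "F - {{i, x}}" "{j, y}" "\<lambda>e. of_bool (v \<in> e) :: int"] fin by simp
    moreover have "(\<Sum>e\<in>F'. of_bool (v \<in> e)) = of_bool (v \<in> {x, y}) +
        ((\<Sum>e\<in>F - {{i, x}} - {{j, y}}. of_bool (v \<in> e)) :: int)"
      unfolding F'_def using nF by (intro sum.insert finF') auto
    moreover have "of_bool (v \<in> {i, x}) + of_bool (v \<in> {j, y}) - of_bool (v \<in> {x, y}) =
        (of_bool (v = i) + of_bool (v = j) :: int)"
      using \<open>i \<noteq> x\<close> \<open>j \<noteq> y\<close> \<open>y \<noteq> i\<close> \<open>x \<noteq> j\<close> ne ij(3) by (auto simp: of_bool_def)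
    ultimately show ?thesis
      using int_edge_degree[OF fin(1), of v] int_edge_degree[of F' v] finF' by (simp add: F'_def)
  qed
  ultimately show ?thesis by (rule that)
qed

lemma edit_dist_Diff:
  assumes "F \<subseteq> E" "G \<subseteq> E"
  shows "edit_dist (E - F) (E - G) = edit_dist F G"
proof -
  have "sym_diff (E - F) (E - G) = sym_diff F G" using assms by blast
  then show ?thesis by (simp only: edit_dist_def)
qed

text \<open>Raising two degrees is lowering them in the complement; complementation preserves edit
  distances and exchanges the two richness assumptions.\<close>

lemma shift_two_degrees:
  fixes s :: int
  assumes F: "F \<subseteq> all_edges n" and F0: "F0 \<subseteq> all_edges n" and rich: "edge_rich n m K F0" "edge_rich n m K (all_edges n - F0)"
    and near: "edit_dist F F0 \<le> K" and ij: "i \<in> {1..n}" "j \<in> {1..n}" "i \<noteq> j"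
    and deg: "\<And>v. v \<in> {1..n} \<Longrightarrow> int m \<le> int (edge_degree F v) \<and> int (edge_degree F v) \<le> int n - 1 - int m"
    and s: "s \<in> {1, - 1}"
  obtains F' where "F' \<subseteq> all_edges n" "edit_dist F F' \<le> 3"
    "\<And>v. v \<in> {1..n} \<Longrightarrow> int (edge_degree F' v) = int (edge_degree F v) + s * of_bool (v = i) + s * of_bool (v = j)"
proof (cases "s = - 1")
  case True
  have "m \<le> edge_degree F i" "m \<le> edge_degree F j"
    using deg[OF ij(1)] deg[OF ij(2)] by linarith+
  then obtain G where G: "G \<subseteq> all_edges n" "edit_dist F G \<le> 3"
    "\<And>v. int (edge_degree G v) = int (edge_degree F v) - of_bool (v = i) - of_bool (v = j)"
    using lower_two_degrees[OF F F0 rich(2) near ij] by blast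
  show ?thesis
    by (rule that[OF G(1,2)]) (simp add: G(3) True)
next
  case False
  then have s1: "s = 1" using s by simp
  let ?E = "all_edges n"
  have rich': "edge_rich n m K (?E - (?E - F0))" using rich(1) F0 by (simp add: double_diff)
  have near': "edit_dist (?E - F) (?E - F0) \<le> K" using near edit_dist_Diff[OF F F0] by simp
  have deg': "m \<le> edge_degree (?E - F) i" "m \<le> edge_degree (?E - F) j"
    using edge_degree_complement[OF F ij(1)] edge_degree_complement[OF F ij(2)] deg[OF ij(1)] deg[OF ij(2)]
    by linarith+
  obtain G where G: "G \<subseteq> ?E" "edit_dist (?E - F) G \<le> 3"
    "\<And>v. int (edge_degree G v) = int (edge_degree (?E - F) v) - of_bool (v = i) - of_bool (v = j)"
    using lower_two_degrees[OF Diff_subset Diff_subset rich' near' ij deg'] by blast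
  show ?thesis
  proof (rule that[of "?E - G"])
    have "sym_diff F (?E - G) = sym_diff (?E - F) G"
      using F G(1) by blast
    then show "edit_dist F (?E - G) \<le> 3" using G(2) by (simp only: edit_dist_def)
    show "int (edge_degree (?E - G) v) = int (edge_degree F v) + s * of_bool (v = i) + s * of_bool (v = j)"
      if "v \<in> {1..n}" for v
      using edge_degree_complement[OF G(1) that] edge_degree_complement[OF F that] G(3)[of v] s1 by simp
  qed simp
qed

lemma edit_dist_edges_triangle:
  assumes "A \<subseteq> all_edges n" "B \<subseteq> all_edges n" "C \<subseteq> all_edges n"
    "edit_dist A B \<le> k" "edit_dist B C \<le> l"
  shows "edit_dist A C \<le> k + l"
  using edit_dist_triangle[OF assms(1-3)[THEN finite_subset_all_edges]] assms(4,5) by linarith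

text \<open>A third and possibly a fourth vertex serve as intermediate stations if the two shifts have
  opposite signs or concern the same vertex.\<close>

lemma shift_degrees:
  fixes s t :: int
  assumes F: "F \<subseteq> all_edges n" and F0: "F0 \<subseteq> all_edges n" and rich: "edge_rich n m K F0" "edge_rich n m K (all_edges n - F0)"
    and near: "edit_dist F F0 + 9 \<le> K" and ij: "i \<in> {1..n}" "j \<in> {1..n}" and n: "3 \<le> n"
    and deg: "\<And>v. v \<in> {1..n} \<Longrightarrow> int m + 2 \<le> int (edge_degree F v) \<and> int (edge_degree F v) \<le> int n - 3 - int m"
    and st: "s \<in> {1, - 1}" "t \<in> {1, - 1}" "i = j \<Longrightarrow> s = t"
  obtains F' where "F' \<subseteq> all_edges n" "edit_dist F F' \<le> 9"
    "\<And>v. v \<in> {1..n} \<Longrightarrow> int (edge_degree F' v) = int (edge_degree F v) + s * of_bool (v = i) + t * of_bool (v = j)"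
proof -
  have near': "edit_dist G F0 \<le> K" if "G \<subseteq> all_edges n" "edit_dist F G \<le> 9" for G
    using edit_dist_edges_triangle[OF that(1) F F0, of 9 "edit_dist F F0"] that(2) near
    by (simp add: edit_dist_commute)
  have nearF: "edit_dist F F0 \<le> K" using near by simp
  have degF: "int m \<le> int (edge_degree F v) \<and> int (edge_degree F v) \<le> int n - 1 - int m" if "v \<in> {1..n}" for v
    using deg[OF that] by simp
  note move1 = shift_two_degrees[OF F F0 rich nearF _ _ _ degF]
  have avoid: "\<exists>k\<in>{1..n}. k \<noteq> a \<and> k \<noteq> b" for a b
  proof (rule ccontr)
    assume "\<not> (\<exists>k\<in>{1..n}. k \<noteq> a \<and> k \<noteq> b)"
    then have "{1..n} \<subseteq> set [a, b]" by auto
    then have "card {1..n} \<le> card (set [a, b])" by (intro card_mono) auto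
    also have "\<dots> \<le> 2" using card_length[of "[a, b]"] by simp
    finally show False using n by simp
  qed
  consider "i \<noteq> j" "s = t" | "i \<noteq> j" "t = - s" | "i = j" using st by force
  then show ?thesis
  proof cases
    case 1
    then obtain F1 where F1: "F1 \<subseteq> all_edges n" "edit_dist F F1 \<le> 3"
      "\<And>v. v \<in> {1..n} \<Longrightarrow> int (edge_degree F1 v) = int (edge_degree F v) + s * of_bool (v = i) + s * of_bool (v = j)"
      using move1[OF ij _ _ st(1)] by blast
    show ?thesis by (rule that[OF F1(1)]) (use F1(2,3) 1 in auto)
  next
    case 2
    obtain k where k: "k \<in> {1..n}" "k \<noteq> i" "k \<noteq> j" using avoid by blast
    obtain F1 where F1: "F1 \<subseteq> all_edges n" "edit_dist F F1 \<le> 3"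
      "\<And>v. v \<in> {1..n} \<Longrightarrow> int (edge_degree F1 v) = int (edge_degree F v) + s * of_bool (v = i) + s * of_bool (v = k)"
      using move1[OF ij(1) k(1) _ _ st(1)] k(2) by blast
    have deg1: "int m \<le> int (edge_degree F1 v) \<and> int (edge_degree F1 v) \<le> int n - 1 - int m" if "v \<in> {1..n}" for v
      using deg[OF that] F1(3)[OF that] k(2) st(1) by (auto simp: of_bool_def)
    have near1: "edit_dist F1 F0 \<le> K" using near'[OF F1(1)] F1(2) by simp
    obtain F2 where F2: "F2 \<subseteq> all_edges n" "edit_dist F1 F2 \<le> 3"
      "\<And>v. v \<in> {1..n} \<Longrightarrow> int (edge_degree F2 v) = int (edge_degree F1 v) + t * of_bool (v = k) + t * of_bool (v = j)"
      using shift_two_degrees[OF F1(1) F0 rich near1 k(1) ij(2) k(3) deg1 st(2)] by blast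
    have "edit_dist F F2 \<le> 3 + 3"
      by (rule edit_dist_edges_triangle[OF F F1(1) F2(1) F1(2) F2(2)])
    then show ?thesis
      by (intro that[OF F2(1)]) (use F1(3) F2(3) 2 in auto)
  next
    case 3
    then have ts: "t = s" using st(3) by simp
    \<comment> \<open>For a double shift of \<open>i\<close>, the first two moves shift
      \<open>i\<close> twice and each of \<open>k\<close> and \<open>l\<close> once; the third moves
      \<open>k\<close> and \<open>l\<close> back. Hence the margin of 2 for the degrees and the
      bound of 9 edits.\<close>
    obtain k where k: "k \<in> {1..n}" "k \<noteq> i" using avoid by blast
    obtain l where l: "l \<in> {1..n}" "l \<noteq> i" "l \<noteq> k" using avoid by blast
    have ms: "- s \<in> {1, - 1}" using st(1) by auto
    obtain F1 where F1: "F1 \<subseteq> all_edges n" "edit_dist F F1 \<le> 3"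
      "\<And>v. v \<in> {1..n} \<Longrightarrow> int (edge_degree F1 v) = int (edge_degree F v) + s * of_bool (v = i) + s * of_bool (v = k)"
      using move1[OF ij(1) k(1) _ _ st(1)] k(2) by blast
    have deg1: "int m \<le> int (edge_degree F1 v) \<and> int (edge_degree F1 v) \<le> int n - 1 - int m" if "v \<in> {1..n}" for v
      using deg[OF that] F1(3)[OF that] k(2) st(1) by (auto simp: of_bool_def)
    have near1: "edit_dist F1 F0 \<le> K" using near'[OF F1(1)] F1(2) by simp
    obtain F2 where F2: "F2 \<subseteq> all_edges n" "edit_dist F1 F2 \<le> 3"
      "\<And>v. v \<in> {1..n} \<Longrightarrow> int (edge_degree F2 v) = int (edge_degree F1 v) + s * of_bool (v = i) + s * of_bool (v = l)"
      using shift_two_degrees[OF F1(1) F0 rich near1 ij(1) l(1) _ deg1 st(1)] l(2) by blast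
    have 12: "edit_dist F F2 \<le> 3 + 3"
      by (rule edit_dist_edges_triangle[OF F F1(1) F2(1) F1(2) F2(2)])
    have deg2: "int m \<le> int (edge_degree F2 v) \<and> int (edge_degree F2 v) \<le> int n - 1 - int m" if "v \<in> {1..n}" for v
      using deg[OF that] F1(3)[OF that] F2(3)[OF that] k(2) l st(1) by (auto simp: of_bool_def)
    have near2: "edit_dist F2 F0 \<le> K" using near'[OF F2(1)] 12 by simp
    obtain F3 where F3: "F3 \<subseteq> all_edges n" "edit_dist F2 F3 \<le> 3"
      "\<And>v. v \<in> {1..n} \<Longrightarrow> int (edge_degree F3 v) = int (edge_degree F2 v) + (- s) * of_bool (v = l) + (- s) * of_bool (v = k)"
      using shift_two_degrees[OF F2(1) F0 rich near2 l(1) k(1) l(3) deg2 ms] by blast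
    have "edit_dist F F3 \<le> (3 + 3) + 3"
      by (rule edit_dist_edges_triangle[OF F F2(1) F3(1) 12 F3(2)])
    then show ?thesis
      by (intro that[OF F3(1)]) (use F1(3) F2(3) F3(3) ts 3 in auto)
  qed
qed

text \<open>Each step lowers the total degree error by 2 at the price of at most 9 edits, so the
  distance plus 9 times the error never grows. The base \<open>F0\<close> stays fixed because
  richness is assumed there; the bound by \<open>K\<close> transfers it to all intermediate
  graphs.\<close>

lemma correct_degrees:
  fixes d :: "nat \<Rightarrow> nat"
  assumes F0: "F0 \<subseteq> all_edges n" and rich: "edge_rich n m K F0" "edge_rich n m K (all_edges n - F0)" and n: "3 \<le> n"
    and d: "\<And>v. v \<in> {1..n} \<Longrightarrow> int m + 2 \<le> int (d v) \<and> int (d v) \<le> int n - 3 - int m"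
    and even: "even (\<Sum>v=1..n. int (d v))"
  shows "F \<subseteq> all_edges n \<Longrightarrow>
    (\<And>v. v \<in> {1..n} \<Longrightarrow> int m + 2 \<le> int (edge_degree F v) \<and> int (edge_degree F v) \<le> int n - 3 - int m) \<Longrightarrow>
    int (edit_dist F F0) + 9 * (\<Sum>v=1..n. \<bar>int (edge_degree F v) - int (d v)\<bar>) \<le> int K \<Longrightarrow>
    \<exists>F'\<subseteq>all_edges n. (\<forall>v\<in>{1..n}. edge_degree F' v = d v) \<and> edit_dist F' F0 \<le> K"
proof (induction "nat (\<Sum>v=1..n. \<bar>int (edge_degree F v) - int (d v)\<bar>)" arbitrary: F rule: less_induct)
  case (less F)
  let ?b = "\<lambda>F v. int (edge_degree F v) - int (d v)"
  note F = less.prems(1) and deg = less.prems(2) and near = less.prems(3)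
  have nonneg: "0 \<le> (\<Sum>v=1..n. \<bar>?b F v\<bar>)" by (intro sum_nonneg) auto
  show ?case
  proof (cases "\<exists>i\<in>{1..n}. ?b F i \<noteq> 0")
    case False
    then have "\<forall>v\<in>{1..n}. edge_degree F v = d v" by auto
    then show ?thesis using F near nonneg by (intro exI[of _ F]) auto
  next
    case True
    then obtain i where i: "i \<in> {1..n}" "?b F i \<noteq> 0" by blast
    \<comment> \<open>Parity enters here: if \<open>i\<close> is the only wrong vertex, the
      handshake identity makes its error even, hence at least 2 in absolute value, and
      \<open>j = i\<close> is allowed.\<close>
    have "\<exists>j\<in>{1..n}. ?b F j \<noteq> 0 \<and> (i = j \<longrightarrow> 2 \<le> \<bar>?b F i\<bar>)"
    proof (cases "\<exists>j\<in>{1..n}. j \<noteq> i \<and> ?b F j \<noteq> 0")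
      case False
      have "(\<Sum>v=1..n. ?b F v) = ?b F i + (\<Sum>v\<in>{1..n} - {i}. ?b F v)"
        using i(1) by (intro sum.remove) auto
      also have "(\<Sum>v\<in>{1..n} - {i}. ?b F v) = 0"
        using False by (intro sum.neutral) auto
      finally have "?b F i = (\<Sum>v=1..n. int (edge_degree F v)) - (\<Sum>v=1..n. int (d v))"
        by (simp add: sum_subtractf)
      moreover have "even (\<Sum>v=1..n. int (edge_degree F v))" using handshake[OF F] by simp
      ultimately have "even (?b F i)" using even by simp
      then have "2 \<le> \<bar>?b F i\<bar>" using i(2) by presburger
      then show ?thesis using i by blast
    qed blast
    then obtain j where j: "j \<in> {1..n}" "?b F j \<noteq> 0" "i = j \<Longrightarrow> 2 \<le> \<bar>?b F i\<bar>" by blast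
    define s t where "s = - sgn (?b F i)" and "t = - sgn (?b F j)"
    have st: "s \<in> {1, - 1}" "t \<in> {1, - 1}" "i = j \<Longrightarrow> s = t"
      using i(2) j(2) by (auto simp: s_def t_def sgn_if)
    have "\<bar>?b F i\<bar> \<le> (\<Sum>v=1..n. \<bar>?b F v\<bar>)"
      using i(1) by (intro member_le_sum) auto
    then have pos: "1 \<le> (\<Sum>v=1..n. \<bar>?b F v\<bar>)" using i(2) by linarith
    then have near9: "edit_dist F F0 + 9 \<le> K" using near by linarith
    obtain F1 where F1: "F1 \<subseteq> all_edges n" "edit_dist F F1 \<le> 9"
      "\<And>v. v \<in> {1..n} \<Longrightarrow> int (edge_degree F1 v) = int (edge_degree F v) + s * of_bool (v = i) + t * of_bool (v = j)"
      using shift_degrees[OF F F0 rich near9 i(1) j(1) n deg st] by blast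
    have red: "\<bar>?b F1 v\<bar> = \<bar>?b F v\<bar> - of_bool (v = i) - of_bool (v = j)" if v: "v \<in> {1..n}" for v
    proof -
      consider "v = i" "v = j" | "v = i" "v \<noteq> j" | "v \<noteq> i" "v = j" | "v \<noteq> i" "v \<noteq> j" by blast
      then show ?thesis
      proof cases
        case 1
        then show ?thesis using F1(3)[OF v] j(3) unfolding s_def t_def sgn_if by (auto split: if_splits)
      next
        case 2
        then show ?thesis using F1(3)[OF v] i(2) unfolding s_def sgn_if by (auto split: if_splits)
      next
        case 3
        then show ?thesis using F1(3)[OF v] j(2) unfolding t_def sgn_if by (auto split: if_splits)
      next
        case 4
        then show ?thesis using F1(3)[OF v] by simp
      qed
    qed
    have "(\<Sum>v=1..n. \<bar>?b F1 v\<bar>) = (\<Sum>v=1..n. \<bar>?b F v\<bar> - of_bool (v = i) - of_bool (v = j))"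
      using red by (intro sum.cong) auto
    also have "\<dots> = (\<Sum>v=1..n. \<bar>?b F v\<bar>) - 2"
      using i(1) j(1) by (simp add: sum_subtractf of_bool_def sum.delta)
    finally have sum1: "(\<Sum>v=1..n. \<bar>?b F1 v\<bar>) = (\<Sum>v=1..n. \<bar>?b F v\<bar>) - 2" .
    show ?thesis
    proof (rule less.hyps[OF _ F1(1)])
      show "nat (\<Sum>v=1..n. \<bar>?b F1 v\<bar>) < nat (\<Sum>v=1..n. \<bar>?b F v\<bar>)"
        using sum1 pos by linarith
      have "edit_dist F1 F0 \<le> 9 + edit_dist F F0"
        by (rule edit_dist_edges_triangle[OF F1(1) F F0]) (use F1(2) in \<open>simp_all add: edit_dist_commute\<close>)
      then show "int (edit_dist F1 F0) + 9 * (\<Sum>v=1..n. \<bar>?b F1 v\<bar>) \<le> int K"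
        using near sum1 by linarith
      fix v assume v: "v \<in> {1..n}"
      have "s * of_bool (v = i) + t * of_bool (v = j) = ?b F1 v - ?b F v"
        using F1(3)[OF v] by simp
      moreover have "\<bar>?b F1 v\<bar> \<le> \<bar>?b F v\<bar>" using red[OF v] by simp
      \<comment> \<open>The error shrinks without changing sign, so the new degree lies between the
        old one and \<open>d v\<close>, both of which are in the admissible range.\<close>
      moreover have "0 \<le> ?b F1 v * ?b F v"
      proof -
        have "\<bar>?b F1 v - ?b F v\<bar> \<le> of_bool (v = i) + of_bool (v = j)"
          using F1(3)[OF v] st by (auto simp: of_bool_def)
        then have "\<bar>?b F1 v - ?b F v\<bar> \<le> \<bar>?b F v\<bar>"
          using red[OF v] by linarith
        then show ?thesis by (auto simp: zero_le_mult_iff abs_if split: if_splits)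
      qed
      ultimately show "int m + 2 \<le> int (edge_degree F1 v) \<and> int (edge_degree F1 v) \<le> int n - 3 - int m"
        using deg[OF v] d[OF v] by (auto simp: zero_le_mult_iff abs_if split: if_splits)
    qed
  qed
qed

section \<open>Homomorphism densities and the cut norm\<close>

lemma sum_le_positive_part:
  fixes r u :: "'a \<Rightarrow> real"
  assumes "finite V" "\<And>i. i \<in> V \<Longrightarrow> 0 \<le> u i \<and> u i \<le> 1"
  shows "(\<Sum>i\<in>V. r i * u i) \<le> (\<Sum>i\<in>{i \<in> V. r i > 0}. r i)"
proof -
  have "(\<Sum>i\<in>V. r i * u i) \<le> (\<Sum>i\<in>V. if r i > 0 then r i else 0)"
  proof (rule sum_mono)
    fix i assume "i \<in> V"
    then have "0 \<le> u i" "u i \<le> 1" using assms(2) by auto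
    then show "r i * u i \<le> (if r i > 0 then r i else 0)"
      by (auto intro: mult_left_le mult_nonpos_nonneg)
  qed
  also have "\<dots> = (\<Sum>i\<in>{i \<in> V. r i > 0}. r i)"
    using assms(1) by (simp add: sum.If_cases Int_def)
  finally show ?thesis .
qed

text \<open>A bilinear form is maximal over vectors with entries in \<open>[0,1]\<close> at
  indicators: \<open>u\<close> may be replaced by the indicator of the rows with positive weighted
  sum, and then \<open>w\<close> by that of the columns with positive sum.\<close>

lemma bilinear_cut_bound:
  fixes M :: "'a \<Rightarrow> 'a \<Rightarrow> real"
  assumes V: "finite V" and M: "\<And>S T. S \<subseteq> V \<Longrightarrow> T \<subseteq> V \<Longrightarrow> \<bar>\<Sum>i\<in>S. \<Sum>j\<in>T. M i j\<bar> \<le> \<delta>"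
    and u: "\<And>i. i \<in> V \<Longrightarrow> 0 \<le> u i \<and> u i \<le> 1" and w: "\<And>i. i \<in> V \<Longrightarrow> 0 \<le> w i \<and> w i \<le> 1"
  shows "\<bar>\<Sum>i\<in>V. \<Sum>j\<in>V. M i j * (u i * w j)\<bar> \<le> \<delta>"
proof -
  have *: "(\<Sum>i\<in>V. \<Sum>j\<in>V. N i j * (u i * w j)) \<le> \<delta>"
    if N: "\<And>S T. S \<subseteq> V \<Longrightarrow> T \<subseteq> V \<Longrightarrow> (\<Sum>i\<in>S. \<Sum>j\<in>T. N i j) \<le> \<delta>" for N :: "'a \<Rightarrow> 'a \<Rightarrow> real"
  proof -
    define r where "r i = (\<Sum>j\<in>V. N i j * w j)" for i
    define S where "S = {i \<in> V. r i > 0}"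
    define r' where "r' j = (\<Sum>i\<in>S. N i j)" for j
    define T where "T = {j \<in> V. r' j > 0}"
    have "(\<Sum>i\<in>V. \<Sum>j\<in>V. N i j * (u i * w j)) = (\<Sum>i\<in>V. r i * u i)"
      by (simp add: r_def sum_distrib_right sum_distrib_left mult_ac)
    also have "\<dots> \<le> (\<Sum>i\<in>S. r i)"
      unfolding S_def by (rule sum_le_positive_part[OF V u])
    also have "\<dots> = (\<Sum>j\<in>V. r' j * w j)"
      unfolding r_def r'_def by (subst sum.swap) (simp add: sum_distrib_right)
    also have "\<dots> \<le> (\<Sum>j\<in>T. r' j)"
      unfolding T_def by (rule sum_le_positive_part[OF V w])
    also have "\<dots> = (\<Sum>i\<in>S. \<Sum>j\<in>T. N i j)"
      unfolding r'_def by (rule sum.swap)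
    also have "\<dots> \<le> \<delta>" by (rule N) (auto simp: S_def T_def)
    finally show ?thesis .
  qed
  have "(\<Sum>i\<in>V. \<Sum>j\<in>V. M i j * (u i * w j)) \<le> \<delta>"
    by (rule *) (use M in \<open>force simp: abs_le_iff\<close>)
  moreover have "(\<Sum>i\<in>V. \<Sum>j\<in>V. - M i j * (u i * w j)) \<le> \<delta>"
    by (rule *) (use M in \<open>force simp: abs_le_iff sum_negf\<close>)
  ultimately show ?thesis by (simp add: sum_negf abs_le_iff)
qed

lemma sum_PiE_insert:
  fixes f :: "('i \<Rightarrow> 'a) \<Rightarrow> real"
  assumes "a \<notin> J"
  shows "(\<Sum>\<phi>\<in>insert a J \<rightarrow>\<^sub>E V. f \<phi>) = (\<Sum>\<psi>\<in>J \<rightarrow>\<^sub>E V. \<Sum>x\<in>V. f (\<psi>(a := x)))"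
proof -
  have "(\<Sum>\<phi>\<in>insert a J \<rightarrow>\<^sub>E V. f \<phi>) = (\<Sum>(x, \<psi>)\<in>V \<times> (J \<rightarrow>\<^sub>E V). f (\<psi>(a := x)))"
    unfolding PiE_insert_eq
    by (subst sum.reindex[OF inj_combinator[OF assms]]) (auto intro!: sum.cong)
  also have "\<dots> = (\<Sum>x\<in>V. \<Sum>\<psi>\<in>J \<rightarrow>\<^sub>E V. f (\<psi>(a := x)))"
    by (simp add: sum.cartesian_product)
  also have "\<dots> = (\<Sum>\<psi>\<in>J \<rightarrow>\<^sub>E V. \<Sum>x\<in>V. f (\<psi>(a := x)))" by (rule sum.swap)
  finally show ?thesis .
qed

text \<open>With the values off \<open>a\<close> and \<open>b\<close> fixed, the remaining factor
  splits into a function of \<open>\<phi> a\<close> and one of \<open>\<phi> b\<close>, so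
  \<open>bilinear_cut_bound\<close> applies.\<close>

lemma single_edge_bound:
  fixes M :: "'a \<Rightarrow> 'a \<Rightarrow> real" and R R' :: "('i \<Rightarrow> 'a) \<Rightarrow> real"
  assumes V: "finite V" "V \<noteq> {}" and M: "\<And>S T. S \<subseteq> V \<Longrightarrow> T \<subseteq> V \<Longrightarrow> \<bar>\<Sum>i\<in>S. \<Sum>j\<in>T. M i j\<bar> \<le> \<delta>"
    and I: "finite I" "a \<in> I" "b \<in> I" "a \<noteq> b"
    and R: "\<And>\<phi>. 0 \<le> R \<phi> \<and> R \<phi> \<le> 1" "\<And>\<phi> y. R (\<phi>(b := y)) = R \<phi>"
    and R': "\<And>\<phi>. 0 \<le> R' \<phi> \<and> R' \<phi> \<le> 1" "\<And>\<phi> x. R' (\<phi>(a := x)) = R' \<phi>"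
  shows "\<bar>\<Sum>\<phi>\<in>I \<rightarrow>\<^sub>E V. M (\<phi> a) (\<phi> b) * (R \<phi> * R' \<phi>)\<bar> \<le> \<delta> / (real (card V))\<^sup>2 * real (card V) ^ card I"
proof -
  define J where "J = I - {a, b}"
  have IJ: "I = insert b (insert a J)" "b \<notin> insert a J" "a \<notin> J" "finite J"
    using I by (auto simp: J_def)
  let ?f = "\<lambda>\<phi>. M (\<phi> a) (\<phi> b) * (R \<phi> * R' \<phi>)"
  have "(\<Sum>\<phi>\<in>I \<rightarrow>\<^sub>E V. ?f \<phi>) = (\<Sum>\<psi>\<in>J \<rightarrow>\<^sub>E V. \<Sum>x\<in>V. \<Sum>y\<in>V. ?f (\<psi>(a := x, b := y)))"
    unfolding IJ(1) sum_PiE_insert[OF IJ(2)] sum_PiE_insert[OF IJ(3)] ..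
  also have "\<dots> = (\<Sum>\<psi>\<in>J \<rightarrow>\<^sub>E V. \<Sum>x\<in>V. \<Sum>y\<in>V. M x y * (R (\<psi>(a := x)) * R' (\<psi>(b := y))))"
  proof (intro sum.cong refl)
    fix \<psi> x y
    have "R' (\<psi>(a := x, b := y)) = R' (\<psi>(b := y))"
      using R'(2)[of "\<psi>(b := y)" x] I(4) by (simp add: fun_upd_twist)
    then show "?f (\<psi>(a := x, b := y)) = M x y * (R (\<psi>(a := x)) * R' (\<psi>(b := y)))"
      using R(2) I(4) by simp
  qed
  finally have "\<bar>\<Sum>\<phi>\<in>I \<rightarrow>\<^sub>E V. ?f \<phi>\<bar> \<le> (\<Sum>\<psi>\<in>J \<rightarrow>\<^sub>E V. \<bar>\<Sum>x\<in>V. \<Sum>y\<in>V. M x y * (R (\<psi>(a := x)) * R' (\<psi>(b := y)))\<bar>)"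
    by (simp only: sum_abs)
  also have "\<dots> \<le> (\<Sum>\<psi>\<in>J \<rightarrow>\<^sub>E V. \<delta>)"
    by (intro sum_mono bilinear_cut_bound[OF V(1)] M R(1) R'(1))
  also have "\<dots> = \<delta> * real (card V) ^ card J"
    using IJ(4) by (simp add: card_PiE)
  also have "real (card V) ^ card J = real (card V) ^ card I / (real (card V))\<^sup>2"
    using V IJ by (simp add: power2_eq_square)
  finally show ?thesis by simp
qed

text \<open>Edges are exchanged one at a time. The set \<open>Q\<close> holds those that already
  carry \<open>B\<close>, which is why the induction runs over all \<open>Q\<close>; the difference
  at one edge is multiplied by factors in \<open>[0,1]\<close> and falls under
  \<open>single_edge_bound\<close>.\<close>

lemma counting_lemma_aux:
  fixes A B :: "'a \<Rightarrow> 'a \<Rightarrow> real" and I :: "nat set"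
  assumes V: "finite V" "V \<noteq> {}"
    and cut: "\<And>S T. S \<subseteq> V \<Longrightarrow> T \<subseteq> V \<Longrightarrow> \<bar>\<Sum>i\<in>S. \<Sum>j\<in>T. A i j - B i j\<bar> \<le> \<delta>"
    and A: "\<And>i j. 0 \<le> A i j \<and> A i j \<le> 1" and B: "\<And>i j. 0 \<le> B i j \<and> B i j \<le> 1"
    and I: "finite I" and P: "finite P"
  shows "P \<subseteq> {(i, j). i < j \<and> i \<in> I \<and> j \<in> I} \<Longrightarrow> Q \<subseteq> {(i, j). i < j \<and> i \<in> I \<and> j \<in> I} \<Longrightarrow> P \<inter> Q = {} \<Longrightarrow>
    \<bar>\<Sum>\<phi>\<in>I \<rightarrow>\<^sub>E V. ((\<Prod>(i, j)\<in>P. A (\<phi> i) (\<phi> j)) - (\<Prod>(i, j)\<in>P. B (\<phi> i) (\<phi> j))) * (\<Prod>(i, j)\<in>Q. B (\<phi> i) (\<phi> j))\<bar>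
    \<le> real (card P) * (\<delta> / (real (card V))\<^sup>2 * real (card V) ^ card I)"
  using P
proof (induction P arbitrary: Q rule: finite_induct)
  case (insert e P)
  obtain a b where e: "e = (a, b)" by force
  let ?pr = "\<lambda>C P \<phi>. \<Prod>(i, j)\<in>P. C (\<phi> i) (\<phi> j) :: real"
  let ?K = "\<delta> / (real (card V))\<^sup>2 * real (card V) ^ card I"
  have ab: "a < b" "a \<in> I" "b \<in> I" using insert.prems(1) e by auto
  have fin: "finite P" "finite Q"
  proof -
    show "finite Q"
      by (rule finite_subset[OF insert.prems(2)], rule finite_subset[of _ "I \<times> I"]) (use I in auto)
  qed (use insert in auto)
  have pA: "0 \<le> ?pr A X \<phi> \<and> ?pr A X \<phi> \<le> 1" and pB: "0 \<le> ?pr B X \<phi> \<and> ?pr B X \<phi> \<le> 1" for X \<phi>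
    using A B by (auto intro!: prod_nonneg prod_le_1 split: prod.splits)
  \<comment> \<open>Factors that involve \<open>b\<close> go into \<open>R'\<close>, the others into
    \<open>R\<close>. The only increasing pair containing both vertices is \<open>(a, b)\<close>,
    which is in neither set, so \<open>R'\<close> is free of \<open>a\<close>.\<close>
  let ?H = "{(i, j). i = b \<or> j = b}"
  define R where "R \<phi> = ?pr A (P - ?H) \<phi> * ?pr B (Q - ?H) \<phi>" for \<phi>
  define R' where "R' \<phi> = ?pr A (P \<inter> ?H) \<phi> * ?pr B (Q \<inter> ?H) \<phi>" for \<phi>
  have split: "?pr A P \<phi> * ?pr B Q \<phi> = R \<phi> * R' \<phi>" for \<phi>
    unfolding R_def R'_def
    using prod.Int_Diff[OF fin(1), of "\<lambda>(i, j). A (\<phi> i) (\<phi> j)" ?H]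
      prod.Int_Diff[OF fin(2), of "\<lambda>(i, j). B (\<phi> i) (\<phi> j)" ?H] by (simp add: mult_ac)
  have notin: "(a, b) \<notin> P" "(a, b) \<notin> Q" using insert.hyps insert.prems(3) e by auto
  have noa: "i \<noteq> a \<and> j \<noteq> a" if "(i, j) \<in> P \<inter> ?H \<or> (i, j) \<in> Q \<inter> ?H" for i j
    using that notin insert.prems(1,2) ab(1) by auto
  have R01: "0 \<le> R \<phi> \<and> R \<phi> \<le> 1" for \<phi>
    unfolding R_def using pA[of \<phi> "P - ?H"] pB[of \<phi> "Q - ?H"] by (auto intro: mult_le_one)
  have R'01: "0 \<le> R' \<phi> \<and> R' \<phi> \<le> 1" for \<phi>
    unfolding R'_def using pA[of \<phi> "P \<inter> ?H"] pB[of \<phi> "Q \<inter> ?H"] by (auto intro: mult_le_one)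
  have Rb: "R (\<phi>(b := y)) = R \<phi>" for \<phi> y
    unfolding R_def by (intro arg_cong2[where f="(*)"] prod.cong) (auto split: if_splits)
  have Ra: "R' (\<phi>(a := x)) = R' \<phi>" for \<phi> x
    unfolding R'_def using noa by (intro arg_cong2[where f="(*)"] prod.cong refl) (auto split: prod.splits)
  have 1: "\<bar>\<Sum>\<phi>\<in>I \<rightarrow>\<^sub>E V. (A (\<phi> a) (\<phi> b) - B (\<phi> a) (\<phi> b)) * (R \<phi> * R' \<phi>)\<bar> \<le> ?K"
    using single_edge_bound[where M="\<lambda>i j. A i j - B i j", OF V cut I ab(2,3) _ R01 Rb R'01 Ra] ab(1) by simp
  have 2: "\<bar>\<Sum>\<phi>\<in>I \<rightarrow>\<^sub>E V. (?pr A P \<phi> - ?pr B P \<phi>) * ?pr B (insert (a, b) Q) \<phi>\<bar> \<le> real (card P) * ?K"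
    using insert.prems notin ab e by (intro insert.IH) auto
  have "(\<Sum>\<phi>\<in>I \<rightarrow>\<^sub>E V. (?pr A (insert e P) \<phi> - ?pr B (insert e P) \<phi>) * ?pr B Q \<phi>) =
      (\<Sum>\<phi>\<in>I \<rightarrow>\<^sub>E V. (A (\<phi> a) (\<phi> b) - B (\<phi> a) (\<phi> b)) * (R \<phi> * R' \<phi>)) +
      (\<Sum>\<phi>\<in>I \<rightarrow>\<^sub>E V. (?pr A P \<phi> - ?pr B P \<phi>) * ?pr B (insert (a, b) Q) \<phi>)"
    unfolding sum.distrib[symmetric] split[symmetric] e
    using fin notin by (intro sum.cong refl) (simp add: algebra_simps)
  moreover have "real (card (insert e P)) * ?K = ?K + real (card P) * ?K"
    using insert.hyps by (simp add: distrib_right add_divide_distrib)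
  ultimately show ?case
    using 1 2 by linarith
qed simp

definition increasing_edges :: "nat graph \<Rightarrow> (nat \<times> nat) set" where
  "increasing_edges H = {(i, j). i < j \<and> {i, j} \<in> edges H}"

lemma increasing_edges_subset:
  assumes "simple_graph H"
  shows "increasing_edges H \<subseteq> {(i, j). i < j \<and> i \<in> verts H \<and> j \<in> verts H}" "finite (increasing_edges H)"
proof -
  show sub: "increasing_edges H \<subseteq> {(i, j). i < j \<and> i \<in> verts H \<and> j \<in> verts H}"
    using assms unfolding simple_graph_def increasing_edges_def by blast
  show "finite (increasing_edges H)"
    by (rule finite_subset[of _ "verts H \<times> verts H"]) (use sub assms in \<open>auto simp: simple_graph_def\<close>)
qed

lemma card_homs_eq:
  assumes H: "simple_graph H"
    and F: "F \<subseteq> all_edges n"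
  shows "real (card (homs H ({1..n}, F))) =
    (\<Sum>\<phi>\<in>verts H \<rightarrow>\<^sub>E {1..n}. \<Prod>(i, j)\<in>increasing_edges H. of_bool ({\<phi> i, \<phi> j} \<in> F))"
proof -
  have finH: "finite (verts H)" using H by (simp add: simple_graph_def)
  have fin: "finite (verts H \<rightarrow>\<^sub>E {1..n})" using finH by (simp add: finite_PiE)
  have iff: "\<phi> \<in> homs H ({1..n}, F) \<longleftrightarrow> (\<forall>(i, j)\<in>increasing_edges H. {\<phi> i, \<phi> j} \<in> F)"
    if "\<phi> \<in> verts H \<rightarrow>\<^sub>E {1..n}" for \<phi>
  proof
    assume "\<phi> \<in> homs H ({1..n}, F)"
    then show "\<forall>(i, j)\<in>increasing_edges H. {\<phi> i, \<phi> j} \<in> F"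
      by (auto simp: homs_def increasing_edges_def)
  next
    assume *: "\<forall>(i, j)\<in>increasing_edges H. {\<phi> i, \<phi> j} \<in> F"
    have "{\<phi> u, \<phi> v} \<in> F" if uv: "{u, v} \<in> edges H" for u v
    proof -
      have "card {u, v} = 2" using uv H unfolding simple_graph_def by blast
      then have "u \<noteq> v" by auto
      then consider "u < v" | "v < u" by linarith
      then show ?thesis
      proof cases
        case 1
        then have "(u, v) \<in> increasing_edges H" using uv by (simp add: increasing_edges_def)
        then show ?thesis using * by blast
      next
        case 2
        then have "(v, u) \<in> increasing_edges H" using uv by (simp add: increasing_edges_def insert_commute)
        then have "{\<phi> v, \<phi> u} \<in> F" using * by blast
        then show ?thesis by (simp add: insert_commute)
      qed
    qed
    then show "\<phi> \<in> homs H ({1..n}, F)" using that by (simp add: homs_def)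
  qed
  have ind: "(\<Prod>(i, j)\<in>increasing_edges H. of_bool ({\<phi> i, \<phi> j} \<in> F)) =
      (if \<phi> \<in> homs H ({1..n}, F) then 1 else 0 :: real)" if phi: "\<phi> \<in> verts H \<rightarrow>\<^sub>E {1..n}" for \<phi>
  proof (cases "\<phi> \<in> homs H ({1..n}, F)")
    case True
    then show ?thesis using iff[OF phi] by (auto intro!: prod.neutral)
  next
    case False
    then obtain i j where "(i, j) \<in> increasing_edges H" "{\<phi> i, \<phi> j} \<notin> F" using iff[OF phi] by blast
    then show ?thesis using False increasing_edges_subset(2)[OF H] by (auto intro!: prod_zero bexI[of _ "(i, j)"])
  qed
  have "(\<Sum>\<phi>\<in>verts H \<rightarrow>\<^sub>E {1..n}. \<Prod>(i, j)\<in>increasing_edges H. of_bool ({\<phi> i, \<phi> j} \<in> F)) =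
      (\<Sum>\<phi>\<in>verts H \<rightarrow>\<^sub>E {1..n}. if \<phi> \<in> homs H ({1..n}, F) then 1 else 0 :: real)"
    using ind by (intro sum.cong) auto
  also have "\<dots> = real (card ((verts H \<rightarrow>\<^sub>E {1..n}) \<inter> homs H ({1..n}, F)))"
    using fin by (simp add: sum.If_cases)
  also have "(verts H \<rightarrow>\<^sub>E {1..n}) \<inter> homs H ({1..n}, F) = homs H ({1..n}, F)"
    by (auto simp: homs_def)
  finally show ?thesis by simp
qed

section \<open>Sampling the limit function on the grid\<close>

text \<open>As a sum over end points, the potential makes the total over an edge set depend only on
  the degrees.\<close>

definition edge_potential :: "(real \<Rightarrow> real) \<Rightarrow> nat \<Rightarrow> nat set \<Rightarrow> real" where
  "edge_potential g n e = (\<Sum>i\<in>e. g (real i / real n))"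

definition edge_prob :: "(real \<Rightarrow> real) \<Rightarrow> nat \<Rightarrow> nat set \<Rightarrow> real" where
  "edge_prob g n e = logistic (edge_potential g n e)"

text \<open>On the diagonal this uses \<open>g\<close> twice, as the graphon does, whereas
  \<open>edge_prob\<close> of a singleton would use it once.\<close>

abbreviation grid_prob :: "(real \<Rightarrow> real) \<Rightarrow> nat \<Rightarrow> nat \<Rightarrow> nat \<Rightarrow> real" where
  "grid_prob g n i j \<equiv> logistic (g (real i / real n) + g (real j / real n))"

lemma edge_prob_doubleton: "i \<noteq> j \<Longrightarrow> edge_prob g n {i, j} = grid_prob g n i j"
  by (simp add: edge_prob_def edge_potential_def)

text \<open>Homomorphism sums allow two vertices to share an image and so meet the diagonal, which
  \<open>cut_deviation\<close> omits. Each diagonal entry is at most 1 in absolute value.\<close>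

lemma cut_deviation_full:
  assumes S: "S \<subseteq> {1..n}" and T: "T \<subseteq> {1..n}" and F: "F \<subseteq> all_edges n"
  shows "\<bar>(\<Sum>i\<in>S. \<Sum>j\<in>T. of_bool ({i, j} \<in> F) - grid_prob g n i j) - cut_deviation (edge_prob g n) F S T\<bar> \<le> real (card (S \<inter> T))"
proof -
  have fin: "finite S" "finite T" using S T finite_subset by blast+
  let ?m = "\<lambda>(i, j). of_bool ({i, j} \<in> F) - grid_prob g n i j"
  let ?P = "{(i, j). i \<in> S \<and> j \<in> T \<and> i \<noteq> j}"
  let ?D = "(\<lambda>i. (i, i)) ` (S \<inter> T)"
  have "(\<Sum>i\<in>S. \<Sum>j\<in>T. of_bool ({i, j} \<in> F) - grid_prob g n i j) = (\<Sum>x\<in>S \<times> T. ?m x)"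
    by (simp add: sum.cartesian_product)
  also have "S \<times> T = ?P \<union> ?D" by auto
  also have "(\<Sum>x\<in>?P \<union> ?D. ?m x) = (\<Sum>x\<in>?P. ?m x) + (\<Sum>x\<in>?D. ?m x)"
  proof (rule sum.union_disjoint)
    show "finite ?P" by (rule finite_subset[of _ "S \<times> T"]) (use fin in auto)
  qed (use fin in auto)
  also have "(\<Sum>x\<in>?P. ?m x) = cut_deviation (edge_prob g n) F S T"
    unfolding cut_deviation_def by (intro sum.cong) (auto simp: edge_prob_doubleton)
  finally have "(\<Sum>i\<in>S. \<Sum>j\<in>T. of_bool ({i, j} \<in> F) - grid_prob g n i j) - cut_deviation (edge_prob g n) F S T = (\<Sum>x\<in>?D. ?m x)"
    by simp
  moreover have "\<bar>\<Sum>x\<in>?D. ?m x\<bar> \<le> (\<Sum>x\<in>?D. 1)"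
  proof (intro order_trans[OF sum_abs] sum_mono)
    fix x assume "x \<in> ?D"
    then obtain i where "x = (i, i)" by blast
    moreover have "{i} \<notin> F" using F singleton_notin_all_edges by blast
    ultimately show "\<bar>?m x\<bar> \<le> 1" by simp
  qed
  moreover have "(\<Sum>x\<in>?D. 1) = real (card (S \<inter> T))"
    by (simp add: card_image inj_on_def)
  ultimately show ?thesis by simp
qed

text \<open>Each edge of \<open>H\<close> pays the cut error once; the summand \<open>1 / n\<close>
  is the diagonal, of size at most \<open>n\<close> among \<open>n^2\<close> pairs.\<close>

lemma hom_density_cut_close:
  assumes H: "simple_graph H" and n: "n \<ge> 1" and F: "F \<subseteq> all_edges n" and close: "cut_close n (edge_prob g n) \<epsilon> F"
  shows "\<bar>hom_density H ({1..n}, F) -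
      (\<Sum>\<phi>\<in>verts H \<rightarrow>\<^sub>E {1..n}. \<Prod>(i, j)\<in>increasing_edges H. grid_prob g n (\<phi> i) (\<phi> j)) / real n ^ card (verts H)\<bar>
    \<le> real (card (increasing_edges H)) * (\<epsilon> + 1 / real n)"
proof -
  let ?A = "\<lambda>i j. of_bool ({i, j} \<in> F) :: real" and ?B = "grid_prob g n"
  let ?d = "\<epsilon> * (real n)\<^sup>2 + real n"
  let ?k = "card (verts H)"
  let ?P = "increasing_edges H"
  have cut: "\<bar>\<Sum>i\<in>S. \<Sum>j\<in>T. ?A i j - ?B i j\<bar> \<le> ?d" if ST: "S \<subseteq> {1..n}" "T \<subseteq> {1..n}" for S T
  proof -
    have "card (S \<inter> T) \<le> card {1..n}" using ST by (intro card_mono) auto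
    then have "real (card (S \<inter> T)) \<le> real n" by simp
    moreover have "\<bar>cut_deviation (edge_prob g n) F S T\<bar> \<le> \<epsilon> * (real n)\<^sup>2"
      using close ST by (simp add: cut_close_def)
    ultimately show ?thesis using cut_deviation_full[OF ST F, of g] by linarith
  qed
  have finH: "finite (verts H)" using H by (simp add: simple_graph_def)
  have "\<bar>\<Sum>\<phi>\<in>verts H \<rightarrow>\<^sub>E {1..n}. ((\<Prod>(i, j)\<in>?P. ?A (\<phi> i) (\<phi> j)) - (\<Prod>(i, j)\<in>?P. ?B (\<phi> i) (\<phi> j))) * (\<Prod>(i, j)\<in>{}. ?B (\<phi> i) (\<phi> j))\<bar>
    \<le> real (card ?P) * (?d / (real (card {1..n}))\<^sup>2 * real (card {1..n}) ^ ?k)"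
    using n increasing_edges_subset[OF H] cut
    by (intro counting_lemma_aux finH) (auto simp: less_imp_le)
  then have 1: "\<bar>(\<Sum>\<phi>\<in>verts H \<rightarrow>\<^sub>E {1..n}. \<Prod>(i, j)\<in>?P. ?A (\<phi> i) (\<phi> j)) -
      (\<Sum>\<phi>\<in>verts H \<rightarrow>\<^sub>E {1..n}. \<Prod>(i, j)\<in>?P. ?B (\<phi> i) (\<phi> j))\<bar>
    \<le> real (card ?P) * (?d / (real n)\<^sup>2 * real n ^ ?k)"
    by (simp add: sum_subtractf)
  have "hom_density H ({1..n}, F) = (\<Sum>\<phi>\<in>verts H \<rightarrow>\<^sub>E {1..n}. \<Prod>(i, j)\<in>?P. ?A (\<phi> i) (\<phi> j)) / real n ^ ?k"
    unfolding hom_density_def card_homs_eq[OF H F] by simp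
  then have "\<bar>hom_density H ({1..n}, F) - (\<Sum>\<phi>\<in>verts H \<rightarrow>\<^sub>E {1..n}. \<Prod>(i, j)\<in>?P. ?B (\<phi> i) (\<phi> j)) / real n ^ ?k\<bar> =
      \<bar>(\<Sum>\<phi>\<in>verts H \<rightarrow>\<^sub>E {1..n}. \<Prod>(i, j)\<in>?P. ?A (\<phi> i) (\<phi> j)) -
      (\<Sum>\<phi>\<in>verts H \<rightarrow>\<^sub>E {1..n}. \<Prod>(i, j)\<in>?P. ?B (\<phi> i) (\<phi> j))\<bar> / real n ^ ?k"
    by (simp add: diff_divide_distrib[symmetric] abs_divide)
  also have "\<dots> \<le> real (card ?P) * (?d / (real n)\<^sup>2 * real n ^ ?k) / real n ^ ?k"
    using 1 by (intro divide_right_mono) auto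
  also have "\<dots> = real (card ?P) * (\<epsilon> + 1 / real n)"
    using n by (simp add: field_simps power2_eq_square)
  finally show ?thesis .
qed

lemma abs_prod_diff_le:
  fixes a b :: "'e \<Rightarrow> real"
  assumes "finite P" "\<And>e. e \<in> P \<Longrightarrow> 0 \<le> a e \<and> a e \<le> 1" "\<And>e. e \<in> P \<Longrightarrow> 0 \<le> b e \<and> b e \<le> 1"
  shows "\<bar>(\<Prod>e\<in>P. a e) - (\<Prod>e\<in>P. b e)\<bar> \<le> (\<Sum>e\<in>P. \<bar>a e - b e\<bar>)"
  using norm_prod_diff[of P a b] assms by auto

text \<open>For factors in \<open>[0,1]\<close> the difference of two products is at most the sum of
  the differences. As \<open>logistic\<close> is 1-Lipschitz, each edge contributes the cell errors
  of its two end points.\<close>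

lemma graphon_density_grid:
  assumes H: "simple_graph H" and n: "n \<ge> 1" and g: "antimono_on {0..1} g"
  shows "\<bar>graphon_density H (beta_graphon g) -
      (\<Sum>\<phi>\<in>verts H \<rightarrow>\<^sub>E {1..n}. \<Prod>(i, j)\<in>increasing_edges H. grid_prob g n (\<phi> i) (\<phi> j)) / real n ^ card (verts H)\<bar>
    \<le> real (card (increasing_edges H)) * (2 * (g 0 - g 1) / real n)"
proof -
  let ?P = "increasing_edges H" and ?V = "verts H"
  let ?M = "\<Pi>\<^sub>M i\<in>?V. \<U>"
  let ?c = "\<lambda>x. real (cell n x) / real n"
  let ?e = "\<lambda>x. \<bar>g (?c x) - g x\<bar>"
  note [measurable] = measurable_antimono_unit[OF g]
  have finV: "finite ?V" using H by (simp add: simple_graph_def)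
  note P = increasing_edges_subset[OF H]
  interpret UP: prob_space ?M by (rule prob_space_PiM) (rule prob_space_unit_lebesgue)
  let ?W = "\<lambda>x. \<Prod>(i, j)\<in>?P. logistic (g (x i) + g (x j))"
  let ?F = "\<lambda>\<phi>. \<Prod>(i, j)\<in>?P. grid_prob g n (\<phi> i) (\<phi> j)"
  let ?Wn = "\<lambda>x. ?F (\<lambda>i\<in>?V. cell n (x i))"
  have dens: "graphon_density H (beta_graphon g) = (\<integral>x. ?W x \<partial>?M)"
    unfolding graphon_density_def increasing_edges_def beta_graphon_logistic ..
  have cell: "(\<integral>x. ?Wn x \<partial>?M) = (\<Sum>\<phi>\<in>?V \<rightarrow>\<^sub>E {1..n}. ?F \<phi>) / real n ^ card ?V" "integrable ?M ?Wn"
    using integral_PiM_cell[OF n finV, of ?F] by auto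
  have gm: "(\<lambda>x. g (x i)) \<in> borel_measurable ?M" if "i \<in> ?V" for i
    using that by measurable
  have "(\<lambda>x. case e of (i, j) \<Rightarrow> logistic (g (x i) + g (x j))) \<in> borel_measurable ?M" if eP: "e \<in> ?P" for e
  proof -
    obtain i j where e: "e = (i, j)" "i \<in> ?V" "j \<in> ?V" using eP P(1) by (cases e) auto
    show ?thesis unfolding e(1) prod.case using gm[OF e(2)] gm[OF e(3)] by measurable
  qed
  then have "?W \<in> borel_measurable ?M" by (intro borel_measurable_prod) auto
  moreover have "\<bar>?W x\<bar> \<le> 1" for x
  proof -
    have "0 \<le> ?W x" "?W x \<le> 1" by (auto intro!: prod_nonneg prod_le_1 split: prod.splits)
    then show ?thesis by simp
  qed
  ultimately have intW: "integrable ?M ?W"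
    by (intro UP.integrable_const_bound[where B=1]) auto
  note eu = antimono_cell_error[OF g n]
  have ei: "integrable ?M (\<lambda>x. ?e (x i))" "(\<integral>x. ?e (x i) \<partial>?M) = (\<integral>x. ?e x \<partial>\<U>)" if "i \<in> ?V" for i
    using integral_PiM_component[OF finV that eu(2)] by auto
  have inte: "integrable ?M (\<lambda>x. case e of (i, j) \<Rightarrow> ?e (x i) + ?e (x j))"
      "(\<integral>x. (case e of (i, j) \<Rightarrow> ?e (x i) + ?e (x j)) \<partial>?M) \<le> 2 * (g 0 - g 1) / real n" if eP: "e \<in> ?P" for e
  proof -
    obtain i j where e: "e = (i, j)" "i \<in> ?V" "j \<in> ?V" using eP P(1) by (cases e) auto
    show "integrable ?M (\<lambda>x. case e of (i, j) \<Rightarrow> ?e (x i) + ?e (x j))"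
      unfolding e(1) prod.case using ei(1)[OF e(2)] ei(1)[OF e(3)] by (rule Bochner_Integration.integrable_add)
    have "(\<integral>x. ?e (x i) + ?e (x j) \<partial>?M) = (\<integral>x. ?e x \<partial>\<U>) + (\<integral>x. ?e x \<partial>\<U>)"
      using Bochner_Integration.integral_add[OF ei(1)[OF e(2)] ei(1)[OF e(3)]] ei(2)[OF e(2)] ei(2)[OF e(3)] by simp
    also have "\<dots> \<le> (g 0 - g 1) / real n + (g 0 - g 1) / real n"
      by (intro add_mono eu(1))
    also have "\<dots> = 2 * (g 0 - g 1) / real n" by (simp add: field_simps)
    finally show "(\<integral>x. (case e of (i, j) \<Rightarrow> ?e (x i) + ?e (x j)) \<partial>?M) \<le> 2 * (g 0 - g 1) / real n"
      unfolding e(1) prod.case .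
  qed
  have "\<bar>(\<integral>x. ?W x \<partial>?M) - (\<integral>x. ?Wn x \<partial>?M)\<bar> = \<bar>\<integral>x. ?W x - ?Wn x \<partial>?M\<bar>"
    by (simp only: Bochner_Integration.integral_diff[OF intW cell(2)])
  also have "\<dots> \<le> (\<integral>x. \<bar>?W x - ?Wn x\<bar> \<partial>?M)" by (rule integral_abs_bound)
  also have "\<dots> \<le> (\<integral>x. (\<Sum>e\<in>?P. case e of (i, j) \<Rightarrow> ?e (x i) + ?e (x j)) \<partial>?M)"
  proof (rule integral_mono)
    show "integrable ?M (\<lambda>x. \<bar>?W x - ?Wn x\<bar>)"
      by (intro integrable_abs Bochner_Integration.integrable_diff intW cell(2))
    show "integrable ?M (\<lambda>x. \<Sum>e\<in>?P. case e of (i, j) \<Rightarrow> ?e (x i) + ?e (x j))"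
      by (intro Bochner_Integration.integrable_sum inte(1))
    fix x
    have "?Wn x = (\<Prod>(i, j)\<in>?P. logistic (g (?c (x i)) + g (?c (x j))))"
      using P(1) by (intro prod.cong) auto
    then have "\<bar>?W x - ?Wn x\<bar> \<le> (\<Sum>e\<in>?P. \<bar>(case e of (i, j) \<Rightarrow> logistic (g (x i) + g (x j))) - (case e of (i, j) \<Rightarrow> logistic (g (?c (x i)) + g (?c (x j))))\<bar>)"
      using abs_prod_diff_le[OF P(2), of "\<lambda>(i, j). logistic (g (x i) + g (x j))" "\<lambda>(i, j). logistic (g (?c (x i)) + g (?c (x j)))"]
      by (auto split: prod.splits)
    also have "\<dots> \<le> (\<Sum>e\<in>?P. case e of (i, j) \<Rightarrow> ?e (x i) + ?e (x j))"
    proof (rule sum_mono)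
      fix e :: "nat \<times> nat"
      obtain i j where e: "e = (i, j)" by force
      show "\<bar>(case e of (i, j) \<Rightarrow> logistic (g (x i) + g (x j))) - (case e of (i, j) \<Rightarrow> logistic (g (?c (x i)) + g (?c (x j))))\<bar>
         \<le> (case e of (i, j) \<Rightarrow> ?e (x i) + ?e (x j))"
        unfolding e prod.case
        using logistic_lipschitz[of "g (x i) + g (x j)" "g (?c (x i)) + g (?c (x j))"] by linarith
    qed
    finally show "\<bar>?W x - ?Wn x\<bar> \<le> (\<Sum>e\<in>?P. case e of (i, j) \<Rightarrow> ?e (x i) + ?e (x j))" .
  qed
  also have "\<dots> = (\<Sum>e\<in>?P. \<integral>x. (case e of (i, j) \<Rightarrow> ?e (x i) + ?e (x j)) \<partial>?M)"
    by (rule Bochner_Integration.integral_sum[OF inte(1)])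
  also have "\<dots> \<le> (\<Sum>e\<in>?P. 2 * (g 0 - g 1) / real n)"
    by (intro sum_mono inte(2))
  finally show ?thesis unfolding dens cell(1) by simp
qed

lemma graphon_beta_graphon:
  assumes g: "antimono_on {0..1} g"
  shows "graphon (beta_graphon g)"
proof -
  have "g \<in> borel_measurable (restrict_space borel {0..1})"
    using measurable_antimono_unit[OF g]
    by (simp add: sets_restrict_space cong: measurable_cong_sets)
  \<comment> \<open>Extension by 0 gives a Borel function on the whole line that agrees with
    \<open>g\<close> on the unit interval.\<close>
  then have [measurable]: "(\<lambda>x. indicator {0..1} x *\<^sub>R g x) \<in> borel_measurable borel"
    by (simp add: borel_measurable_restrict_space_iff)
  have "(\<lambda>(x, y). logistic (indicator {0..1} x *\<^sub>R g x + indicator {0..1} y *\<^sub>R g y)) \<in> borel_measurable (borel \<Otimes>\<^sub>M borel)"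
    by measurable
  then have "(\<lambda>(x, y). logistic (indicator {0..1} x *\<^sub>R g x + indicator {0..1} y *\<^sub>R g y)) \<in>
      borel_measurable (restrict_space borel ({0..1} \<times> {0..1}))"
    unfolding borel_prod by (rule measurable_restrict_space1)
  then have "(\<lambda>(x, y). beta_graphon g x y) \<in> borel_measurable (restrict_space borel ({0..1} \<times> {0..1}))"
    by (rule measurable_cong[THEN iffD1, rotated]) (auto simp: space_restrict_space beta_graphon_logistic)
  then show ?thesis
    by (auto simp: graphon_def beta_graphon_logistic add.commute)
qed

text \<open>The tolerances \<open>1 / Suc m\<close> form a countable family, so that in the random
  case a single null set serves all of them.\<close>

lemma converges_of_cut_close:
  assumes g: "antimono_on {0..1} g" and F: "\<And>n. n \<ge> 1 \<Longrightarrow> F n \<subseteq> all_edges n"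
    and G: "\<And>n. n \<ge> 1 \<Longrightarrow> G n = ({1..n}, F n)"
    and close: "\<And>m. eventually (\<lambda>n. cut_close n (edge_prob g n) (1 / real (Suc m)) (F n)) sequentially"
  shows "converges_to_graphon G (beta_graphon g)"
  unfolding converges_to_graphon_def
proof (intro conjI allI impI)
  show "graphon (beta_graphon g)" by (rule graphon_beta_graphon[OF g])
  fix H :: "nat graph" and k assume "simple_graph H \<and> verts H = {1..k}"
  then have H: "simple_graph H" by simp
  let ?p = "real (card (increasing_edges H))"
  show "(\<lambda>n. hom_density H (G n)) \<longlonglongrightarrow> graphon_density H (beta_graphon g)"
  proof (rule LIMSEQ_I)
    fix r :: real assume r: "0 < r"
    obtain m where "2 * (?p / r) < real m" using reals_Archimedean2 by blast
    then have "2 * (?p / r) < real (Suc m)" by simp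
    then have half: "?p * (1 / real (Suc m)) < r / 2" using r by (simp add: field_simps)
    have "(\<lambda>n. ?p * (1 / real n) + ?p * (2 * (g 0 - g 1) / real n)) \<longlonglongrightarrow> ?p * 0 + ?p * 0"
      by (intro tendsto_intros lim_const_over_n)
    then have ev: "eventually (\<lambda>n. ?p * (1 / real n) + ?p * (2 * (g 0 - g 1) / real n) < r / 2) sequentially"
      using r by (intro order_tendstoD) auto
    have "eventually (\<lambda>n. norm (hom_density H (G n) - graphon_density H (beta_graphon g)) < r) sequentially"
      using close[of m] ev eventually_ge_at_top[of 1]
    proof eventually_elim
      case (elim n)
      have "\<bar>hom_density H (G n) - graphon_density H (beta_graphon g)\<bar> \<le>
          ?p * (1 / real (Suc m) + 1 / real n) + ?p * (2 * (g 0 - g 1) / real n)"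
        using hom_density_cut_close[OF H elim(3) F[OF elim(3)] elim(1)] graphon_density_grid[OF H elim(3) g]
        unfolding G[OF elim(3)] by linarith
      also have "\<dots> < r" using half elim(2) unfolding distrib_left by linarith
      finally show ?case by simp
    qed
    then show "\<exists>no. \<forall>n\<ge>no. norm (hom_density H (G n) - graphon_density H (beta_graphon g)) < r"
      by (simp add: eventually_sequentially)
  qed
qed

section \<open>The weight of a degree class\<close>

definition degree_class :: "nat \<Rightarrow> (nat \<Rightarrow> nat) \<Rightarrow> nat set set set" where
  "degree_class n d = {F. F \<subseteq> all_edges n \<and> (\<forall>v\<in>{1..n}. edge_degree F v = d v)}"

lemma graphs_with_degrees_eq: "graphs_with_degrees n d = Pair {1..n} ` degree_class n d"
proof -
  have "(V, F) \<in> graphs_with_degrees n d \<longleftrightarrow> V = {1..n} \<and> F \<in> degree_class n d" for V F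
    unfolding graphs_with_degrees_def degree_class_def
    by (auto simp: edge_degree_eq_vertex_degree[where V="{1..n}"] simp flip: simple_graph_all_edges)
  then show ?thesis by auto
qed

lemma finite_degree_class: "finite (degree_class n d)"
  unfolding degree_class_def by (rule finite_subset_family) simp

lemma sum_edge_potential:
  assumes F: "F \<subseteq> all_edges n"
  shows "(\<Sum>e\<in>F. edge_potential g n e) = (\<Sum>v=1..n. real (edge_degree F v) * g (real v / real n))"
proof -
  note fin = finite_subset_all_edges[OF F]
  have "(\<Sum>e\<in>F. edge_potential g n e) = (\<Sum>e\<in>F. \<Sum>v=1..n. of_bool (v \<in> e) * g (real v / real n))"
  proof (rule sum.cong[OF refl])
    fix e assume "e \<in> F"
    then have e: "e \<subseteq> {1..n}" using F by (auto simp: all_edges_def)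
    have "(\<Sum>v=1..n. of_bool (v \<in> e) * g (real v / real n)) = (\<Sum>v=1..n. if v \<in> e then g (real v / real n) else 0)"
      by (intro sum.cong) auto
    also have "\<dots> = (\<Sum>v\<in>{1..n} \<inter> e. g (real v / real n))" by (simp add: sum.If_cases)
    also have "{1..n} \<inter> e = e" using e by blast
    finally show "edge_potential g n e = (\<Sum>v=1..n. of_bool (v \<in> e) * g (real v / real n))"
      by (simp add: edge_potential_def)
  qed
  also have "\<dots> = (\<Sum>v=1..n. \<Sum>e\<in>F. of_bool (v \<in> e) * g (real v / real n))" by (rule sum.swap)
  also have "\<dots> = (\<Sum>v=1..n. real (edge_degree F v) * g (real v / real n))"
  proof (rule sum.cong[OF refl])
    fix v
    have "real (edge_degree F v) = real_of_int (int (edge_degree F v))" by simp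
    also have "\<dots> = (\<Sum>e\<in>F. of_bool (v \<in> e))"
      unfolding int_edge_degree[OF fin] by simp
    finally show "(\<Sum>e\<in>F. of_bool (v \<in> e) * g (real v / real n)) = real (edge_degree F v) * g (real v / real n)"
      by (simp add: sum_distrib_right)
  qed
  finally show ?thesis .
qed

text \<open>This constancy is what makes the uniform graph equal in law to the graph with
  independent edges conditioned on its degrees.\<close>

lemma gibbs_weight_degree_class:
  assumes "F \<in> degree_class n d" "F' \<in> degree_class n d"
  shows "gibbs_weight (edge_potential g n) (all_edges n) F = gibbs_weight (edge_potential g n) (all_edges n) F'"
proof -
  have "F \<subseteq> all_edges n" "F' \<subseteq> all_edges n" using assms by (auto simp: degree_class_def)
  moreover have "(\<Sum>v=1..n. real (edge_degree F v) * g (real v / real n)) = (\<Sum>v=1..n. real (edge_degree F' v) * g (real v / real n))"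
    using assms by (intro sum.cong) (auto simp: degree_class_def)
  ultimately show ?thesis by (simp add: gibbs_weight_eq sum_edge_potential)
qed

lemma grid_in_unit: "v \<in> {1..n} \<Longrightarrow> real v / real n \<in> {0..1}"
  by (auto simp: field_simps)

lemma edge_potential_bound:
  assumes g: "antimono_on {0..1} g" and e: "e \<in> all_edges n"
  shows "\<bar>edge_potential g n e\<bar> \<le> 2 * (\<bar>g 0\<bar> + \<bar>g 1\<bar>)"
proof -
  obtain i j where ij: "e = {i, j}" "i \<noteq> j" "i \<in> {1..n}" "j \<in> {1..n}" using e by (rule all_edgesE)
  then show ?thesis
    using antimono_unit_bounds(3)[OF g grid_in_unit[OF ij(3)]] antimono_unit_bounds(3)[OF g grid_in_unit[OF ij(4)]]
    by (simp add: edge_potential_def)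
qed

lemma edge_prob_bounds:
  assumes "antimono_on {0..1} g" "e \<in> all_edges n"
  shows "logistic (- (2 * (\<bar>g 0\<bar> + \<bar>g 1\<bar>))) \<le> edge_prob g n e"
    and "edge_prob g n e \<le> 1 - logistic (- (2 * (\<bar>g 0\<bar> + \<bar>g 1\<bar>)))"
proof -
  let ?C = "2 * (\<bar>g 0\<bar> + \<bar>g 1\<bar>)"
  have "- ?C \<le> edge_potential g n e" "edge_potential g n e \<le> ?C"
    using edge_potential_bound[OF assms] by linarith+
  then have "logistic (- ?C) \<le> edge_prob g n e" "edge_prob g n e \<le> logistic ?C"
    unfolding edge_prob_def by (intro logistic_mono; simp)+
  then show "logistic (- ?C) \<le> edge_prob g n e" "edge_prob g n e \<le> 1 - logistic (- ?C)"
    using logistic_minus[of ?C] by linarith+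
qed

lemma cut_deviation_iterated:
  assumes "finite S" "finite T"
  shows "cut_deviation p F S T = (\<Sum>i\<in>S. \<Sum>j\<in>T - {i}. of_bool ({i, j} \<in> F) - p {i, j})"
proof -
  have "{(i, j). i \<in> S \<and> j \<in> T \<and> i \<noteq> j} = (SIGMA i:S. T - {i})" by auto
  then show ?thesis
    unfolding cut_deviation_def using assms by (simp add: sum.Sigma)
qed

lemma cut_deviation_vertex:
  assumes F: "F \<subseteq> all_edges n" and v: "v \<in> {1..n}"
  shows "cut_deviation p F {v} {1..n} = real (edge_degree F v) - (\<Sum>x\<in>{1..n} - {v}. p {v, x})"
proof -
  have nv: "{v, v} \<notin> F" using F singleton_notin_all_edges by auto
  have "real (edge_degree F v) = (\<Sum>x=1..n. of_bool ({v, x} \<in> F))"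
    unfolding edge_degree_eq_sum(1)[OF F v] of_nat_sum by (intro sum.cong) auto
  also have "\<dots> = of_bool ({v, v} \<in> F) + (\<Sum>x\<in>{1..n} - {v}. of_bool ({v, x} \<in> F))"
    by (rule sum.remove) (use v in auto)
  finally have "real (edge_degree F v) = (\<Sum>x\<in>{1..n} - {v}. of_bool ({v, x} \<in> F))"
    using nv by simp
  then show ?thesis
    by (simp add: cut_deviation_iterated sum_subtractf)
qed

text \<open>There are at least \<open>m^2 - n\<close> off-diagonal pairs. The expected number of
  edges among them, and likewise of non-edges, is at least \<delta> times that, and the cut bound
  controls the deviation from it.\<close>

lemma edge_rich_of_cut_close:
  assumes F: "F \<subseteq> all_edges n" and close: "cut_close n p \<epsilon> F"
    and p: "\<And>e. e \<in> all_edges n \<Longrightarrow> \<delta> \<le> p e \<and> p e \<le> 1 - \<delta>" and \<delta>: "0 \<le> \<delta>"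
    and K: "2 * real K < \<delta> * ((real m)\<^sup>2 - real n) - \<epsilon> * (real n)\<^sup>2"
  shows "edge_rich n m K F" "edge_rich n m K (all_edges n - F)"
proof -
  have *: "2 * K < card {(x, y). x \<in> S \<and> y \<in> T \<and> {x, y} \<in> F} \<and>
      2 * K < card {(x, y). x \<in> S \<and> y \<in> T \<and> {x, y} \<in> all_edges n - F}"
    if S: "S \<subseteq> {1..n}" "m \<le> card S" and T: "T \<subseteq> {1..n}" "m \<le> card T" for S T
  proof -
    let ?N = "{(x, y). x \<in> S \<and> y \<in> T \<and> x \<noteq> y}"
    let ?A = "{(x, y). x \<in> S \<and> y \<in> T \<and> {x, y} \<in> F}" and ?B = "{(x, y). x \<in> S \<and> y \<in> T \<and> {x, y} \<in> all_edges n - F}"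
    have fin: "finite S" "finite T" using S T finite_subset by blast+
    have finN: "finite ?N" by (rule finite_subset[of _ "S \<times> T"]) (use fin in auto)
    have E: "{x, y} \<in> all_edges n" if "(x, y) \<in> ?N" for x y
      using that S(1) T(1) by (auto simp: doubleton_in_all_edges)
    have ne: "x \<noteq> y" if "{x, y} \<in> all_edges n" for x y
      using that by (simp add: doubleton_in_all_edges)
    have A: "?A = {z \<in> ?N. (case z of (x, y) \<Rightarrow> {x, y} \<in> F)}"
      using ne subsetD[OF F] by blast
    have B: "?B = {z \<in> ?N. \<not> (case z of (x, y) \<Rightarrow> {x, y} \<in> F)}"
      using ne E by blast
    have cA: "real (card ?A) = (\<Sum>z\<in>?N. of_bool (case z of (x, y) \<Rightarrow> {x, y} \<in> F))"
      unfolding A using finN by (simp add: of_bool_def sum.If_cases Int_def)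
    have cB: "real (card ?B) = (\<Sum>z\<in>?N. 1 - of_bool (case z of (x, y) \<Rightarrow> {x, y} \<in> F))"
    proof -
      have "real (card ?B) = (\<Sum>z\<in>?N. of_bool (\<not> (case z of (x, y) \<Rightarrow> {x, y} \<in> F)))"
        unfolding B using finN by (simp add: of_bool_def sum.If_cases Int_def)
      then show ?thesis by (simp only: of_bool_not_iff)
    qed
    have dev: "cut_deviation p F S T = (\<Sum>z\<in>?N. of_bool (case z of (x, y) \<Rightarrow> {x, y} \<in> F) - (case z of (x, y) \<Rightarrow> p {x, y}))"
      unfolding cut_deviation_def by (intro sum.cong) auto
    have pN: "\<delta> \<le> (case z of (x, y) \<Rightarrow> p {x, y}) \<and> (case z of (x, y) \<Rightarrow> p {x, y}) \<le> 1 - \<delta>" if "z \<in> ?N" for z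
      using p[OF E] that by (cases z) auto
    have 1: "real (card ?N) * \<delta> \<le> (\<Sum>z\<in>?N. (case z of (x, y) \<Rightarrow> p {x, y}))"
      by (rule sum_bounded_below) (use pN in blast)
    have 2: "real (card ?N) * \<delta> \<le> (\<Sum>z\<in>?N. 1 - (case z of (x, y) \<Rightarrow> p {x, y}))"
    proof (rule sum_bounded_below)
      fix z assume "z \<in> ?N"
      from pN[OF this] show "\<delta> \<le> 1 - (case z of (x, y) \<Rightarrow> p {x, y})" by linarith
    qed
    have "\<bar>cut_deviation p F S T\<bar> \<le> \<epsilon> * (real n)\<^sup>2"
      using close S T by (simp add: cut_close_def)
    then have AB: "\<delta> * real (card ?N) - \<epsilon> * (real n)\<^sup>2 \<le> real (card ?A)" "\<delta> * real (card ?N) - \<epsilon> * (real n)\<^sup>2 \<le> real (card ?B)"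
      using 1 2 unfolding dev cA cB sum_subtractf mult.commute[of \<delta>] by linarith+
    have "card (S \<times> T) \<le> card (?N \<union> (\<lambda>i. (i, i)) ` {1..n})"
      using finN S(1) by (intro card_mono) auto
    also have "\<dots> \<le> card ?N + card ((\<lambda>i. (i, i)) ` {1..n})" by (rule card_Un_le)
    also have "card ((\<lambda>i. (i, i)) ` {1..n}) = n" by (simp add: card_image inj_on_def)
    finally have "card S * card T \<le> card ?N + n" by (simp add: card_cartesian_product)
    moreover have "m * m \<le> card S * card T" using S T by (intro mult_mono) auto
    ultimately have "m\<^sup>2 \<le> card ?N + n" by (simp add: power2_eq_square)
    then have "real (m\<^sup>2) \<le> real (card ?N + n)" by (rule of_nat_mono)
    then have "(real m)\<^sup>2 \<le> real (card ?N) + real n" by (simp only: of_nat_power of_nat_add)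
    then have "\<delta> * ((real m)\<^sup>2 - real n) \<le> \<delta> * real (card ?N)"
      using \<delta> by (intro mult_left_mono) auto
    then have "real (2 * K) < real (card ?A)" "real (2 * K) < real (card ?B)" using AB K by (simp_all only: of_nat_mult of_nat_numeral)
    then show ?thesis unfolding of_nat_less_iff by (rule conjI)
  qed
  show "edge_rich n m K F" "edge_rich n m K (all_edges n - F)"
    unfolding edge_rich_def using * by blast+
qed

text \<open>Split by sign, the deviations form two sums, each of which is a cut deviation between a
  vertex set and all vertices.\<close>

lemma sum_abs_degree_deviation:
  assumes F: "F \<subseteq> all_edges n" and close: "cut_close n p \<epsilon> F"
  shows "(\<Sum>v=1..n. \<bar>real (edge_degree F v) - (\<Sum>x\<in>{1..n} - {v}. p {v, x})\<bar>) \<le> 2 * \<epsilon> * (real n)\<^sup>2"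
proof -
  define r where "r v = cut_deviation p F {v} {1..n}" for v
  have r: "r v = real (edge_degree F v) - (\<Sum>x\<in>{1..n} - {v}. p {v, x})" if "v \<in> {1..n}" for v
    unfolding r_def by (rule cut_deviation_vertex[OF F that])
  have S: "\<bar>\<Sum>v\<in>S. r v\<bar> \<le> \<epsilon> * (real n)\<^sup>2" if "S \<subseteq> {1..n}" for S
  proof -
    have "finite S" using that finite_subset by blast
    then have "(\<Sum>v\<in>S. r v) = cut_deviation p F S {1..n}"
      by (simp add: r_def cut_deviation_iterated)
    then show ?thesis using close that by (simp add: cut_close_def)
  qed
  let ?P = "{v \<in> {1..n}. r v \<ge> 0}" and ?N = "{v \<in> {1..n}. \<not> r v \<ge> 0}"
  have "(\<Sum>v=1..n. \<bar>r v\<bar>) = (\<Sum>v=1..n. if r v \<ge> 0 then r v else - r v)"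
    by (intro sum.cong) auto
  also have "\<dots> = (\<Sum>v\<in>?P. r v) + (\<Sum>v\<in>?N. - r v)"
    by (simp add: sum.If_cases Int_def)
  also have "\<dots> = (\<Sum>v\<in>?P. r v) - (\<Sum>v\<in>?N. r v)" by (simp add: sum_negf)
  also have "\<dots> \<le> \<epsilon> * (real n)\<^sup>2 + \<epsilon> * (real n)\<^sup>2"
  proof -
    have "?P \<subseteq> {1..n}" "?N \<subseteq> {1..n}" by auto
    from this[THEN S] show ?thesis by linarith
  qed
  also have "\<dots> = 2 * \<epsilon> * (real n)\<^sup>2" by simp
  also have "(\<Sum>v=1..n. \<bar>r v\<bar>) = (\<Sum>v=1..n. \<bar>real (edge_degree F v) - (\<Sum>x\<in>{1..n} - {v}. p {v, x})\<bar>)"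
    using r by (intro sum.cong) auto
  finally show ?thesis .
qed

text \<open>The missing term at \<open>v\<close> accounts for 1, the Riemann sum for
  \<open>g 0 - g 1\<close>. The bound does not grow with \<open>n\<close>, so the errors of all
  vertices together are only linear in \<open>n\<close>.\<close>

lemma expected_degree_error:
  assumes g: "antimono_on {0..1} g" and sol: "solves_limit_equation f g" and v: "v \<in> {1..n}"
  shows "\<bar>(\<Sum>x\<in>{1..n} - {v}. edge_prob g n {v, x}) - real n * f (real v / real n)\<bar> \<le> 1 + (g 0 - g 1)"
proof -
  have n: "n \<ge> 1" using v by auto
  let ?s = "g (real v / real n)" and ?c = "\<lambda>y. real (cell n y) / real n"
  note gm = measurable_antimono_unit[OF g]
  note c = integral_cell[OF n, of "\<lambda>x. grid_prob g n v x"]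
  note e = antimono_cell_error[OF g n]
  have "\<bar>(\<integral>y. logistic (?s + g (?c y)) \<partial>\<U>) - (\<integral>y. logistic (?s + g y) \<partial>\<U>)\<bar> =
      \<bar>\<integral>y. logistic (?s + g (?c y)) - logistic (?s + g y) \<partial>\<U>\<bar>"
    by (simp only: Bochner_Integration.integral_diff[OF c(2) logistic_mean_integrable[OF gm]])
  also have "\<dots> \<le> (\<integral>y. \<bar>logistic (?s + g (?c y)) - logistic (?s + g y)\<bar> \<partial>\<U>)"
    by (rule integral_abs_bound)
  also have "\<dots> \<le> (\<integral>y. \<bar>g (?c y) - g y\<bar> \<partial>\<U>)"
  proof (rule integral_mono[OF _ e(2)])
    show "integrable \<U> (\<lambda>y. \<bar>logistic (?s + g (?c y)) - logistic (?s + g y)\<bar>)"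
      by (intro integrable_abs Bochner_Integration.integrable_diff c(2) logistic_mean_integrable gm)
    show "\<bar>logistic (?s + g (?c y)) - logistic (?s + g y)\<bar> \<le> \<bar>g (?c y) - g y\<bar>" for y
      using logistic_lipschitz[of "?s + g (?c y)" "?s + g y"] by simp
  qed
  also have "\<dots> \<le> (g 0 - g 1) / real n" by (rule e(1))
  finally have "\<bar>(1 / real n) * (\<Sum>x=1..n. grid_prob g n v x) - logistic_mean g ?s\<bar> \<le> (g 0 - g 1) / real n"
    unfolding c(1) logistic_mean_def .
  then have "real n * \<bar>(1 / real n) * (\<Sum>x=1..n. grid_prob g n v x) - logistic_mean g ?s\<bar> \<le> real n * ((g 0 - g 1) / real n)"
    by (intro mult_left_mono) auto
  also have "real n * \<bar>(1 / real n) * (\<Sum>x=1..n. grid_prob g n v x) - logistic_mean g ?s\<bar> =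
      \<bar>real n * ((1 / real n) * (\<Sum>x=1..n. grid_prob g n v x) - logistic_mean g ?s)\<bar>"
    by (simp add: abs_mult)
  also have "real n * ((1 / real n) * (\<Sum>x=1..n. grid_prob g n v x) - logistic_mean g ?s) =
      (\<Sum>x=1..n. grid_prob g n v x) - real n * logistic_mean g ?s"
    using n by (simp add: right_diff_distrib)
  also have "logistic_mean g ?s = f (real v / real n)"
    using sol grid_in_unit[OF v] by (simp add: solves_limit_equation_iff)
  finally have 1: "\<bar>(\<Sum>x=1..n. grid_prob g n v x) - real n * f (real v / real n)\<bar> \<le> g 0 - g 1"
    using n by simp
  have "(\<Sum>x=1..n. grid_prob g n v x) = grid_prob g n v v + (\<Sum>x\<in>{1..n} - {v}. grid_prob g n v x)"
    using v by (intro sum.remove) auto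
  also have "(\<Sum>x\<in>{1..n} - {v}. grid_prob g n v x) = (\<Sum>x\<in>{1..n} - {v}. edge_prob g n {v, x})"
    by (intro sum.cong) (auto simp: edge_prob_doubleton)
  finally show ?thesis
    using 1 logistic_ge_0[of "g (real v / real n) + g (real v / real n)"] logistic_le_1[of "g (real v / real n) + g (real v / real n)"]
    by linarith
qed

lemma limit_function_bounds:
  assumes g: "antimono_on {0..1} g" and sol: "solves_limit_equation f g" and x: "x \<in> {0..1}"
  shows "logistic (- (2 * (\<bar>g 0\<bar> + \<bar>g 1\<bar>))) \<le> f x" "f x \<le> 1 - logistic (- (2 * (\<bar>g 0\<bar> + \<bar>g 1\<bar>)))"
proof -
  let ?C = "2 * (\<bar>g 0\<bar> + \<bar>g 1\<bar>)"
  note int = logistic_mean_integrable[OF measurable_antimono_unit[OF g], of "g x"]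
  have b: "- ?C \<le> g x + g y" "g x + g y \<le> ?C" if "y \<in> {0..1}" for y
  proof -
    note x1 = antimono_unit_bounds(3)[OF g x] and y1 = antimono_unit_bounds(3)[OF g that]
    show "- ?C \<le> g x + g y" using abs_le_D2[OF x1] abs_le_D2[OF y1] by simp
    show "g x + g y \<le> ?C" using abs_le_D1[OF x1] abs_le_D1[OF y1] by simp
  qed
  have "(\<integral>y. logistic (- ?C) \<partial>\<U>) \<le> logistic_mean g (g x)" "logistic_mean g (g x) \<le> (\<integral>y. logistic ?C \<partial>\<U>)"
    unfolding logistic_mean_def
    by (rule integral_mono[OF _ int] integral_mono[OF int]; use b in \<open>simp add: logistic_mono\<close>)+
  then show "logistic (- ?C) \<le> f x" "f x \<le> 1 - logistic (- ?C)"
    using sol x U.prob_space logistic_minus[of ?C] by (auto simp: solves_limit_equation_iff)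
qed

section \<open>From typical graphs to the prescribed degrees\<close>

definition scaling_error :: "(nat \<Rightarrow> nat \<Rightarrow> nat) \<Rightarrow> (real \<Rightarrow> real) \<Rightarrow> nat \<Rightarrow> real" where
  "scaling_error d f n = \<bar>real (d n 1) / real n - f 0\<bar> + \<bar>real (d n n) / real n - f 1\<bar>
        + (1 / real n) * (\<Sum>i=1..n. \<bar>real (d n i) / real n - f (real i / real n)\<bar>)"

lemma scaling_error_bounds:
  assumes n: "n \<ge> 1"
  shows "(\<Sum>i=1..n. \<bar>real (d n i) - real n * f (real i / real n)\<bar>) \<le> (real n)\<^sup>2 * scaling_error d f n"
    and "real (d n 1) \<le> real n * (f 0 + scaling_error d f n)"
    and "real n * (f 1 - scaling_error d f n) \<le> real (d n n)"
proof -
  let ?S = "\<Sum>i=1..n. \<bar>real (d n i) / real n - f (real i / real n)\<bar>"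
  have S: "0 \<le> (1 / real n) * ?S" by (intro mult_nonneg_nonneg sum_nonneg) auto
  have "(\<Sum>i=1..n. \<bar>real (d n i) - real n * f (real i / real n)\<bar>) = (\<Sum>i=1..n. real n * \<bar>real (d n i) / real n - f (real i / real n)\<bar>)"
  proof (rule sum.cong[OF refl])
    fix i
    have "real (d n i) - real n * f (real i / real n) = real n * (real (d n i) / real n - f (real i / real n))"
      using n by (simp add: right_diff_distrib)
    then show "\<bar>real (d n i) - real n * f (real i / real n)\<bar> = real n * \<bar>real (d n i) / real n - f (real i / real n)\<bar>"
      by (simp add: abs_mult)
  qed
  also have "\<dots> = (real n)\<^sup>2 * ((1 / real n) * ?S)"
    using n by (simp add: sum_distrib_left power2_eq_square)
  also have "\<dots> \<le> (real n)\<^sup>2 * scaling_error d f n"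
    unfolding scaling_error_def by (intro mult_left_mono) auto
  finally show "(\<Sum>i=1..n. \<bar>real (d n i) - real n * f (real i / real n)\<bar>) \<le> (real n)\<^sup>2 * scaling_error d f n" .
  have "real (d n 1) / real n \<le> f 0 + scaling_error d f n" "f 1 - scaling_error d f n \<le> real (d n n) / real n"
    using S unfolding scaling_error_def by linarith+
  then show "real (d n 1) \<le> real n * (f 0 + scaling_error d f n)"
    "real n * (f 1 - scaling_error d f n) \<le> real (d n n)"
    using n by (simp_all add: field_simps)
qed

lemma even_sum_graphical:
  assumes "graphs_with_degrees n d \<noteq> {}"
  shows "even (\<Sum>v=1..n. int (d v))"
proof -
  obtain F where F: "F \<in> degree_class n d" using assms by (auto simp: graphs_with_degrees_eq)
  then have "(\<Sum>v=1..n. int (d v)) = (\<Sum>v=1..n. int (edge_degree F v))"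
    by (intro sum.cong) (auto simp: degree_class_def)
  then show ?thesis using handshake[of F n] F by (simp add: degree_class_def)
qed

text \<open>Cut closeness makes a typical graph rich and its total degree error small, and
  \<open>degree_close\<close> keeps its degrees away from the extremes. These are the hypotheses of
  \<open>correct_degrees\<close>, with the typical graph itself as base.\<close>

lemma typical_graph_near_degree_class:
  fixes d :: "nat \<Rightarrow> nat \<Rightarrow> nat" and g :: "real \<Rightarrow> real"
  defines "\<delta> \<equiv> logistic (- (2 * (\<bar>g 0\<bar> + \<bar>g 1\<bar>)))"
  assumes g: "antimono_on {0..1} g" and sol: "solves_limit_equation f g"
    and d: "ordered_degree_sequence n (d n)" and n: "n \<ge> 3"
    and F: "F \<subseteq> all_edges n" and close: "cut_close n (edge_prob g n) \<epsilon> F"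
    and dclose: "degree_close n (edge_prob g n) (\<delta> / 4) F"
    and s: "scaling_error d f n \<le> \<delta> / 4" and big: "3 \<le> \<delta> * real n / 4"
    and K1: "2 * real K < \<delta> * ((\<delta> * real n / 4)\<^sup>2 - real n) - \<epsilon> * (real n)\<^sup>2"
    and K2: "9 * (2 * \<epsilon> * (real n)\<^sup>2 + (real n + real n * (g 0 - g 1)) + (real n)\<^sup>2 * scaling_error d f n) \<le> real K"
  shows "\<exists>F'\<in>degree_class n (d n). edit_dist F F' \<le> K"
proof -
  have n1: "n \<ge> 1" using n by simp
  have \<delta>: "0 < \<delta>" and \<delta>1: "\<delta> \<le> 1" by (simp_all add: \<delta>_def)
  \<comment> \<open>Edge probabilities lie between \<delta> and \<open>1 - \<delta>\<close>, so
    expected degrees keep a distance of about \<open>\<delta> * n\<close> from 0 and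
    \<open>n\<close>. A quarter of it is lost to deviations, half serves as \<open>m\<close>, and
    the last quarter absorbs additive constants.\<close>
  define m where "m = nat \<lfloor>\<delta> * real n / 2\<rfloor>"
  have m: "real m \<le> \<delta> * real n / 2" "\<delta> * real n / 2 - 1 < real m"
  proof -
    have "0 \<le> \<delta> * real n / 2" using \<delta> by simp
    then show "real m \<le> \<delta> * real n / 2" "\<delta> * real n / 2 - 1 < real m"
      unfolding m_def by linarith+
  qed
  have mono: "antimono_on {1..n} (d n)" and gr: "graphs_with_degrees n (d n) \<noteq> {}"
    using d by (auto simp: ordered_degree_sequence_def)
  have p: "\<delta> \<le> edge_prob g n e \<and> edge_prob g n e \<le> 1 - \<delta>" if "e \<in> all_edges n" for e
    unfolding \<delta>_def using edge_prob_bounds[OF g that] by simp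
  have "\<delta> * real n / 4 \<le> real m" using m big by linarith
  then have "(\<delta> * real n / 4)\<^sup>2 \<le> (real m)\<^sup>2" using \<delta> by (intro power_mono) auto
  then have "\<delta> * ((\<delta> * real n / 4)\<^sup>2 - real n) \<le> \<delta> * ((real m)\<^sup>2 - real n)"
    using \<delta> by (intro mult_left_mono) auto
  then have "2 * real K < \<delta> * ((real m)\<^sup>2 - real n) - \<epsilon> * (real n)\<^sup>2" using K1 by linarith
  note rich = edge_rich_of_cut_close[OF F close p _ this]
  let ?ex = "\<lambda>v. \<Sum>x\<in>{1..n} - {v}. edge_prob g n {v, x}"
  have range: "int m + 2 \<le> int k \<and> int k \<le> int n - 3 - int m"
    if "3 / 4 * \<delta> * real n - \<delta> \<le> real k" "real k \<le> real n - 3 / 4 * \<delta> * real n" for k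
  proof -
    have "real m + 2 \<le> real k" "real k \<le> real n - 3 - real m" using that m big \<delta>1 by linarith+
    then show ?thesis by linarith
  qed
  have degF: "int m + 2 \<le> int (edge_degree F v) \<and> int (edge_degree F v) \<le> int n - 3 - int m" if v: "v \<in> {1..n}" for v
  proof (rule range)
    have E: "{v, x} \<in> all_edges n" if "x \<in> {1..n} - {v}" for x
      using that v by (auto simp: doubleton_in_all_edges)
    have card: "real (card ({1..n} - {v})) = real n - 1" using v n1 by (simp add: of_nat_diff)
    have "(real n - 1) * \<delta> \<le> ?ex v"
      using sum_bounded_below[of "{1..n} - {v}" \<delta> "\<lambda>x. edge_prob g n {v, x}"] p[OF E] unfolding card by simp
    moreover have "(real n - 1) * \<delta> = \<delta> * real n - \<delta>" by (simp add: algebra_simps)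
    ultimately have low: "\<delta> * real n - \<delta> \<le> ?ex v" by (simp only:)
    have "?ex v \<le> (real n - 1) * (1 - \<delta>)"
      using sum_bounded_above[of "{1..n} - {v}" "\<lambda>x. edge_prob g n {v, x}" "1 - \<delta>"] p[OF E] unfolding card by simp
    also have "(real n - 1) * (1 - \<delta>) = real n - 1 - \<delta> * real n + \<delta>" by (simp add: algebra_simps)
    finally have up: "?ex v \<le> real n - 1 - \<delta> * real n + \<delta>" .
    have dev: "\<bar>real (edge_degree F v) - ?ex v\<bar> \<le> \<delta> * real n / 4"
      using bspec[OF dclose[unfolded degree_close_def] v]
      by (simp only: cut_deviation_vertex[OF F v] times_divide_eq_left)
    have gen: "3 / 4 * t - \<delta> \<le> D" "D \<le> N - 3 / 4 * t"
      if "t - \<delta> \<le> X" "X \<le> N - 1 - t + \<delta>" "\<bar>D - X\<bar> \<le> t / 4" for D X N t :: real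
      using that \<delta>1 by linarith+
    show "3 / 4 * \<delta> * real n - \<delta> \<le> real (edge_degree F v)" "real (edge_degree F v) \<le> real n - 3 / 4 * \<delta> * real n"
      using gen[OF low up dev] by (simp_all only: mult.assoc)
  qed
  have degd: "int m + 2 \<le> int (d n v) \<and> int (d n v) \<le> int n - 3 - int m" if v: "v \<in> {1..n}" for v
  proof (rule range)
    have "d n n \<le> d n v" "d n v \<le> d n 1" using v by (auto intro: monotone_onD[OF mono])
    moreover have "real (d n 1) \<le> real n * (1 - \<delta> + \<delta> / 4)"
    proof -
      have "f 0 + scaling_error d f n \<le> 1 - \<delta> + \<delta> / 4"
        using limit_function_bounds(2)[OF g sol, of 0] s unfolding \<delta>_def by simp
      then show ?thesis using scaling_error_bounds(2)[OF n1, of d f] by (meson mult_left_mono of_nat_0_le_iff order_trans)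
    qed
    moreover have "real n * (\<delta> - \<delta> / 4) \<le> real (d n n)"
    proof -
      have "\<delta> - \<delta> / 4 \<le> f 1 - scaling_error d f n"
        using limit_function_bounds(1)[OF g sol, of 1] s unfolding \<delta>_def by simp
      then show ?thesis using scaling_error_bounds(3)[OF n1, of f d] by (meson mult_left_mono of_nat_0_le_iff order_trans)
    qed
    ultimately show "3 / 4 * \<delta> * real n - \<delta> \<le> real (d n v)" "real (d n v) \<le> real n - 3 / 4 * \<delta> * real n"
      using \<delta> by (simp_all add: algebra_simps)
  qed
  have "(\<Sum>v=1..n. \<bar>real (edge_degree F v) - real (d n v)\<bar>) \<le>
      (\<Sum>v=1..n. \<bar>real (edge_degree F v) - ?ex v\<bar> + (1 + (g 0 - g 1)) + \<bar>real (d n v) - real n * f (real v / real n)\<bar>)"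
  proof (rule sum_mono)
    fix v assume "v \<in> {1..n}"
    from expected_degree_error[OF g sol this]
    show "\<bar>real (edge_degree F v) - real (d n v)\<bar> \<le>
        \<bar>real (edge_degree F v) - ?ex v\<bar> + (1 + (g 0 - g 1)) + \<bar>real (d n v) - real n * f (real v / real n)\<bar>"
      by linarith
  qed
  also have "\<dots> = (\<Sum>v=1..n. \<bar>real (edge_degree F v) - ?ex v\<bar>) + (real n + real n * (g 0 - g 1)) +
      (\<Sum>v=1..n. \<bar>real (d n v) - real n * f (real v / real n)\<bar>)"
    by (simp only: sum.distrib sum_constant card_atLeastAtMost) (simp add: distrib_left)
  also have "\<dots> \<le> 2 * \<epsilon> * (real n)\<^sup>2 + (real n + real n * (g 0 - g 1)) + (real n)\<^sup>2 * scaling_error d f n"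
    by (intro add_mono sum_abs_degree_deviation[OF F close] scaling_error_bounds(1)[OF n1] order_refl)
  finally have "9 * (\<Sum>v=1..n. \<bar>real (edge_degree F v) - real (d n v)\<bar>) \<le>
      9 * (2 * \<epsilon> * (real n)\<^sup>2 + (real n + real n * (g 0 - g 1)) + (real n)\<^sup>2 * scaling_error d f n)"
    by (rule mult_left_mono) simp
  from this K2 have "9 * (\<Sum>v=1..n. \<bar>real (edge_degree F v) - real (d n v)\<bar>) \<le> real K"
    by (rule order_trans)
  moreover have "(\<Sum>v=1..n. \<bar>real (edge_degree F v) - real (d n v)\<bar>) = real_of_int (\<Sum>v=1..n. \<bar>int (edge_degree F v) - int (d n v)\<bar>)"
    by simp
  ultimately have "9 * (\<Sum>v=1..n. \<bar>int (edge_degree F v) - int (d n v)\<bar>) \<le> int K" by linarith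
  then have near: "int (edit_dist F F) + 9 * (\<Sum>v=1..n. \<bar>int (edge_degree F v) - int (d n v)\<bar>) \<le> int K" by simp
  obtain F' where "F' \<subseteq> all_edges n" "\<forall>v\<in>{1..n}. edge_degree F' v = d n v" "edit_dist F' F \<le> K"
    using correct_degrees[OF F rich n degd even_sum_graphical[OF gr] F degF near] \<delta> by auto
  then show ?thesis
    by (intro bexI[of _ F']) (auto simp: degree_class_def edit_dist_commute)
qed

text \<open>Typical graphs carry at least half of the total weight, and each lies within
  \<open>K\<close> edits of the class. By \<open>gibbs_weight_neighbourhood\<close> the class then
  has at least half the inverse of a factor whose exponent is at most
  \<open>\<kappa> / 2 * n^2\<close>.\<close>

lemma degree_class_weight_lower:
  fixes d :: "nat \<Rightarrow> nat \<Rightarrow> nat"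
  assumes g: "antimono_on {0..1} g" and sol: "solves_limit_equation f g"
    and d: "\<And>n. n \<ge> 1 \<Longrightarrow> ordered_degree_sequence n (d n)" and lim: "scaling_limit d f" and \<kappa>: "0 < \<kappa>"
  shows "eventually (\<lambda>n. exp (- \<kappa> * (real n)\<^sup>2) \<le>
    (\<Sum>F\<in>degree_class n (d n). gibbs_weight (edge_potential g n) (all_edges n) F)) sequentially"
proof -
  define C where "C = 2 * (\<bar>g 0\<bar> + \<bar>g 1\<bar>)"
  define \<delta> where "\<delta> = logistic (- C)"
  have C: "0 \<le> C" and \<delta>: "0 < \<delta>" "\<delta> \<le> 1" by (simp_all add: C_def \<delta>_def)
  \<comment> \<open>With \<open>x \<le> \<kappa> / 4\<close> the factor
    \<open>(1 + x) ^ card E\<close> is at most \<open>exp (\<kappa> / 4 * n^2)\<close>.\<close>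
  define x where "x = min 1 (\<kappa> / 4)"
  have x: "0 < x" "x \<le> 1" "x \<le> \<kappa> / 4" using \<kappa> by (auto simp: x_def)
  define L where "L = ln (1 / x)"
  have L: "0 \<le> L" "1 / x = exp L" using x by (auto simp: L_def)
  \<comment> \<open>The number of edits will be about \<open>\<rho> * n^2\<close>. The first bound
    keeps \<open>exp (C * K) * (1 / x) ^ K\<close> below \<open>exp (\<kappa> / 4 * n^2)\<close>.
    The second preserves richness, where \<open>2 * K\<close>, the cut error and
    \<open>\<delta> * n\<close> together must stay below
    \<open>\<delta> ^ 3 / 16 * n^2\<close>.\<close>
  define \<rho> where "\<rho> = min (\<kappa> / (4 * (C + L + 1))) (\<delta> ^ 3 / 128)"
  have CL: "0 < C + L + 1" using C L by simp
  have \<rho>: "0 < \<rho>" "\<rho> \<le> \<kappa> / (4 * (C + L + 1))" "\<rho> \<le> \<delta> ^ 3 / 128"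
  proof -
    show "0 < \<rho>" using \<kappa> CL \<delta> by (simp add: \<rho>_def)
  qed (unfold \<rho>_def, rule min.cobounded1, rule min.cobounded2)
  \<comment> \<open>Then \<open>9 * 2 * \<epsilon> = \<rho> / 2\<close>, so degree deviations use
    half of the edits; a quarter each is left for the scaling error and for the terms linear in
    \<open>n\<close>.\<close>
  define \<epsilon> where "\<epsilon> = \<rho> / 36"
  have "\<delta> ^ 3 \<le> 1" using \<delta> by (intro power_le_one) auto
  then have \<epsilon>: "0 < \<epsilon>" "\<epsilon> \<le> 1" using \<rho> by (auto simp: \<epsilon>_def)
  have \<gamma>: "0 < \<delta> / 4" "\<delta> / 4 \<le> 1" using \<delta> by auto
  have s: "scaling_error d f \<longlonglongrightarrow> 0" using lim unfolding scaling_limit_def scaling_error_def .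
  have ev1: "eventually (\<lambda>n. scaling_error d f n < \<delta> / 4) sequentially"
    and ev2: "eventually (\<lambda>n. scaling_error d f n < \<rho> / 36) sequentially"
    by (rule order_tendstoD(2)[OF s], use \<delta> \<rho> in simp)+
  have ev3: "eventually (\<lambda>n. 3 \<le> \<delta> * real n / 4) sequentially" using \<delta>(1) by real_asymp
  \<comment> \<open>The additional 1 pays for rounding in \<open>K\<close>.\<close>
  have ev4: "eventually (\<lambda>n. 9 * (real n + real n * (g 0 - g 1)) + 1 \<le> \<rho> / 4 * (real n)\<^sup>2) sequentially"
    using \<rho>(1) by real_asymp
  have ev5: "eventually (\<lambda>n. \<delta> * real n < \<delta> ^ 3 / 32 * (real n)\<^sup>2) sequentially" using \<delta>(1) by real_asymp
  have ev6: "eventually (\<lambda>n. 2 * 4 ^ n * exp (- \<epsilon>\<^sup>2 * (real n)\<^sup>2 / 8) + 2 * real n * exp (- (\<delta> / 4)\<^sup>2 * real n / 8) \<le> 1 / 2) sequentially"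
    using \<epsilon>(1) \<gamma>(1) by real_asymp
  \<comment> \<open>One half of the exponent \<kappa> pays for the neighbourhood factor, the other
    half, through this bound, for the factor \<open>1 / 2\<close> from the typical graphs.\<close>
  have ev7: "eventually (\<lambda>n. exp (- \<kappa> / 2 * (real n)\<^sup>2) \<le> 1 / 2) sequentially" using \<kappa> by real_asymp
  show ?thesis
    using ev1 ev2 ev3 ev4 ev5 ev6 ev7 eventually_ge_at_top[of 3]
  proof eventually_elim
    case (elim n)
    let ?E = "all_edges n" and ?w = "gibbs_weight (edge_potential g n) (all_edges n)"
    let ?p = "edge_prob g n"
    have p: "?p = (\<lambda>e. logistic (edge_potential g n e))" by (simp add: edge_prob_def fun_eq_iff)
    define K where "K = nat \<lfloor>\<rho> * (real n)\<^sup>2\<rfloor>"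
    have "0 \<le> \<rho> * (real n)\<^sup>2" using \<rho>(1) by simp
    then have K: "real K \<le> \<rho> * (real n)\<^sup>2" "\<rho> * (real n)\<^sup>2 - 1 < real K" unfolding K_def by linarith+
    define \<A> where "\<A> = {F. F \<subseteq> ?E \<and> cut_close n ?p \<epsilon> F \<and> degree_close n ?p (\<delta> / 4) F}"
    note fin = finite_subset_family[OF finite_all_edges, of n]
    have "1 = (\<Sum>F\<in>Pow ?E. ?w F)" by (simp add: sum_gibbs_weight)
    also have "\<dots> = (\<Sum>F\<in>\<A> \<union> ({F. F \<subseteq> ?E \<and> \<not> cut_close n ?p \<epsilon> F} \<union> {F. F \<subseteq> ?E \<and> \<not> degree_close n ?p (\<delta> / 4) F}). ?w F)"
      unfolding \<A>_def by (intro sum.cong) auto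
    also have "\<dots> \<le> (\<Sum>F\<in>\<A>. ?w F) + ((\<Sum>F | F \<subseteq> ?E \<and> \<not> cut_close n ?p \<epsilon> F. ?w F) + (\<Sum>F | F \<subseteq> ?E \<and> \<not> degree_close n ?p (\<delta> / 4) F. ?w F))"
      unfolding \<A>_def
      by (intro order_trans[OF sum_Un_le] add_mono order_refl sum_Un_le fin finite_UnI less_imp_le[OF gibbs_weight_pos])
    also have "\<dots> \<le> (\<Sum>F\<in>\<A>. ?w F) + 1 / 2"
      using not_cut_close_weight[OF \<epsilon>, where n=n and \<theta>="edge_potential g n"]
        not_degree_close_weight[OF \<gamma>, where n=n and \<theta>="edge_potential g n"] elim(6)
      unfolding p by linarith
    finally have half: "1 / 2 \<le> (\<Sum>F\<in>\<A>. ?w F)" by simp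
    have K1: "2 * real K < \<delta> * ((\<delta> * real n / 4)\<^sup>2 - real n) - \<epsilon> * (real n)\<^sup>2"
    proof -
      have "\<epsilon> * (real n)\<^sup>2 + 2 * real K \<le> 3 * (\<rho> * (real n)\<^sup>2)"
        using K(1) \<rho>(1) by (simp add: \<epsilon>_def)
      also have "\<dots> \<le> 3 * (\<delta> ^ 3 / 128 * (real n)\<^sup>2)" using \<rho>(3) by (intro mult_left_mono mult_right_mono) auto
      finally have le: "\<epsilon> * (real n)\<^sup>2 + 2 * real K \<le> 3 * (\<delta> ^ 3 / 128 * (real n)\<^sup>2)" .
      define q where "q = \<delta> ^ 3 * (real n)\<^sup>2"
      have "0 \<le> q" "3 * (\<delta> ^ 3 / 128 * (real n)\<^sup>2) = 3 / 128 * q" "\<delta> ^ 3 / 32 * (real n)\<^sup>2 = q / 32"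
          "\<delta> ^ 3 / 16 * (real n)\<^sup>2 = q / 16"
        using \<delta> by (simp_all add: q_def)
      then have "\<epsilon> * (real n)\<^sup>2 + 2 * real K + \<delta> * real n < \<delta> ^ 3 / 16 * (real n)\<^sup>2"
        using elim(5) le by linarith
      also have "\<delta> ^ 3 / 16 * (real n)\<^sup>2 = \<delta> * (\<delta> * real n / 4)\<^sup>2" by (simp add: power2_eq_square power3_eq_cube)
      finally show ?thesis by (simp add: right_diff_distrib)
    qed
    have K2: "9 * (2 * \<epsilon> * (real n)\<^sup>2 + (real n + real n * (g 0 - g 1)) + (real n)\<^sup>2 * scaling_error d f n) \<le> real K"
    proof -
      have gen: "9 * (t1 + t2 + t3) \<le> k"
        if "9 * t1 = q / 2" "9 * t2 + 1 \<le> q / 4" "9 * t3 \<le> q / 4" "q - 1 < k" for t1 t2 t3 q k :: real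
        using that by simp
      have "(real n)\<^sup>2 * scaling_error d f n \<le> (real n)\<^sup>2 * (\<rho> / 36)" using elim(2) by (intro mult_left_mono) auto
      then have 3: "9 * ((real n)\<^sup>2 * scaling_error d f n) \<le> \<rho> * (real n)\<^sup>2 / 4" by (simp add: mult.commute)
      have 1: "9 * (2 * \<epsilon> * (real n)\<^sup>2) = \<rho> * (real n)\<^sup>2 / 2" by (simp add: \<epsilon>_def)
      have 2: "9 * (real n + real n * (g 0 - g 1)) + 1 \<le> \<rho> * (real n)\<^sup>2 / 4"
        using elim(4) by (simp only: times_divide_eq_left)
      show ?thesis by (rule gen[OF 1 2 3 K(2)])
    qed
    have n1: "1 \<le> n" using elim(8) by simp
    have near: "\<exists>F'\<in>degree_class n (d n). edit_dist F F' \<le> K" if "F \<in> \<A>" for F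
    proof (rule typical_graph_near_degree_class[where d=d and n=n, OF g sol d[OF n1] elim(8), folded C_def, folded \<delta>_def])
      show "F \<subseteq> all_edges n" "cut_close n ?p \<epsilon> F" "degree_close n ?p (\<delta> / 4) F"
        using that by (simp_all only: \<A>_def mem_Collect_eq)
      show "scaling_error d f n \<le> \<delta> / 4" using elim(1) by (rule less_imp_le)
    qed (rule elim(3) K1 K2)+
    have "1 / 2 \<le> exp (C * real K) * (1 / x) ^ K * (1 + x) ^ card ?E * (\<Sum>F\<in>degree_class n (d n). ?w F)"
    proof (rule order_trans[OF half gibbs_weight_neighbourhood[OF _ _ _ _ C near x(1,2)]])
      show "\<A> \<subseteq> Pow ?E" "degree_class n (d n) \<subseteq> Pow ?E" by (auto simp: \<A>_def degree_class_def)
      show "\<bar>edge_potential g n e\<bar> \<le> C" if "e \<in> ?E" for e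
        unfolding C_def by (rule edge_potential_bound[OF g that])
    qed auto
    also have "\<dots> \<le> exp (\<kappa> / 2 * (real n)\<^sup>2) * (\<Sum>F\<in>degree_class n (d n). ?w F)"
    proof (rule mult_right_mono)
      have "exp (C * real K) * (1 / x) ^ K = exp ((C + L) * real K)"
        unfolding L(2) by (simp add: exp_of_nat_mult[symmetric] exp_add[symmetric] algebra_simps)
      also have "(C + L) * real K \<le> (C + L + 1) * (\<rho> * (real n)\<^sup>2)"
        using K(1) C L by (intro mult_mono) auto
      also have "\<dots> \<le> (C + L + 1) * (\<kappa> / (4 * (C + L + 1)) * (real n)\<^sup>2)"
        using \<rho>(2) CL by (intro mult_left_mono mult_right_mono) auto
      also have "\<dots> = \<kappa> / 4 * (real n)\<^sup>2"
      proof -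
        have "c * (\<kappa> / (4 * c) * N) = \<kappa> / 4 * N" if "0 < c" for c N :: real
          using that by simp
        then show ?thesis using CL by blast
      qed
      finally have 1: "exp (C * real K) * (1 / x) ^ K \<le> exp (\<kappa> / 4 * (real n)\<^sup>2)" by simp
      have "(1 + x) ^ card ?E \<le> exp x ^ card ?E"
        using x by (intro power_mono) (auto simp: exp_ge_add_one_self)
      also have "\<dots> = exp (real (card ?E) * x)" by (simp add: exp_of_nat_mult)
      also have "real (card ?E) * x \<le> (real n)\<^sup>2 * (\<kappa> / 4)"
      proof (rule mult_mono)
        show "real (card ?E) \<le> (real n)\<^sup>2"
          using card_all_edges_le[of n] by (metis of_nat_le_iff of_nat_power)
      qed (use x in auto)
      finally have 2: "(1 + x) ^ card ?E \<le> exp (\<kappa> / 4 * (real n)\<^sup>2)" by (simp add: mult.commute)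
      have "exp (C * real K) * (1 / x) ^ K * (1 + x) ^ card ?E \<le> exp (\<kappa> / 4 * (real n)\<^sup>2) * exp (\<kappa> / 4 * (real n)\<^sup>2)"
        using 1 2 x by (intro mult_mono) auto
      also have "\<dots> = exp (\<kappa> / 2 * (real n)\<^sup>2)" by (simp add: exp_add[symmetric])
      finally show "exp (C * real K) * (1 / x) ^ K * (1 + x) ^ card ?E \<le> exp (\<kappa> / 2 * (real n)\<^sup>2)" .
    qed (auto intro!: sum_nonneg less_imp_le[OF gibbs_weight_pos])
    finally have low: "1 / 2 \<le> exp (\<kappa> / 2 * (real n)\<^sup>2) * (\<Sum>F\<in>degree_class n (d n). ?w F)" .
    have "exp (- \<kappa> * (real n)\<^sup>2) = exp (- \<kappa> / 2 * (real n)\<^sup>2) * exp (- \<kappa> / 2 * (real n)\<^sup>2)"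
      by (simp add: exp_add[symmetric])
    also have "\<dots> \<le> exp (- \<kappa> / 2 * (real n)\<^sup>2) * (1 / 2)"
      using elim(7) by (intro mult_left_mono) auto
    also have "\<dots> \<le> exp (- \<kappa> / 2 * (real n)\<^sup>2) * (exp (\<kappa> / 2 * (real n)\<^sup>2) * (\<Sum>F\<in>degree_class n (d n). ?w F))"
      using low by (intro mult_left_mono) auto
    also have "\<dots> = (\<Sum>F\<in>degree_class n (d n). ?w F)"
      by (simp add: mult.assoc[symmetric] exp_add[symmetric])
    finally show ?case .
  qed
qed

section \<open>Uniform random graphs\<close>

text \<open>Since \<open>w\<close> is constant on the degree class, the proportion of far graphs is
  a ratio of weights, and its numerator is at most the weight of all far graphs with any
  degrees.\<close>

lemma uniform_random_graph_prob:
  fixes g :: "real \<Rightarrow> real"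
  assumes G: "uniform_random_graph M n d G" and D: "degree_class n d \<noteq> {}" and \<epsilon>: "0 < \<epsilon>" "\<epsilon> \<le> 1"
  defines "w \<equiv> gibbs_weight (edge_potential g n) (all_edges n)"
  shows "{\<omega> \<in> space M. \<not> cut_close n (edge_prob g n) \<epsilon> (edges (G \<omega>))} \<in> sets M"
    and "measure M {\<omega> \<in> space M. \<not> cut_close n (edge_prob g n) \<epsilon> (edges (G \<omega>))} \<le>
      2 * 4 ^ n * exp (- \<epsilon>\<^sup>2 * (real n)\<^sup>2 / 8) / (\<Sum>F\<in>degree_class n d. w F)"
proof -
  let ?D = "graphs_with_degrees n d" and ?D' = "degree_class n d"
  let ?far = "\<lambda>F. \<not> cut_close n (edge_prob g n) \<epsilon> F"
  let ?S = "{X \<in> ?D. ?far (edges X)}" and ?S' = "{F \<in> ?D'. ?far F}"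
  have Gm: "G \<in> measurable M (count_space ?D)" and Gd: "distr M (count_space ?D) G = uniform_count_measure ?D"
    using G by (auto simp: uniform_random_graph_def)
  have inj: "inj_on (Pair {1..n}) A" for A :: "nat set set set" by (auto simp: inj_on_def)
  have S: "?S = Pair {1..n} ` ?S'" unfolding graphs_with_degrees_eq by auto
  have pre: "{\<omega> \<in> space M. ?far (edges (G \<omega>))} = G -` ?S \<inter> space M"
    using measurable_space[OF Gm] by auto
  have Ss: "?S \<in> sets (count_space ?D)" by auto
  show "{\<omega> \<in> space M. ?far (edges (G \<omega>))} \<in> sets M"
    unfolding pre by (rule measurable_sets[OF Gm Ss])
  have finD: "finite ?D" unfolding graphs_with_degrees_eq by (intro finite_imageI finite_degree_class)
  obtain F0 where F0: "F0 \<in> ?D'" using D by blast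
  have wc: "w F = w F0" if "F \<in> ?D'" for F
    unfolding w_def by (rule gibbs_weight_degree_class[OF that F0])
  have w0: "0 < w F0" unfolding w_def by (rule gibbs_weight_pos)
  have "measure M {\<omega> \<in> space M. ?far (edges (G \<omega>))} = measure (uniform_count_measure ?D) ?S"
    unfolding pre Gd[symmetric] by (rule measure_distr[OF Gm Ss, symmetric])
  also have "\<dots> = real (card ?S) / real (card ?D)"
    by (rule measure_uniform_count_measure[OF finD]) auto
  also have "\<dots> = real (card ?S') / real (card ?D')"
  proof -
    have "card ?S = card ?S'" unfolding S by (rule card_image[OF inj])
    moreover have "card ?D = card ?D'" unfolding graphs_with_degrees_eq by (rule card_image[OF inj])
    ultimately show ?thesis by (simp only:)
  qed
  also have "\<dots> = (\<Sum>F\<in>?S'. w F) / (\<Sum>F\<in>?D'. w F)"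
    using wc w0 by simp
  also have "\<dots> \<le> (\<Sum>F | F \<subseteq> all_edges n \<and> ?far F. w F) / (\<Sum>F\<in>?D'. w F)"
  proof (rule divide_right_mono)
    show "(\<Sum>F\<in>?S'. w F) \<le> (\<Sum>F | F \<subseteq> all_edges n \<and> ?far F. w F)"
    proof (rule sum_mono2)
      show "finite {F. F \<subseteq> all_edges n \<and> ?far F}"
        by (rule finite_subset_family) simp
    qed (auto simp: degree_class_def w_def less_imp_le[OF gibbs_weight_pos])
  qed (auto intro!: sum_nonneg simp: w_def less_imp_le[OF gibbs_weight_pos])
  also have "\<dots> \<le> 2 * 4 ^ n * exp (- \<epsilon>\<^sup>2 * (real n)\<^sup>2 / 8) / (\<Sum>F\<in>?D'. w F)"
  proof (rule divide_right_mono)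
    show "(\<Sum>F | F \<subseteq> all_edges n \<and> ?far F. w F) \<le> 2 * 4 ^ n * exp (- \<epsilon>\<^sup>2 * (real n)\<^sup>2 / 8)"
      using not_cut_close_weight[OF \<epsilon>, where n=n and \<theta>="edge_potential g n"] unfolding w_def edge_prob_def .
  qed (auto intro!: sum_nonneg simp: w_def less_imp_le[OF gibbs_weight_pos])
  finally show "measure M {\<omega> \<in> space M. ?far (edges (G \<omega>))} \<le>
      2 * 4 ^ n * exp (- \<epsilon>\<^sup>2 * (real n)\<^sup>2 / 8) / (\<Sum>F\<in>?D'. w F)" .
qed

text \<open>The lower bound with \<open>\<kappa> = \<epsilon>^2 / 16\<close> costs half of the
  deviation rate \<open>\<epsilon>^2 / 8\<close>, and the remaining
  \<open>exp (- \<epsilon>^2 * n^2 / 16)\<close> beats \<open>4 ^ n\<close>. The convergent half of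
  Borel-Cantelli then covers every joint law of the graphs.\<close>

lemma AE_eventually_cut_close:
  fixes d :: "nat \<Rightarrow> nat \<Rightarrow> nat"
  assumes M: "prob_space M" and g: "antimono_on {0..1} g" and sol: "solves_limit_equation f g"
    and d: "\<And>n. n \<ge> 1 \<Longrightarrow> ordered_degree_sequence n (d n)" and lim: "scaling_limit d f"
    and G: "\<And>n. n \<ge> 1 \<Longrightarrow> uniform_random_graph M n (d n) (G n)" and \<epsilon>: "0 < \<epsilon>" "\<epsilon> \<le> 1"
  shows "AE \<omega> in M. eventually (\<lambda>n. cut_close n (edge_prob g n) \<epsilon> (edges (G n \<omega>))) sequentially"
proof -
  interpret M: prob_space M by (rule M)
  \<comment> \<open>The index is shifted because the assumptions on the graphs begin at
    \<open>n = 1\<close>.\<close>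
  define A where "A n = {\<omega> \<in> space M. \<not> cut_close (Suc n) (edge_prob g (Suc n)) \<epsilon> (edges (G (Suc n) \<omega>))}" for n
  have ne: "degree_class (Suc n) (d (Suc n)) \<noteq> {}" for n
    using d[of "Suc n"] by (auto simp: ordered_degree_sequence_def graphs_with_degrees_eq)
  have sets: "A n \<in> sets M" for n
    unfolding A_def by (rule uniform_random_graph_prob(1)[OF G ne \<epsilon>]) simp
  have "0 < \<epsilon>\<^sup>2 / 16" using \<epsilon> by simp
  from degree_class_weight_lower[OF g sol d lim this]
  have low: "eventually (\<lambda>n. exp (- (\<epsilon>\<^sup>2 / 16) * (real n)\<^sup>2) \<le>
    (\<Sum>F\<in>degree_class n (d n). gibbs_weight (edge_potential g n) (all_edges n) F)) sequentially" .
  have geo: "eventually (\<lambda>n. 2 * 4 ^ n * exp (- \<epsilon>\<^sup>2 * (real n)\<^sup>2 / 16) \<le> (1 / 2) ^ n) sequentially"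
    using \<epsilon>(1) by real_asymp
  have "eventually (\<lambda>n. measure M {\<omega> \<in> space M. \<not> cut_close n (edge_prob g n) \<epsilon> (edges (G n \<omega>))} \<le> (1 / 2) ^ n) sequentially"
    using low geo eventually_ge_at_top[of 1]
  proof eventually_elim
    case (elim n)
    let ?W = "\<Sum>F\<in>degree_class n (d n). gibbs_weight (edge_potential g n) (all_edges n) F"
    have "degree_class n (d n) \<noteq> {}" using ne[of "n - 1"] elim(3) by simp
    note le = uniform_random_graph_prob(2)[OF G[OF elim(3)] this \<epsilon>, of g]
    also have "2 * 4 ^ n * exp (- \<epsilon>\<^sup>2 * (real n)\<^sup>2 / 8) / ?W \<le>
        2 * 4 ^ n * exp (- \<epsilon>\<^sup>2 * (real n)\<^sup>2 / 8) / exp (- (\<epsilon>\<^sup>2 / 16) * (real n)\<^sup>2)"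
      using elim(1) less_le_trans[OF exp_gt_zero elim(1)] by (intro divide_left_mono) auto
    also have "\<dots> = 2 * 4 ^ n * exp (- \<epsilon>\<^sup>2 * (real n)\<^sup>2 / 16)"
    proof -
      have "exp (- \<epsilon>\<^sup>2 * (real n)\<^sup>2 / 8) / exp (- (\<epsilon>\<^sup>2 / 16) * (real n)\<^sup>2) = exp (- \<epsilon>\<^sup>2 * (real n)\<^sup>2 / 16)"
        unfolding exp_diff[symmetric] by (simp add: field_simps)
      then show ?thesis by (simp only: times_divide_eq_right[symmetric])
    qed
    also have "\<dots> \<le> (1 / 2) ^ n" by (rule elim(2))
    finally show ?case .
  qed
  from eventually_sequentially_Suc[THEN iffD2, OF this]
  have "eventually (\<lambda>n. norm (measure M (A n)) \<le> (1 / 2) ^ Suc n) sequentially"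
    unfolding A_def by simp
  moreover have "summable (\<lambda>n. (1 / 2 :: real) ^ Suc n)"
    by (subst summable_Suc_iff) (simp add: summable_geometric)
  ultimately have "summable (\<lambda>n. measure M (A n))"
    by (rule summable_comparison_test_ev)
  then have "AE \<omega> in M. eventually (\<lambda>n. \<omega> \<in> space M - A n) sequentially"
    using sets by (intro borel_cantelli_AE1) (auto simp: M.emeasure_eq_measure)
  then show ?thesis
  proof eventually_elim
    case (elim \<omega>)
    then have "eventually (\<lambda>n. cut_close (Suc n) (edge_prob g (Suc n)) \<epsilon> (edges (G (Suc n) \<omega>))) sequentially"
      by eventually_elim (simp add: A_def)
    then show ?case by (rule eventually_sequentially_Suc[THEN iffD1])
  qed
qed

lemma AE_converges_to_beta_graphon:
  fixes d :: "nat \<Rightarrow> nat \<Rightarrow> nat"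
  assumes M: "prob_space M" and gD: "g \<in> Dprime" and sol: "solves_limit_equation f g"
    and d: "\<And>n. n \<ge> 1 \<Longrightarrow> ordered_degree_sequence n (d n)" and lim: "scaling_limit d f"
    and G: "\<And>n. n \<ge> 1 \<Longrightarrow> uniform_random_graph M n (d n) (G n)"
  shows "AE \<omega> in M. converges_to_graphon (\<lambda>n. G n \<omega>) (beta_graphon g)"
proof -
  have g: "antimono_on {0..1} g" using gD by (simp add: Dprime_def)
  have "AE \<omega> in M. \<forall>m. eventually (\<lambda>n. cut_close n (edge_prob g n) (1 / real (Suc m)) (edges (G n \<omega>))) sequentially"
    unfolding AE_all_countable
    by (intro allI AE_eventually_cut_close[OF M g sol d lim G]) auto
  then show ?thesis
    using AE_space
  proof eventually_elim
    case (elim \<omega>)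
    have *: "G n \<omega> \<in> graphs_with_degrees n (d n)" if "n \<ge> 1" for n
      using measurable_space[of "G n" M "count_space (graphs_with_degrees n (d n))" \<omega>] G[OF that] elim(2)
      by (simp add: uniform_random_graph_def)
    show ?case
    proof (rule converges_of_cut_close[OF g])
      show "edges (G n \<omega>) \<subseteq> all_edges n" "G n \<omega> = ({1..n}, edges (G n \<omega>))" if "n \<ge> 1" for n
        using *[OF that] by (auto simp: graphs_with_degrees_eq degree_class_def)
    qed (use elim(1) in blast)
  qed
qed

theorem theorem1p1:
  fixes M :: "'w measure"
    and d :: "nat \<Rightarrow> nat \<Rightarrow> nat"
    and G :: "nat \<Rightarrow> 'w \<Rightarrow> nat graph"
    and f :: "real \<Rightarrow> real"
  assumes "prob_space M"
    and "\<And>n. n \<ge> 1 \<Longrightarrow> ordered_degree_sequence n (d n)"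
    and "\<And>n. n \<ge> 1 \<Longrightarrow> uniform_random_graph M n (d n) (G n)"
    and "f \<in> Dprime"
    and "scaling_limit d f"
    and "f \<in> Dprime_topology interior_of scaling_limits"
  shows "(\<exists>!g. g \<in> Dprime \<and> solves_limit_equation f g) \<and>
    (\<forall>g. g \<in> Dprime \<and> solves_limit_equation f g \<longrightarrow>
      (AE \<omega> in M. converges_to_graphon (\<lambda>n. G n \<omega>) (beta_graphon g)))"
  using limit_equation_solvable[OF assms(4,6)] AE_converges_to_beta_graphon[OF assms(1) _ _ assms(2,5,3)]
  by blast

end
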